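(* Let $\Sigma$ be a monoidal signature. A cospan $m\to F\leftarrow n$ in $\mathrm{Csp}_D(\mathbf{Hyp}_\Sigma)$ is in the image of the composite $[\![\mathcal{I}(-)]\!]:\mathbf{STMC}(\Sigma)\to\mathrm{Csp}_D(\mathbf{Hyp}_\Sigma)$ if and only if it is partial monogamous.
   Context: A monoidal signature $\Sigma$ is a set of generators $\phi$, each with an arity and a coarity in $\mathbb{N}$. A hypergraph $F$ consists of a set $F_\star$ of vertices and, for each $k,l\in\mathbb{N}$, a set $F_{k,l}$ of hyperedges, with functions $s_i:F_{k,l}\to F_\star$ ($i<k$) and $t_j:F_{k,l}\to F_\star$ ($j<l$) giving the $i$-th source and $j$-th target; a morphism of hypergraphs is a family of functions on vertices and hyperedges commuting with all $s_i,t_j$. $\mathbf{Hyp}_\Sigma$ is the category of $\Sigma$-labelled hypergraphs: hypergraphs with each hyperedge in $F_{k,l}$ labelled by a generator of arity $k$ and coarity $l$, and label-preserving morphisms. For $n\in\mathbb{N}$ the discrete hypergraph $n$ has vertices $0,\dots,n-1$ and no hyperedges. $\mathrm{Csp}_D(\mathbf{Hyp}_\Sigma)$ is the PROP whose morphisms $m\to n$ are isomorphism classes of cospans $m\xrightarrow{f}F\xleftarrow{g}n$ in $\mathbf{Hyp}_\Sigma$; composition is by pushout, monoidal product by disjoint union. The degree of a vertex $v$ is $(\mathrm{in},\mathrm{out})$, where $\mathrm{in}$ is the number of pairs $(e,j)$ with $v=t_j(e)$ and $\mathrm{out}$ the number of pairs $(e,i)$ with $v=s_i(e)$. A cospan $m\xrightarrow{f}F\xleftarrow{g}n$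 is partial monogamous if $f,g$ are injective and every vertex has degree $(0,0)$ if it is in the images of both $f$ and $g$, $(0,1)$ if only in the image of $f$, $(1,0)$ if only in the image of $g$, and $(0,0)$ or $(1,1)$ otherwise. $\mathrm{Csp}_D(\mathbf{Hyp}_\Sigma)$ has for each $n$ the Frobenius structure given by the discrete cospans merge $n+n\to n\leftarrow n$, unit $0\to n\leftarrow n$, copy $n\to n\leftarrow n+n$, counit $n\to n\leftarrow 0$. $\mathbf{STMC}(\Sigma)$ is the free symmetric traced monoidal category (traced PROP) on $\Sigma$. $\mathbf{SMC}(\Sigma)+\mathbf{Frob}$ is the coproduct of the free symmetric monoidal PROP on $\Sigma$ with the PROP $\mathbf{Frob}$ of special commutative Frobenius algebras (generators merge, unit, copy, counit); it is compact closed with cup $=$ unit;copy, cap $=$ merge;counit, and its canonical trace is $\mathrm{Tr}^x(h)=(\mathrm{cup}_x\otimes\mathrm{id}_m);(\mathrm{id}_x\otimes h);(\mathrm{cap}_x\otimes\mathrm{id}_n)$. $\mathcal{I}:\mathbf{STMC}(\Sigma)\to\mathbf{SMC}(\Sigma)+\mathbf{Frob}$ is the inclusion sending generators to themselves and the trace to the canonical trace. $[\![-]\!]:\mathbf{SMC}(\Sigma)+\mathbf{Frob}\to\mathrm{Csp}_D(\mathbf{Hyp}_\Sigma)$ is the PROP morphism sending $\phi:m\to n$ to $m\to E_\phi\leftarrow n$, where $E_\phi$ has $m+n$ vertices and a single hyperedge labelled $\phi$ with sources the $m$ left-interface vertices and targets the $n$ right-interface vertices (in order), and sending the Frobenius generators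 to the discrete cospans above.
   Formalization: Hypergraphs are assumed to have finitely many vertices and hyperedges; otherwise the claim fails: 0→F←0 with F infinitely many isolated vertices is partial monogamous but not in the image. *)

theory Defs
  imports Main
begin

section \<open>Signatures and labelled hypergraphs\<close>

record 'g signature =
  gens :: "'g set"
  ar :: "'g \<Rightarrow> nat"
  coar :: "'g \<Rightarrow> nat"

text \<open>The sources and targets of a hyperedge are given as lists, so \<open>F\<^bsub>k,l\<^esub>\<close> is the set of edges
  with \<open>k\<close> sources and \<open>l\<close> targets, and \<open>s\<^sub>i e\<close> is \<open>src F e ! i\<close>.\<close>

record ('v, 'e, 'g) hypergraph =
  verts :: "'v set"
  edges :: "'e set"
  src :: "'e \<Rightarrow> 'v list"
  tgt :: "'e \<Rightarrow> 'v list"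
  lab :: "'e \<Rightarrow> 'g"

text \<open>Hypergraphs are finite: a term only has finitely many generators and wires, so an infinite
  hypergraph is never the interpretation of a term, even if it is partial monogamous.\<close>

definition hyp :: "'g signature \<Rightarrow> ('v, 'e, 'g) hypergraph \<Rightarrow> bool" where
  "hyp \<Sigma> F \<longleftrightarrow> finite (verts F) \<and> finite (edges F) \<and>
     (\<forall>e \<in> edges F. set (src F e) \<subseteq> verts F \<and> set (tgt F e) \<subseteq> verts F \<and> lab F e \<in> gens \<Sigma> \<and>
        length (src F e) = ar \<Sigma> (lab F e) \<and> length (tgt F e) = coar \<Sigma> (lab F e))"

type_synonym ('v, 'e, 'w, 'f) hmap = "('v \<Rightarrow> 'w) \<times> ('e \<Rightarrow> 'f)"

definition hyp_mor ::
  "('v, 'e, 'g) hypergraph \<Rightarrow> ('w, 'f, 'g) hypergraph \<Rightarrow> ('v, 'e, 'w, 'f) hmap \<Rightarrow> bool" where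
  "hyp_mor F G h \<longleftrightarrow> fst h ` verts F \<subseteq> verts G \<and> snd h ` edges F \<subseteq> edges G \<and>
     (\<forall>e \<in> edges F. src G (snd h e) = map (fst h) (src F e) \<and>
        tgt G (snd h e) = map (fst h) (tgt F e) \<and> lab G (snd h e) = lab F e)"

definition hmap_comp ::
  "('w, 'f, 'x, 'h) hmap \<Rightarrow> ('v, 'e, 'w, 'f) hmap \<Rightarrow> ('v, 'e, 'x, 'h) hmap" where
  "hmap_comp k h = (fst k \<circ> fst h, snd k \<circ> snd h)"

text \<open>Equality of morphisms out of \<open>F\<close>; values outside the carriers of \<open>F\<close> are irrelevant.\<close>

definition hmap_eq ::
  "('v, 'e, 'g) hypergraph \<Rightarrow> ('v, 'e, 'w, 'f) hmap \<Rightarrow> ('v, 'e, 'w, 'f) hmap \<Rightarrow> bool" where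
  "hmap_eq F h k \<longleftrightarrow> (\<forall>v \<in> verts F. fst h v = fst k v) \<and> (\<forall>e \<in> edges F. snd h e = snd k e)"

definition hyp_sum ::
  "('v, 'e, 'g) hypergraph \<Rightarrow> ('w, 'f, 'g) hypergraph \<Rightarrow> ('v + 'w, 'e + 'f, 'g) hypergraph" where
  "hyp_sum F G =
     \<lparr> verts = verts F <+> verts G,
       edges = edges F <+> edges G,
       src = case_sum (\<lambda>e. map Inl (src F e)) (\<lambda>e. map Inr (src G e)),
       tgt = case_sum (\<lambda>e. map Inl (tgt F e)) (\<lambda>e. map Inr (tgt G e)),
       lab = case_sum (lab F) (lab G) \<rparr>"

definition in_deg :: "('v, 'e, 'g) hypergraph \<Rightarrow> 'v \<Rightarrow> nat" where
  "in_deg F v = card {(e, j). e \<in> edges F \<and> j < length (tgt F e) \<and> v = tgt F e ! j}"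

definition out_deg :: "('v, 'e, 'g) hypergraph \<Rightarrow> 'v \<Rightarrow> nat" where
  "out_deg F v = card {(e, i). e \<in> edges F \<and> i < length (src F e) \<and> v = src F e ! i}"

definition degree :: "('v, 'e, 'g) hypergraph \<Rightarrow> 'v \<Rightarrow> nat \<times> nat" where
  "degree F v = (in_deg F v, out_deg F v)"


section \<open>Cospans with discrete feet\<close>

text \<open>A morphism from the discrete hypergraph \<open>n\<close> to \<open>F\<close> is a function from \<open>{0..<n}\<close> to the
  vertices of \<open>F\<close>; it is represented by the list of its \<open>n\<close> values.\<close>

record ('v, 'e, 'g) cospan =
  apex :: "('v, 'e, 'g) hypergraph"
  left :: "'v list"
  right :: "'v list"

definition is_cospan :: "'g signature \<Rightarrow> nat \<Rightarrow> nat \<Rightarrow> ('v, 'e, 'g) cospan \<Rightarrow> bool" where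
  "is_cospan \<Sigma> m n C \<longleftrightarrow> hyp \<Sigma> (apex C) \<and>
     length (left C) = m \<and> set (left C) \<subseteq> verts (apex C) \<and>
     length (right C) = n \<and> set (right C) \<subseteq> verts (apex C)"

definition partial_monogamous :: "('v, 'e, 'g) cospan \<Rightarrow> bool" where
  "partial_monogamous C \<longleftrightarrow> distinct (left C) \<and> distinct (right C) \<and>
     (\<forall>v \<in> verts (apex C).
        (v \<in> set (left C) \<and> v \<in> set (right C) \<longrightarrow> degree (apex C) v = (0, 0)) \<and>
        (v \<in> set (left C) \<and> v \<notin> set (right C) \<longrightarrow> degree (apex C) v = (0, 1)) \<and>
        (v \<notin> set (left C) \<and> v \<in> set (right C) \<longrightarrow> degree (apex C) v = (1, 0)) \<and>
        (v \<notin> set (left C) \<and> v \<notin> set (right C) \<longrightarrow> degree (apex C) v \<in> {(0, 0), (1, 1)}))"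

definition cospan_iso :: "('v, 'e, 'g) cospan \<Rightarrow> ('w, 'f, 'g) cospan \<Rightarrow> bool" where
  "cospan_iso C D \<longleftrightarrow> (\<exists>h. hyp_mor (apex C) (apex D) h \<and>
     bij_betw (fst h) (verts (apex C)) (verts (apex D)) \<and>
     bij_betw (snd h) (edges (apex C)) (edges (apex D)) \<and>
     map (fst h) (left C) = left D \<and> map (fst h) (right C) = right D)"

text \<open>Every finite hypergraph is isomorphic to one whose vertices and edges are natural numbers,
  so the isomorphism class of a cospan is represented by its members over \<open>nat\<close>; these sets are the
  morphisms of \<open>Csp\<^sub>D(Hyp\<^sub>\<Sigma>)\<close>.\<close>

type_synonym 'g csp = "(nat, nat, 'g) cospan set"

definition csp_class :: "('v, 'e, 'g) cospan \<Rightarrow> 'g csp" where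
  "csp_class C = {D. cospan_iso C D}"

text \<open>The square formed by \<open>g : n \<rightarrow> F\<close>, \<open>f : n \<rightarrow> G\<close>, \<open>p : F \<rightarrow> P\<close> and \<open>q : G \<rightarrow> P\<close> is a pushout
  in \<open>Hyp\<^sub>\<Sigma>\<close>.\<close>

definition pushout ::
  "'g signature \<Rightarrow> nat list \<Rightarrow> nat list \<Rightarrow>
   (nat, nat, 'g) hypergraph \<Rightarrow> (nat, nat, 'g) hypergraph \<Rightarrow> (nat, nat, 'g) hypergraph \<Rightarrow>
   (nat, nat, nat, nat) hmap \<Rightarrow> (nat, nat, nat, nat) hmap \<Rightarrow> bool" where
  "pushout \<Sigma> g f F G P p q \<longleftrightarrow>
     hyp \<Sigma> P \<and> hyp_mor F P p \<and> hyp_mor G P q \<and> map (fst p) g = map (fst q) f \<and>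
     (\<forall>(T :: (nat, nat, 'g) hypergraph) a b.
        hyp \<Sigma> T \<and> hyp_mor F T a \<and> hyp_mor G T b \<and> map (fst a) g = map (fst b) f \<longrightarrow>
        (\<exists>u. hyp_mor P T u \<and> hmap_eq F (hmap_comp u p) a \<and> hmap_eq G (hmap_comp u q) b \<and>
           (\<forall>u'. hyp_mor P T u' \<and> hmap_eq F (hmap_comp u' p) a \<and> hmap_eq G (hmap_comp u' q) b
              \<longrightarrow> hmap_eq P u' u)))"

definition csp_comp :: "'g signature \<Rightarrow> 'g csp \<Rightarrow> 'g csp \<Rightarrow> 'g csp" where
  "csp_comp \<Sigma> A B = {E. \<exists>C \<in> A. \<exists>D \<in> B. \<exists>p q.
     pushout \<Sigma> (right C) (left D) (apex C) (apex D) (apex E) p q \<and>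
     left E = map (fst p) (left C) \<and> right E = map (fst q) (right D)}"

definition cospan_sum ::
  "('v, 'e, 'g) cospan \<Rightarrow> ('w, 'f, 'g) cospan \<Rightarrow> ('v + 'w, 'e + 'f, 'g) cospan" where
  "cospan_sum C D =
     \<lparr> apex = hyp_sum (apex C) (apex D),
       left = map Inl (left C) @ map Inr (left D),
       right = map Inl (right C) @ map Inr (right D) \<rparr>"

definition csp_tensor :: "'g csp \<Rightarrow> 'g csp \<Rightarrow> 'g csp" where
  "csp_tensor A B = (\<Union>C \<in> A. \<Union>D \<in> B. csp_class (cospan_sum C D))"

definition discrete :: "nat \<Rightarrow> (nat, nat, 'g) hypergraph" where
  "discrete n = \<lparr> verts = {0..<n}, edges = {}, src = (\<lambda>_. []), tgt = (\<lambda>_. []), lab = (\<lambda>_. undefined) \<rparr>"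

definition disc_csp :: "nat \<Rightarrow> nat list \<Rightarrow> nat list \<Rightarrow> 'g csp" where
  "disc_csp k f g = csp_class \<lparr> apex = discrete k, left = f, right = g \<rparr>"

definition gen_csp :: "'g signature \<Rightarrow> 'g \<Rightarrow> 'g csp" where
  "gen_csp \<Sigma> \<phi> = (let m = ar \<Sigma> \<phi>; n = coar \<Sigma> \<phi> in
     csp_class
       \<lparr> apex = \<lparr> verts = {0..<m + n}, edges = {0 :: nat}, src = (\<lambda>_. [0..<m]),
                  tgt = (\<lambda>_. [m..<m + n]), lab = (\<lambda>_. \<phi>) \<rparr>,
         left = [0..<m], right = [m..<m + n] \<rparr>)"


section \<open>The free traced PROP\<close>

text \<open>\<open>TTr x m n t\<close> is the trace over \<open>x\<close> of \<open>t : x + m \<rightarrow> x + n\<close>, the traced wires being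
  the first \<open>x\<close> ones on each side. Composition is in diagrammatic order.\<close>

datatype 'g tterm =
    TGen 'g
  | TId nat
  | TSym nat nat
  | TSeq "'g tterm" "'g tterm" (infixl \<open>;\<^sub>t\<close> 60)
  | TTen "'g tterm" "'g tterm" (infixl \<open>\<otimes>\<^sub>t\<close> 65)
  | TTr nat nat nat "'g tterm"

inductive t_typed :: "'g signature \<Rightarrow> nat \<Rightarrow> nat \<Rightarrow> 'g tterm \<Rightarrow> bool" for \<Sigma> where
  "\<phi> \<in> gens \<Sigma> \<Longrightarrow> t_typed \<Sigma> (ar \<Sigma> \<phi>) (coar \<Sigma> \<phi>) (TGen \<phi>)"
| "t_typed \<Sigma> n n (TId n)"
| "t_typed \<Sigma> (m + n) (n + m) (TSym m n)"
| "t_typed \<Sigma> m n s \<Longrightarrow> t_typed \<Sigma> n p t \<Longrightarrow> t_typed \<Sigma> m p (s ;\<^sub>t t)"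
| "t_typed \<Sigma> m n s \<Longrightarrow> t_typed \<Sigma> p q t \<Longrightarrow> t_typed \<Sigma> (m + p) (n + q) (s \<otimes>\<^sub>t t)"
| "t_typed \<Sigma> (x + m) (x + n) t \<Longrightarrow> t_typed \<Sigma> m n (TTr x m n t)"

inductive t_eq :: "'g signature \<Rightarrow> nat \<Rightarrow> nat \<Rightarrow> 'g tterm \<Rightarrow> 'g tterm \<Rightarrow> bool" for \<Sigma> where
  t_refl: "t_typed \<Sigma> m n t \<Longrightarrow> t_eq \<Sigma> m n t t"
| t_sym: "t_eq \<Sigma> m n s t \<Longrightarrow> t_eq \<Sigma> m n t s"
| t_trans: "t_eq \<Sigma> m n s t \<Longrightarrow> t_eq \<Sigma> m n t u \<Longrightarrow> t_eq \<Sigma> m n s u"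
| t_cong_seq: "t_eq \<Sigma> m n s s' \<Longrightarrow> t_eq \<Sigma> n p t t' \<Longrightarrow> t_eq \<Sigma> m p (s ;\<^sub>t t) (s' ;\<^sub>t t')"
| t_cong_ten: "t_eq \<Sigma> m n s s' \<Longrightarrow> t_eq \<Sigma> p q t t' \<Longrightarrow>
    t_eq \<Sigma> (m + p) (n + q) (s \<otimes>\<^sub>t t) (s' \<otimes>\<^sub>t t')"
| t_cong_tr: "t_eq \<Sigma> (x + m) (x + n) t t' \<Longrightarrow> t_eq \<Sigma> m n (TTr x m n t) (TTr x m n t')"
  \<comment> \<open>strict symmetric monoidal structure\<close>
| t_seq_assoc: "t_typed \<Sigma> m n s \<Longrightarrow> t_typed \<Sigma> n p t \<Longrightarrow> t_typed \<Sigma> p q u \<Longrightarrow>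
    t_eq \<Sigma> m q ((s ;\<^sub>t t) ;\<^sub>t u) (s ;\<^sub>t (t ;\<^sub>t u))"
| t_id_left: "t_typed \<Sigma> m n t \<Longrightarrow> t_eq \<Sigma> m n (TId m ;\<^sub>t t) t"
| t_id_right: "t_typed \<Sigma> m n t \<Longrightarrow> t_eq \<Sigma> m n (t ;\<^sub>t TId n) t"
| t_ten_assoc: "t_typed \<Sigma> m n s \<Longrightarrow> t_typed \<Sigma> m' n' t \<Longrightarrow> t_typed \<Sigma> m'' n'' u \<Longrightarrow>
    t_eq \<Sigma> (m + m' + m'') (n + n' + n'') ((s \<otimes>\<^sub>t t) \<otimes>\<^sub>t u) (s \<otimes>\<^sub>t (t \<otimes>\<^sub>t u))"
| t_ten_unit_left: "t_typed \<Sigma> m n t \<Longrightarrow> t_eq \<Sigma> m n (TId 0 \<otimes>\<^sub>t t) t"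
| t_ten_unit_right: "t_typed \<Sigma> m n t \<Longrightarrow> t_eq \<Sigma> m n (t \<otimes>\<^sub>t TId 0) t"
| t_ten_id: "t_eq \<Sigma> (m + n) (m + n) (TId m \<otimes>\<^sub>t TId n) (TId (m + n))"
| t_interchange: "t_typed \<Sigma> m n s \<Longrightarrow> t_typed \<Sigma> n p t \<Longrightarrow> t_typed \<Sigma> m' n' s' \<Longrightarrow> t_typed \<Sigma> n' p' t' \<Longrightarrow>
    t_eq \<Sigma> (m + m') (p + p') ((s ;\<^sub>t t) \<otimes>\<^sub>t (s' ;\<^sub>t t')) ((s \<otimes>\<^sub>t s') ;\<^sub>t (t \<otimes>\<^sub>t t'))"
| t_sym_nat: "t_typed \<Sigma> m n s \<Longrightarrow> t_typed \<Sigma> p q t \<Longrightarrow>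
    t_eq \<Sigma> (m + p) (q + n) ((s \<otimes>\<^sub>t t) ;\<^sub>t TSym n q) (TSym m p ;\<^sub>t (t \<otimes>\<^sub>t s))"
| t_sym_inv: "t_eq \<Sigma> (m + n) (m + n) (TSym m n ;\<^sub>t TSym n m) (TId (m + n))"
| t_sym_hex: "t_eq \<Sigma> (m + n + p) (n + p + m)
    (TSym m (n + p)) ((TSym m n \<otimes>\<^sub>t TId p) ;\<^sub>t (TId n \<otimes>\<^sub>t TSym m p))"
| t_sym_unit: "t_eq \<Sigma> m m (TSym m 0) (TId m)"
  \<comment> \<open>trace\<close>
| t_tightening: "t_typed \<Sigma> m' m s \<Longrightarrow> t_typed \<Sigma> (x + m) (x + n) t \<Longrightarrow> t_typed \<Sigma> n n' u \<Longrightarrow>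
    t_eq \<Sigma> m' n' (TTr x m' n' ((TId x \<otimes>\<^sub>t s) ;\<^sub>t t ;\<^sub>t (TId x \<otimes>\<^sub>t u))) (s ;\<^sub>t TTr x m n t ;\<^sub>t u)"
| t_sliding: "t_typed \<Sigma> (x + m) (y + n) t \<Longrightarrow> t_typed \<Sigma> y x s \<Longrightarrow>
    t_eq \<Sigma> m n (TTr x m n (t ;\<^sub>t (s \<otimes>\<^sub>t TId n))) (TTr y m n ((s \<otimes>\<^sub>t TId m) ;\<^sub>t t))"
| t_vanishing_unit: "t_typed \<Sigma> m n t \<Longrightarrow> t_eq \<Sigma> m n (TTr 0 m n t) t"
| t_vanishing_sum: "t_typed \<Sigma> (x + y + m) (x + y + n) t \<Longrightarrow>
    t_eq \<Sigma> m n (TTr (x + y) m n t) (TTr y m n (TTr x (y + m) (y + n) t))"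
| t_superposing: "t_typed \<Sigma> (x + m) (x + n) t \<Longrightarrow> t_typed \<Sigma> p q s \<Longrightarrow>
    t_eq \<Sigma> (m + p) (n + q) (TTr x (m + p) (n + q) (t \<otimes>\<^sub>t s)) (TTr x m n t \<otimes>\<^sub>t s)"
| t_yanking: "t_eq \<Sigma> x x (TTr x x x (TSym x x)) (TId x)"

definition stmc_hom :: "'g signature \<Rightarrow> nat \<Rightarrow> nat \<Rightarrow> 'g tterm set set" where
  "stmc_hom \<Sigma> m n = {t. t_typed \<Sigma> m n t} // {(s, t). t_eq \<Sigma> m n s t}"


section \<open>The coproduct of the free PROP with the PROP of special commutative Frobenius algebras\<close>

text \<open>The coproduct of two presented PROPs is presented by the disjoint union of the generators and
  of the equations.\<close>

datatype 'g fterm =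
    FGen 'g
  | Merge | Unit | Copy | Counit
  | FId nat
  | FSym nat nat
  | FSeq "'g fterm" "'g fterm" (infixl \<open>;\<^sub>f\<close> 60)
  | FTen "'g fterm" "'g fterm" (infixl \<open>\<otimes>\<^sub>f\<close> 65)

inductive f_typed :: "'g signature \<Rightarrow> nat \<Rightarrow> nat \<Rightarrow> 'g fterm \<Rightarrow> bool" for \<Sigma> where
  "\<phi> \<in> gens \<Sigma> \<Longrightarrow> f_typed \<Sigma> (ar \<Sigma> \<phi>) (coar \<Sigma> \<phi>) (FGen \<phi>)"
| "f_typed \<Sigma> 2 1 Merge"
| "f_typed \<Sigma> 0 1 Unit"
| "f_typed \<Sigma> 1 2 Copy"
| "f_typed \<Sigma> 1 0 Counit"
| "f_typed \<Sigma> n n (FId n)"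
| "f_typed \<Sigma> (m + n) (n + m) (FSym m n)"
| "f_typed \<Sigma> m n s \<Longrightarrow> f_typed \<Sigma> n p t \<Longrightarrow> f_typed \<Sigma> m p (s ;\<^sub>f t)"
| "f_typed \<Sigma> m n s \<Longrightarrow> f_typed \<Sigma> p q t \<Longrightarrow> f_typed \<Sigma> (m + p) (n + q) (s \<otimes>\<^sub>f t)"

inductive f_eq :: "'g signature \<Rightarrow> nat \<Rightarrow> nat \<Rightarrow> 'g fterm \<Rightarrow> 'g fterm \<Rightarrow> bool" for \<Sigma> where
  f_refl: "f_typed \<Sigma> m n t \<Longrightarrow> f_eq \<Sigma> m n t t"
| f_sym: "f_eq \<Sigma> m n s t \<Longrightarrow> f_eq \<Sigma> m n t s"
| f_trans: "f_eq \<Sigma> m n s t \<Longrightarrow> f_eq \<Sigma> m n t u \<Longrightarrow> f_eq \<Sigma> m n s u"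
| f_cong_seq: "f_eq \<Sigma> m n s s' \<Longrightarrow> f_eq \<Sigma> n p t t' \<Longrightarrow> f_eq \<Sigma> m p (s ;\<^sub>f t) (s' ;\<^sub>f t')"
| f_cong_ten: "f_eq \<Sigma> m n s s' \<Longrightarrow> f_eq \<Sigma> p q t t' \<Longrightarrow>
    f_eq \<Sigma> (m + p) (n + q) (s \<otimes>\<^sub>f t) (s' \<otimes>\<^sub>f t')"
  \<comment> \<open>strict symmetric monoidal structure\<close>
| f_seq_assoc: "f_typed \<Sigma> m n s \<Longrightarrow> f_typed \<Sigma> n p t \<Longrightarrow> f_typed \<Sigma> p q u \<Longrightarrow>
    f_eq \<Sigma> m q ((s ;\<^sub>f t) ;\<^sub>f u) (s ;\<^sub>f (t ;\<^sub>f u))"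
| f_id_left: "f_typed \<Sigma> m n t \<Longrightarrow> f_eq \<Sigma> m n (FId m ;\<^sub>f t) t"
| f_id_right: "f_typed \<Sigma> m n t \<Longrightarrow> f_eq \<Sigma> m n (t ;\<^sub>f FId n) t"
| f_ten_assoc: "f_typed \<Sigma> m n s \<Longrightarrow> f_typed \<Sigma> m' n' t \<Longrightarrow> f_typed \<Sigma> m'' n'' u \<Longrightarrow>
    f_eq \<Sigma> (m + m' + m'') (n + n' + n'') ((s \<otimes>\<^sub>f t) \<otimes>\<^sub>f u) (s \<otimes>\<^sub>f (t \<otimes>\<^sub>f u))"
| f_ten_unit_left: "f_typed \<Sigma> m n t \<Longrightarrow> f_eq \<Sigma> m n (FId 0 \<otimes>\<^sub>f t) t"
| f_ten_unit_right: "f_typed \<Sigma> m n t \<Longrightarrow> f_eq \<Sigma> m n (t \<otimes>\<^sub>f FId 0) t"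
| f_ten_id: "f_eq \<Sigma> (m + n) (m + n) (FId m \<otimes>\<^sub>f FId n) (FId (m + n))"
| f_interchange: "f_typed \<Sigma> m n s \<Longrightarrow> f_typed \<Sigma> n p t \<Longrightarrow> f_typed \<Sigma> m' n' s' \<Longrightarrow> f_typed \<Sigma> n' p' t' \<Longrightarrow>
    f_eq \<Sigma> (m + m') (p + p') ((s ;\<^sub>f t) \<otimes>\<^sub>f (s' ;\<^sub>f t')) ((s \<otimes>\<^sub>f s') ;\<^sub>f (t \<otimes>\<^sub>f t'))"
| f_sym_nat: "f_typed \<Sigma> m n s \<Longrightarrow> f_typed \<Sigma> p q t \<Longrightarrow>
    f_eq \<Sigma> (m + p) (q + n) ((s \<otimes>\<^sub>f t) ;\<^sub>f FSym n q) (FSym m p ;\<^sub>f (t \<otimes>\<^sub>f s))"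
| f_sym_inv: "f_eq \<Sigma> (m + n) (m + n) (FSym m n ;\<^sub>f FSym n m) (FId (m + n))"
| f_sym_hex: "f_eq \<Sigma> (m + n + p) (n + p + m)
    (FSym m (n + p)) ((FSym m n \<otimes>\<^sub>f FId p) ;\<^sub>f (FId n \<otimes>\<^sub>f FSym m p))"
| f_sym_unit: "f_eq \<Sigma> m m (FSym m 0) (FId m)"
  \<comment> \<open>special commutative Frobenius algebra\<close>
| f_merge_assoc: "f_eq \<Sigma> 3 1 ((Merge \<otimes>\<^sub>f FId 1) ;\<^sub>f Merge) ((FId 1 \<otimes>\<^sub>f Merge) ;\<^sub>f Merge)"
| f_merge_unit: "f_eq \<Sigma> 1 1 ((Unit \<otimes>\<^sub>f FId 1) ;\<^sub>f Merge) (FId 1)"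
| f_merge_comm: "f_eq \<Sigma> 2 1 (FSym 1 1 ;\<^sub>f Merge) Merge"
| f_copy_assoc: "f_eq \<Sigma> 1 3 (Copy ;\<^sub>f (Copy \<otimes>\<^sub>f FId 1)) (Copy ;\<^sub>f (FId 1 \<otimes>\<^sub>f Copy))"
| f_copy_counit: "f_eq \<Sigma> 1 1 (Copy ;\<^sub>f (Counit \<otimes>\<^sub>f FId 1)) (FId 1)"
| f_copy_comm: "f_eq \<Sigma> 1 2 (Copy ;\<^sub>f FSym 1 1) Copy"
| f_frob_left: "f_eq \<Sigma> 2 2 ((Copy \<otimes>\<^sub>f FId 1) ;\<^sub>f (FId 1 \<otimes>\<^sub>f Merge)) (Merge ;\<^sub>f Copy)"
| f_frob_right: "f_eq \<Sigma> 2 2 ((FId 1 \<otimes>\<^sub>f Copy) ;\<^sub>f (Merge \<otimes>\<^sub>f FId 1)) (Merge ;\<^sub>f Copy)"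
| f_special: "f_eq \<Sigma> 1 1 (Copy ;\<^sub>f Merge) (FId 1)"

definition smcf_hom :: "'g signature \<Rightarrow> nat \<Rightarrow> nat \<Rightarrow> 'g fterm set set" where
  "smcf_hom \<Sigma> m n = {t. f_typed \<Sigma> m n t} // {(s, t). f_eq \<Sigma> m n s t}"

text \<open>The Frobenius structure on \<open>n\<close> wires: \<open>n\<close> copies of the structure on one wire, interleaved
  by symmetries.\<close>

primrec merge :: "nat \<Rightarrow> 'g fterm" where
  "merge 0 = FId 0"
| "merge (Suc n) = (FId 1 \<otimes>\<^sub>f FSym n 1 \<otimes>\<^sub>f FId n) ;\<^sub>f (Merge \<otimes>\<^sub>f merge n)"

primrec unit :: "nat \<Rightarrow> 'g fterm" where
  "unit 0 = FId 0"
| "unit (Suc n) = Unit \<otimes>\<^sub>f unit n"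

primrec copy :: "nat \<Rightarrow> 'g fterm" where
  "copy 0 = FId 0"
| "copy (Suc n) = (Copy \<otimes>\<^sub>f copy n) ;\<^sub>f (FId 1 \<otimes>\<^sub>f FSym 1 n \<otimes>\<^sub>f FId n)"

primrec counit :: "nat \<Rightarrow> 'g fterm" where
  "counit 0 = FId 0"
| "counit (Suc n) = Counit \<otimes>\<^sub>f counit n"

definition cup :: "nat \<Rightarrow> 'g fterm" where
  "cup x = unit x ;\<^sub>f copy x"

definition cap :: "nat \<Rightarrow> 'g fterm" where
  "cap x = merge x ;\<^sub>f counit x"

definition canonical_trace :: "nat \<Rightarrow> nat \<Rightarrow> nat \<Rightarrow> 'g fterm \<Rightarrow> 'g fterm" where
  "canonical_trace x m n h = (cup x \<otimes>\<^sub>f FId m) ;\<^sub>f (FId x \<otimes>\<^sub>f h) ;\<^sub>f (cap x \<otimes>\<^sub>f FId n)"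


section \<open>The two PROP morphisms\<close>

text \<open>As usual for maps on quotients, \<open>incl\<close> and \<open>interp\<close> are unions over representatives; since the
  maps on terms respect the equations, all representatives of a class contribute the same set.\<close>

primrec incl_term :: "'g tterm \<Rightarrow> 'g fterm" where
  "incl_term (TGen \<phi>) = FGen \<phi>"
| "incl_term (TId n) = FId n"
| "incl_term (TSym m n) = FSym m n"
| "incl_term (s ;\<^sub>t t) = incl_term s ;\<^sub>f incl_term t"
| "incl_term (s \<otimes>\<^sub>t t) = incl_term s \<otimes>\<^sub>f incl_term t"
| "incl_term (TTr x m n t) = canonical_trace x m n (incl_term t)"

definition incl :: "'g signature \<Rightarrow> nat \<Rightarrow> nat \<Rightarrow> 'g tterm set \<Rightarrow> 'g fterm set" where
  "incl \<Sigma> m n X = (\<Union>t \<in> X. {(s, u). f_eq \<Sigma> m n s u} `` {incl_term t})"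

primrec interp_term :: "'g signature \<Rightarrow> 'g fterm \<Rightarrow> 'g csp" where
  "interp_term \<Sigma> (FGen \<phi>) = gen_csp \<Sigma> \<phi>"
| "interp_term \<Sigma> Merge = disc_csp 1 [0, 0] [0]"
| "interp_term \<Sigma> Unit = disc_csp 1 [] [0]"
| "interp_term \<Sigma> Copy = disc_csp 1 [0] [0, 0]"
| "interp_term \<Sigma> Counit = disc_csp 1 [0] []"
| "interp_term \<Sigma> (FId n) = disc_csp n [0..<n] [0..<n]"
| "interp_term \<Sigma> (FSym m n) = disc_csp (m + n) [0..<m + n] ([m..<m + n] @ [0..<m])"
| "interp_term \<Sigma> (s ;\<^sub>f t) = csp_comp \<Sigma> (interp_term \<Sigma> s) (interp_term \<Sigma> t)"
| "interp_term \<Sigma> (s \<otimes>\<^sub>f t) = csp_tensor (interp_term \<Sigma> s) (interp_term \<Sigma> t)"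

definition interp :: "'g signature \<Rightarrow> 'g fterm set \<Rightarrow> 'g csp" where
  "interp \<Sigma> X = (\<Union>t \<in> X. interp_term \<Sigma> t)"

end

theory Submission
  imports Defs
begin

text \<open>A morphism from the hypergraph of a term into \<open>T\<close> is a \<^emph>\<open>valuation\<close> of the term in \<open>T\<close>. Valuations
  in \<open>T\<close> form a presheaf-like family \<open>S T\<close> with two boundary maps, and a cospan interprets the term
  iff its apex carries a universal valuation. Composition, tensor and trace of cospans
  become elementary operations on valuations, so each equation of the free traced PROP and of the
  Frobenius theory is checked by a natural bijection of valuations rather than with pushouts.

  A cospan is partial monogamous iff at every vertex the number of occurrences on the left
  interface or as a target equals the number of occurrences on the right interface or as a source,
  and is at most one. This balance survives identifying a vertex counted on the left with one
  counted on the right, hence composition and trace. Conversely, if a cospan is balanced, the targets of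
  its edges, its isolated vertices and its left interface enumerate the vertices without repetition,
  and so do the sources, the isolated vertices and the right interface. The permutation between the two
  enumerations, followed by the tensor of all generators and traced over the targets and the
  isolated vertices, is the required term.\<close>

section \<open>Morphisms of hypergraphs\<close>

text \<open>Maps out of a colimit are families of maps subject to equations: homming into
  \<open>T\<close> turns a coproduct into pairs, a pushout into pairs agreeing on the shared
  interface, and the coequaliser behind a trace into solutions of a feedback equation. Quotients
  thus disappear from the verification of the equations. They return only for existence, where
  vertices are glued one pair at a time; existence is a genuine obligation, since
  \<open>csp_comp\<close> is a comprehension and would be empty without a pushout.

  The trace cannot be handled through its definition by cup and cap: for a positive number of wires
  these are not balanced, only their combination preserves balance. Hence the trace gets an
  operation \<open>trS\<close> of its own, proved to agree with the canonical trace.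

  A vertex of degree (0,0) off both interfaces is a closed loop, the trace of an identity wire. This
  is why such vertices are allowed, and why in the converse they become additional traced
  wires.\<close>

definition hmap_id :: "('v, 'e, 'v, 'e) hmap" where
  "hmap_id = (id, id)"

lemma hyp_mor_id: "hyp_mor F F hmap_id"
  by (simp add: hyp_mor_def hmap_id_def)

lemma hyp_mor_comp: "hyp_mor F G h \<Longrightarrow> hyp_mor G H k \<Longrightarrow> hyp_mor F H (hmap_comp k h)"
  by (auto simp: hyp_mor_def hmap_comp_def image_subset_iff)

text \<open>\<open>inv_into\<close> inverts only on the carriers, and well-formedness of
  \<open>F\<close> keeps its source and target lists there; the inverse laws accordingly hold up to
  \<open>hmap_eq\<close>.\<close>

lemma hyp_iso_inverse:
  assumes F: "hyp \<Sigma> F" and h: "hyp_mor F G h"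
    and b: "bij_betw (fst h) (verts F) (verts G)" "bij_betw (snd h) (edges F) (edges G)"
  shows "\<exists>k. hyp_mor G F k \<and> hmap_eq F (hmap_comp k h) hmap_id \<and> hmap_eq G (hmap_comp h k) hmap_id"
proof -
  define k where "k = (inv_into (verts F) (fst h), inv_into (edges F) (snd h))"
  have kv: "fst k (fst h v) = v" if "v \<in> verts F" for v
    using b(1) that by (auto simp: k_def bij_betw_def)
  have ke: "snd k (snd h e) = e" if "e \<in> edges F" for e
    using b(2) that by (auto simp: k_def bij_betw_def)
  have kv': "fst h (fst k v) = v" "fst k v \<in> verts F" if "v \<in> verts G" for v
    using b(1) that by (auto simp: k_def bij_betw_def f_inv_into_f inv_into_into)
  have ke': "snd h (snd k e) = e" "snd k e \<in> edges F" if "e \<in> edges G" for e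
    using b(2) that by (auto simp: k_def bij_betw_def f_inv_into_f inv_into_into)
  have lst: "map (fst k) (map (fst h) vs) = vs" if "set vs \<subseteq> verts F" for vs
    using that kv by (induction vs) auto
  have "hyp_mor G F k"
    unfolding hyp_mor_def
  proof (intro conjI ballI)
    fix e assume e: "e \<in> edges G"
    let ?e = "snd k e"
    have "set (src F ?e) \<subseteq> verts F" "set (tgt F ?e) \<subseteq> verts F"
      using F ke'(2)[OF e] by (auto simp: hyp_def)
    moreover have "src G e = map (fst h) (src F ?e)" "tgt G e = map (fst h) (tgt F ?e)"
      "lab G e = lab F ?e"
      using h ke'[OF e] by (auto simp: hyp_mor_def)
    ultimately show "src F ?e = map (fst k) (src G e)" "tgt F ?e = map (fst k) (tgt G e)"
      "lab F ?e = lab G e"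
      using lst by metis+
  qed (use kv' ke' in auto)
  then show ?thesis
    using kv ke kv' ke' by (intro exI[of _ k]) (auto simp: hmap_eq_def hmap_comp_def hmap_id_def)
qed

lemma hyp_iso:
  assumes F: "hyp \<Sigma> F" and h: "hyp_mor F G h"
    and b: "bij_betw (fst h) (verts F) (verts G)" "bij_betw (snd h) (edges F) (edges G)"
  shows "hyp \<Sigma> G"
  unfolding hyp_def
proof (intro conjI ballI)
  show "finite (verts G)" "finite (edges G)"
    using F b bij_betw_finite by (auto simp: hyp_def)
  fix e' assume "e' \<in> edges G"
  then obtain e where e: "e \<in> edges F" "e' = snd h e"
    using b(2) by (auto simp: bij_betw_def)
  have "fst h ` verts F \<subseteq> verts G" "src G e' = map (fst h) (src F e)"
    "tgt G e' = map (fst h) (tgt F e)" "lab G e' = lab F e"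
    using h e by (auto simp: hyp_mor_def)
  moreover have "set (src F e) \<subseteq> verts F" "set (tgt F e) \<subseteq> verts F" "lab F e \<in> gens \<Sigma>"
    "length (src F e) = ar \<Sigma> (lab F e)" "length (tgt F e) = coar \<Sigma> (lab F e)"
    using F e by (auto simp: hyp_def)
  ultimately show "set (src G e') \<subseteq> verts G" "set (tgt G e') \<subseteq> verts G" "lab G e' \<in> gens \<Sigma>"
    "length (src G e') = ar \<Sigma> (lab G e')" "length (tgt G e') = coar \<Sigma> (lab G e')"
    by auto
qed

lemma hmap_comp_simps [simp]:
  "fst (hmap_comp k h) = fst k \<circ> fst h" "snd (hmap_comp k h) = snd k \<circ> snd h"
  by (simp_all add: hmap_comp_def)

lemma hmap_id_simps [simp]: "fst hmap_id = id" "snd hmap_id = id"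
  by (simp_all add: hmap_id_def)

lemma hyp_mor_bij:
  assumes "hyp_mor F G h" "hyp_mor G F k"
    "hmap_eq F (hmap_comp k h) hmap_id" "hmap_eq G (hmap_comp h k) hmap_id"
  shows "bij_betw (fst h) (verts F) (verts G)" "bij_betw (snd h) (edges F) (edges G)"
  using assms
  by (auto simp: hyp_mor_def hmap_eq_def intro!: bij_betw_byWitness[where f' = "fst k"]
      bij_betw_byWitness[where f' = "snd k"])

lemma map_comp_inverse:
  assumes "hmap_eq F (hmap_comp k h) hmap_id" "set vs \<subseteq> verts F"
  shows "map (fst k) (map (fst h) vs) = vs"
  using assms by (induction vs) (auto simp: hmap_eq_def)

section \<open>Isomorphism of cospans\<close>

lemma cospan_isoD:
  assumes "cospan_iso C D" "hyp \<Sigma> (apex C)"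
  obtains h k where "hyp_mor (apex C) (apex D) h" "hyp_mor (apex D) (apex C) k"
    "hmap_eq (apex C) (hmap_comp k h) hmap_id" "hmap_eq (apex D) (hmap_comp h k) hmap_id"
    "left D = map (fst h) (left C)" "right D = map (fst h) (right C)" "hyp \<Sigma> (apex D)"
proof -
  from assms(1) obtain h where h: "hyp_mor (apex C) (apex D) h"
    "bij_betw (fst h) (verts (apex C)) (verts (apex D))"
    "bij_betw (snd h) (edges (apex C)) (edges (apex D))"
    "map (fst h) (left C) = left D" "map (fst h) (right C) = right D"
    by (auto simp: cospan_iso_def)
  show thesis
    using hyp_iso_inverse[OF assms(2) h(1-3)] hyp_iso[OF assms(2) h(1-3)] h that by metis
qed

lemma cospan_iso_sym:
  assumes "cospan_iso C D" "is_cospan \<Sigma> m n C"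
  shows "cospan_iso D C"
proof -
  have C: "hyp \<Sigma> (apex C)" "set (left C) \<subseteq> verts (apex C)" "set (right C) \<subseteq> verts (apex C)"
    using assms(2) by (auto simp: is_cospan_def)
  obtain h k where hk: "hyp_mor (apex C) (apex D) h" "hyp_mor (apex D) (apex C) k"
    "hmap_eq (apex C) (hmap_comp k h) hmap_id" "hmap_eq (apex D) (hmap_comp h k) hmap_id"
    "left D = map (fst h) (left C)" "right D = map (fst h) (right C)"
    using cospan_isoD[OF assms(1) C(1)] by metis
  show ?thesis
    unfolding cospan_iso_def
    using hk(2) hyp_mor_bij[OF hk(2) hk(1) hk(4) hk(3)] map_comp_inverse[OF hk(3)] C hk(5,6)
    by (intro exI[of _ k]) auto
qed

lemma cospan_iso_trans: "cospan_iso C D \<Longrightarrow> cospan_iso D E \<Longrightarrow> cospan_iso C E"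
proof -
  assume "cospan_iso C D" "cospan_iso D E"
  then obtain h k where "hyp_mor (apex C) (apex D) h" "hyp_mor (apex D) (apex E) k"
    "bij_betw (fst h) (verts (apex C)) (verts (apex D))"
    "bij_betw (snd h) (edges (apex C)) (edges (apex D))"
    "bij_betw (fst k) (verts (apex D)) (verts (apex E))"
    "bij_betw (snd k) (edges (apex D)) (edges (apex E))"
    "map (fst h) (left C) = left D" "map (fst h) (right C) = right D"
    "map (fst k) (left D) = left E" "map (fst k) (right D) = right E"
    unfolding cospan_iso_def by metis
  then show ?thesis
    unfolding cospan_iso_def
    by (intro exI[of _ "hmap_comp k h"]) (auto simp flip: map_map intro: hyp_mor_comp bij_betw_trans)
qed

lemma csp_class_eq:
  assumes "cospan_iso C D" "is_cospan \<Sigma> m n C"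
  shows "csp_class C = csp_class D"
  unfolding csp_class_def
  using cospan_iso_trans[OF assms(1)] cospan_iso_trans[OF cospan_iso_sym[OF assms]]
  by (intro Collect_cong iffI)

lemma is_cospan_iso:
  assumes "cospan_iso C D" "is_cospan \<Sigma> m n C"
  shows "is_cospan \<Sigma> m n D"
proof -
  have C: "hyp \<Sigma> (apex C)" using assms(2) by (simp add: is_cospan_def)
  from cospan_isoD[OF assms(1) C] obtain h where
    "hyp_mor (apex C) (apex D) h" "left D = map (fst h) (left C)" "right D = map (fst h) (right C)"
    "hyp \<Sigma> (apex D)" by metis
  then show ?thesis
    using assms(2) by (auto simp: is_cospan_def hyp_mor_def image_subset_iff)
qed

text \<open>Morphisms of the category and the test objects of \<open>pushout\<close> live over
  \<open>nat\<close>, while disjoint unions and the cospan of the theorem live over other types.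
  Finiteness provides the transfer.\<close>

lemma nat_copy:
  assumes "is_cospan \<Sigma> m n C"
  obtains N :: "(nat, nat, 'g) cospan" where "cospan_iso C N"
proof -
  define F where "F = apex C"
  have fin: "finite (verts F)" "finite (edges F)" using assms by (auto simp: is_cospan_def hyp_def F_def)
  obtain i where i: "bij_betw i (verts F) {0..<card (verts F)}"
    using ex_bij_betw_finite_nat[OF fin(1)] by blast
  obtain j where j: "bij_betw j (edges F) {0..<card (edges F)}"
    using ex_bij_betw_finite_nat[OF fin(2)] by blast
  define j' where "j' = inv_into (edges F) j"
  have j': "j' (j e) = e" if "e \<in> edges F" for e
    using j that by (simp add: j'_def bij_betw_def)
  define G where "G = \<lparr>verts = {0..<card (verts F)}, edges = {0..<card (edges F)},
    src = (\<lambda>e. map i (src F (j' e))), tgt = (\<lambda>e. map i (tgt F (j' e))), lab = (\<lambda>e. lab F (j' e))\<rparr>"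
  have "hyp_mor F G (i, j)"
    using i j j' by (auto simp: hyp_mor_def G_def bij_betw_def)
  then have "cospan_iso C \<lparr>apex = G, left = map i (left C), right = map i (right C)\<rparr>"
    unfolding cospan_iso_def using i j
    by (intro exI[of _ "(i, j)"]) (auto simp: F_def[symmetric] G_def)
  then show thesis using that by blast
qed


section \<open>Valuations\<close>

text \<open>A leaf records the edges and vertices hit, and the values on the left and right interfaces.\<close>

datatype ('v, 'e) valuation =
    VLeaf "'e list" "'v list" "'v list" "'v list"
  | VSeq "('v, 'e) valuation" "('v, 'e) valuation"
  | VTen "('v, 'e) valuation" "('v, 'e) valuation"
  | VTr nat "('v, 'e) valuation"

primrec lft :: "('v, 'e) valuation \<Rightarrow> 'v list" where
  "lft (VLeaf es vs l r) = l"
| "lft (VSeq a b) = lft a"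
| "lft (VTen a b) = lft a @ lft b"
| "lft (VTr x a) = drop x (lft a)"

primrec rgt :: "('v, 'e) valuation \<Rightarrow> 'v list" where
  "rgt (VLeaf es vs l r) = r"
| "rgt (VSeq a b) = rgt b"
| "rgt (VTen a b) = rgt a @ rgt b"
| "rgt (VTr x a) = drop x (rgt a)"

definition act ::
  "('v, 'e, 'w, 'f) hmap \<Rightarrow> ('v, 'e) valuation \<Rightarrow> ('w, 'f) valuation" where
  "act h = map_valuation (fst h) (snd h)"

lemma act_simps [simp]:
  "act h (VLeaf es vs l r) =
     VLeaf (map (snd h) es) (map (fst h) vs) (map (fst h) l) (map (fst h) r)"
  "act h (VSeq a b) = VSeq (act h a) (act h b)"
  "act h (VTen a b) = VTen (act h a) (act h b)"
  "act h (VTr x a) = VTr x (act h a)"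
  by (simp_all add: act_def)

lemma lft_act [simp]: "lft (act h a) = map (fst h) (lft a)"
  by (induction a) (auto simp: drop_map)

lemma rgt_act [simp]: "rgt (act h a) = map (fst h) (rgt a)"
  by (induction a) (auto simp: drop_map)

lemma set_lft: "set (lft a) \<subseteq> set1_valuation a"
  by (induction a) (auto dest: in_set_dropD)

lemma set_rgt: "set (rgt a) \<subseteq> set1_valuation a"
  by (induction a) (auto dest: in_set_dropD)

lemma act_comp: "act k (act h a) = act (hmap_comp k h) a"
  by (simp add: act_def valuation.map_comp)

lemma act_cong:
  assumes "set1_valuation a \<subseteq> verts F" "set2_valuation a \<subseteq> edges F" "hmap_eq F h k"
  shows "act h a = act k a"
  using assms unfolding act_def by (intro valuation.map_cong refl) (auto simp: hmap_eq_def)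

lemma act_id [simp]: "act hmap_id a = a"
  by (simp add: act_def valuation.map_id)

type_synonym 'g presheaf = "(nat, nat, 'g) hypergraph \<Rightarrow> (nat, nat) valuation set"

text \<open>A covariant set-valued functor; its functor laws are those of
  \<open>map_valuation\<close>. The bounds by the carriers make \<open>act h\<close> depend on
  \<open>h\<close> only up to \<open>hmap_eq\<close>.\<close>

definition presheaf :: "'g signature \<Rightarrow> nat \<Rightarrow> nat \<Rightarrow> 'g presheaf \<Rightarrow> bool" where
  "presheaf \<Sigma> m n S \<longleftrightarrow> (\<forall>T. hyp \<Sigma> T \<longrightarrow> (\<forall>a \<in> S T. length (lft a) = m \<and> length (rgt a) = n \<and>
     set1_valuation a \<subseteq> verts T \<and> set2_valuation a \<subseteq> edges T \<and>
     (\<forall>U h. hyp \<Sigma> U \<longrightarrow> hyp_mor T U h \<longrightarrow> act h a \<in> S U)))"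

lemma presheafD:
  assumes "presheaf \<Sigma> m n S" "hyp \<Sigma> T" "a \<in> S T"
  shows "length (lft a) = m" "length (rgt a) = n"
    "set1_valuation a \<subseteq> verts T" "set2_valuation a \<subseteq> edges T"
    "set (lft a) \<subseteq> verts T" "set (rgt a) \<subseteq> verts T"
    "hyp \<Sigma> U \<Longrightarrow> hyp_mor T U h \<Longrightarrow> act h a \<in> S U"
  using assms set_lft[of a] set_rgt[of a] unfolding presheaf_def by blast+

text \<open>By the Yoneda lemma, a universal valuation exhibits its hypergraph as representing \<open>S\<close>.\<close>

definition universal ::
  "'g signature \<Rightarrow> 'g presheaf \<Rightarrow> (nat, nat, 'g) hypergraph \<Rightarrow> (nat, nat) valuation \<Rightarrow> bool" where
  "universal \<Sigma> S F a \<longleftrightarrow> hyp \<Sigma> F \<and> a \<in> S F \<and> (\<forall>T. hyp \<Sigma> T \<longrightarrow> (\<forall>b \<in> S T.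
     \<exists>h. hyp_mor F T h \<and> act h a = b \<and>
       (\<forall>k. hyp_mor F T k \<and> act k a = b \<longrightarrow> hmap_eq F k h)))"

text \<open>All representing cospans at once, matching the encoding of a morphism as a whole
  isomorphism class. The set is empty if \<open>S\<close> is not representable, so nonemptiness is
  tracked separately.\<close>

definition Rep :: "'g signature \<Rightarrow> 'g presheaf \<Rightarrow> 'g csp" where
  "Rep \<Sigma> S = {C. \<exists>a. universal \<Sigma> S (apex C) a \<and> left C = lft a \<and> right C = rgt a}"

section \<open>Uniqueness of representing cospans\<close>

lemma universal_unique:
  assumes "universal \<Sigma> S F a" "hyp \<Sigma> T" "act h a \<in> S T"
    "hyp_mor F T h" "hyp_mor F T k" "act h a = act k a"
  shows "hmap_eq F h k"
proof -
  from assms obtain g where "\<And>k. hyp_mor F T k \<and> act k a = act h a \<Longrightarrow> hmap_eq F k g"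
    unfolding universal_def by metis
  then have "hmap_eq F h g" "hmap_eq F k g" using assms by auto
  then show ?thesis by (auto simp: hmap_eq_def)
qed

lemma universal_ex:
  assumes "universal \<Sigma> S F a" "hyp \<Sigma> T" "b \<in> S T"
  obtains h where "hyp_mor F T h" "act h a = b"
  using assms unfolding universal_def by metis

lemma universalI:
  fixes S :: "'g presheaf"
  assumes "hyp \<Sigma> F" "a \<in> S F"
    "\<And>T b. hyp \<Sigma> T \<Longrightarrow> b \<in> S T \<Longrightarrow> \<exists>h. hyp_mor F T h \<and> act h a = b"
    "\<And>(T :: (nat, nat, 'g) hypergraph) h k. hyp \<Sigma> T \<Longrightarrow> hyp_mor F T h \<Longrightarrow> hyp_mor F T k \<Longrightarrow> act h a = act k a \<Longrightarrow> hmap_eq F h k"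
  shows "universal \<Sigma> S F a"
  unfolding universal_def
proof (intro conjI allI impI ballI)
  fix T b assume T: "hyp \<Sigma> T" "b \<in> S T"
  then obtain h where "hyp_mor F T h" "act h a = b" using assms(3) by blast
  then show "\<exists>h. hyp_mor F T h \<and> act h a = b \<and>
      (\<forall>k. hyp_mor F T k \<and> act k a = b \<longrightarrow> hmap_eq F k h)"
    using assms(4)[OF T(1)] by (intro exI[of _ h]) simp
qed (fact assms)+

lemma Rep_is_cospan:
  assumes "presheaf \<Sigma> m n S" "C \<in> Rep \<Sigma> S"
  shows "is_cospan \<Sigma> m n C"
proof -
  from assms(2) obtain a where "hyp \<Sigma> (apex C)" "a \<in> S (apex C)" "left C = lft a" "right C = rgt a"
    by (auto simp: Rep_def universal_def)
  then show ?thesis using presheafD[OF assms(1)] by (auto simp: is_cospan_def)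
qed

text \<open>Each universal valuation is sent to the other one, so both composites fix a universal
  valuation and are identities by uniqueness.\<close>

lemma Rep_iso:
  assumes S: "presheaf \<Sigma> m n S" and C: "C \<in> Rep \<Sigma> S" and D: "D \<in> Rep \<Sigma> S"
  shows "cospan_iso C D"
proof -
  from C obtain c where c: "universal \<Sigma> S (apex C) c" "left C = lft c" "right C = rgt c"
    by (auto simp: Rep_def)
  from D obtain d where d: "universal \<Sigma> S (apex D) d" "left D = lft d" "right D = rgt d"
    by (auto simp: Rep_def)
  have hyps: "hyp \<Sigma> (apex C)" "c \<in> S (apex C)" "hyp \<Sigma> (apex D)" "d \<in> S (apex D)"
    using c d by (auto simp: universal_def)
  obtain h where h: "hyp_mor (apex C) (apex D) h" "act h c = d"
    using universal_ex[OF c(1) hyps(3,4)] .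
  obtain k where k: "hyp_mor (apex D) (apex C) k" "act k d = c"
    using universal_ex[OF d(1) hyps(1,2)] .
  have "act (hmap_comp k h) c = c" "act (hmap_comp h k) d = d"
    using h k by (simp_all flip: act_comp)
  then have *: "hmap_eq (apex C) (hmap_comp k h) hmap_id" "hmap_eq (apex D) (hmap_comp h k) hmap_id"
    using universal_unique[OF c(1) hyps(1) _ hyp_mor_comp[OF h(1) k(1)] hyp_mor_id]
      universal_unique[OF d(1) hyps(3) _ hyp_mor_comp[OF k(1) h(1)] hyp_mor_id] hyps
    by (simp_all add: act_id)
  have "left D = map (fst h) (left C)" "right D = map (fst h) (right C)"
    using c d by (simp_all flip: h(2))
  then show ?thesis
    using hyp_mor_bij[OF h(1) k(1) *] h(1) unfolding cospan_iso_def by (intro exI[of _ h]) auto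
qed

lemma Rep_transport:
  fixes S :: "'g presheaf"
  assumes S: "presheaf \<Sigma> m n S" and C: "C \<in> Rep \<Sigma> S" and i: "cospan_iso C D"
  shows "D \<in> Rep \<Sigma> S"
proof -
  from C obtain a where a: "universal \<Sigma> S (apex C) a" "left C = lft a" "right C = rgt a"
    by (auto simp: Rep_def)
  have hyps: "hyp \<Sigma> (apex C)" "a \<in> S (apex C)" using a by (auto simp: universal_def)
  obtain h k where hk: "hyp_mor (apex C) (apex D) h" "hyp_mor (apex D) (apex C) k"
    "hmap_eq (apex C) (hmap_comp k h) hmap_id" "hmap_eq (apex D) (hmap_comp h k) hmap_id"
    "left D = map (fst h) (left C)" "right D = map (fst h) (right C)" "hyp \<Sigma> (apex D)"
    using cospan_isoD[OF i hyps(1)] by metis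
  have "universal \<Sigma> S (apex D) (act h a)"
  proof (rule universalI)
    show "act h a \<in> S (apex D)" using presheafD(7)[OF S hyps hk(7) hk(1)] .
  next
    fix T b assume T: "hyp \<Sigma> T" and b: "b \<in> S T"
    obtain g where g: "hyp_mor (apex C) T g" "act g a = b"
      using universal_ex[OF a(1) T b] .
    have "hmap_eq (apex C) (hmap_comp (hmap_comp g k) h) g"
      using hk(3) by (auto simp: hmap_eq_def)
    then have "act (hmap_comp g k) (act h a) = b"
      using act_cong[OF presheafD(3,4)[OF S hyps], of "hmap_comp (hmap_comp g k) h" g] g(2)
      by (simp add: act_comp)
    then show "\<exists>g. hyp_mor (apex D) T g \<and> act g (act h a) = b"
      using hyp_mor_comp[OF hk(2) g(1)] by blast
  next
    fix T :: "(nat, nat, 'g) hypergraph" and g g' assume T: "hyp \<Sigma> T" and g: "hyp_mor (apex D) T g" "hyp_mor (apex D) T g'"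
      "act g (act h a) = act g' (act h a)"
    have "hmap_eq (apex C) (hmap_comp g h) (hmap_comp g' h)"
      using universal_unique[OF a(1) T presheafD(7)[OF S hyps T hyp_mor_comp[OF hk(1) g(1)]]
          hyp_mor_comp[OF hk(1) g(1)] hyp_mor_comp[OF hk(1) g(2)]] g(3)
      by (simp add: act_comp)
    moreover have "fst k ` verts (apex D) \<subseteq> verts (apex C)" "snd k ` edges (apex D) \<subseteq> edges (apex C)"
      using hk(2) by (auto simp: hyp_mor_def)
    ultimately show "hmap_eq (apex D) g g'"
      using hk(4) by (fastforce simp: hmap_eq_def image_subset_iff)
  qed (fact hk(7))
  then show ?thesis using a hk by (auto simp: Rep_def)
qed

text \<open>Exhibiting one representing cospan determines the whole set, because universal
  valuations are unique up to isomorphism and can be transported along isomorphisms.\<close>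

lemma Rep_class:
  assumes "presheaf \<Sigma> m n S" "C \<in> Rep \<Sigma> S"
  shows "Rep \<Sigma> S = csp_class C"
  using Rep_iso[OF assms] Rep_transport[OF assms] by (auto simp: csp_class_def)

text \<open>\<open>R\<close> is the graph of a natural isomorphism.\<close>

lemma Rep_subset:
  fixes S :: "'g presheaf"
  assumes S: "presheaf \<Sigma> m n S" and S': "presheaf \<Sigma> m' n' S'"
    and ex: "\<And>T a. hyp \<Sigma> T \<Longrightarrow> a \<in> S T \<Longrightarrow> \<exists>b \<in> S' T. R a b"
    and ex': "\<And>T b. hyp \<Sigma> T \<Longrightarrow> b \<in> S' T \<Longrightarrow> \<exists>a \<in> S T. R a b"
    and bnd: "\<And>T a b. hyp \<Sigma> T \<Longrightarrow> a \<in> S T \<Longrightarrow> b \<in> S' T \<Longrightarrow> R a b \<Longrightarrow> lft a = lft b \<and> rgt a = rgt b"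
    and nat: "\<And>T a b (h :: (nat, nat, nat, nat) hmap). hyp \<Sigma> T \<Longrightarrow> a \<in> S T \<Longrightarrow> b \<in> S' T \<Longrightarrow> R a b \<Longrightarrow> R (act h a) (act h b)"
    and uniq: "\<And>T a a' b b'. hyp \<Sigma> T \<Longrightarrow> a \<in> S T \<Longrightarrow> b \<in> S' T \<Longrightarrow> a' \<in> S T \<Longrightarrow> b' \<in> S' T \<Longrightarrow>
      R a b \<Longrightarrow> R a' b' \<Longrightarrow> a = a' \<longleftrightarrow> b = b'"
  shows "Rep \<Sigma> S \<subseteq> Rep \<Sigma> S'"
proof
  fix C assume "C \<in> Rep \<Sigma> S"
  then obtain a where a: "universal \<Sigma> S (apex C) a" "left C = lft a" "right C = rgt a"
    by (auto simp: Rep_def)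
  have F: "hyp \<Sigma> (apex C)" "a \<in> S (apex C)" using a by (auto simp: universal_def)
  obtain b where b: "b \<in> S' (apex C)" "R a b" using ex[OF F] by blast
  have "universal \<Sigma> S' (apex C) b"
  proof (rule universalI[where S = S', OF F(1) b(1)])
    fix T c assume T: "hyp \<Sigma> T" and c: "c \<in> S' T"
    obtain d where d: "d \<in> S T" "R d c" using ex'[OF T c] by blast
    obtain h where h: "hyp_mor (apex C) T h" "act h a = d" using universal_ex[OF a(1) T d(1)] .
    have "R d (act h b)" using nat[OF F b, of h] h(2) by simp
    then have "act h b = c"
      using uniq[OF T d(1) _ d(1) c _ d(2)] presheafD(7)[OF S' F(1) b(1) T h(1)] by blast
    then show "\<exists>h. hyp_mor (apex C) T h \<and> act h b = c" using h by blast
  next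
    fix T :: "(nat, nat, 'g) hypergraph" and h k assume T: "hyp \<Sigma> T" and hk: "hyp_mor (apex C) T h" "hyp_mor (apex C) T k"
      "act h b = act k b"
    have "act h a = act k a"
      using uniq[OF T _ _ _ _ nat[OF F b, of h] nat[OF F b, of k]] hk
        presheafD(7)[OF S F T hk(1)] presheafD(7)[OF S F T hk(2)]
        presheafD(7)[OF S' F(1) b(1) T hk(1)] presheafD(7)[OF S' F(1) b(1) T hk(2)] by blast
    then show "hmap_eq (apex C) h k"
      using universal_unique[OF a(1) T presheafD(7)[OF S F T hk(1)] hk(1,2)] by blast
  qed
  then show "C \<in> Rep \<Sigma> S'" using a bnd[OF F b] by (auto simp: Rep_def)
qed

text \<open>With a relation in place of a function the hypotheses are symmetric, so the second
  inclusion is \<open>Rep_subset\<close> for the converse relation.\<close>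

lemma Rep_eqI:
  assumes S: "presheaf \<Sigma> m n S" and S': "presheaf \<Sigma> m' n' S'"
    and ex: "\<And>T a. hyp \<Sigma> T \<Longrightarrow> a \<in> S T \<Longrightarrow> \<exists>b \<in> S' T. R a b"
    and ex': "\<And>T b. hyp \<Sigma> T \<Longrightarrow> b \<in> S' T \<Longrightarrow> \<exists>a \<in> S T. R a b"
    and bnd: "\<And>T a b. hyp \<Sigma> T \<Longrightarrow> a \<in> S T \<Longrightarrow> b \<in> S' T \<Longrightarrow> R a b \<Longrightarrow> lft a = lft b \<and> rgt a = rgt b"
    and nat: "\<And>T a b h. hyp \<Sigma> T \<Longrightarrow> a \<in> S T \<Longrightarrow> b \<in> S' T \<Longrightarrow> R a b \<Longrightarrow> R (act h a) (act h b)"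
    and uniq: "\<And>T a a' b b'. hyp \<Sigma> T \<Longrightarrow> a \<in> S T \<Longrightarrow> b \<in> S' T \<Longrightarrow> a' \<in> S T \<Longrightarrow> b' \<in> S' T \<Longrightarrow>
      R a b \<Longrightarrow> R a' b' \<Longrightarrow> a = a' \<longleftrightarrow> b = b'"
  shows "Rep \<Sigma> S = Rep \<Sigma> S'"
proof (rule antisym)
  show "Rep \<Sigma> S \<subseteq> Rep \<Sigma> S'"
    by (rule Rep_subset[OF S S', of R]) (fact ex ex' bnd nat uniq)+
  show "Rep \<Sigma> S' \<subseteq> Rep \<Sigma> S"
  proof (rule Rep_subset[OF S' S, of "\<lambda>b a. R a b"])
    show "lft b = lft a \<and> rgt b = rgt a"
      if "hyp \<Sigma> T" "b \<in> S' T" "a \<in> S T" "R a b" for T a b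
      using bnd[OF that(1,3,2,4)] by simp
    show "b = b' \<longleftrightarrow> a = a'" if "hyp \<Sigma> T" "b \<in> S' T" "a \<in> S T" "b' \<in> S' T" "a' \<in> S T"
      "R a b" "R a' b'" for T a a' b b'
      using uniq[OF that(1,3,2,5,4,6,7)] by simp
  qed (fact ex ex' | erule (3) nat)+
qed


section \<open>Operations on presheaves\<close>

text \<open>A morphism from the hypergraph of a generator is the choice of an edge with its label.
  The vertex list stays empty because the two interfaces already contain every vertex.\<close>

definition genS :: "'g \<Rightarrow> 'g presheaf" where
  "genS \<phi> T = {VLeaf [e] [] (src T e) (tgt T e) | e. e \<in> edges T \<and> lab T e = \<phi>}"

text \<open>The list \<open>vs\<close> is kept in the leaf since a vertex of a discrete cospan may
  lie on one interface only, or on none.\<close>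

definition discS :: "nat \<Rightarrow> nat list \<Rightarrow> nat list \<Rightarrow> 'g presheaf" where
  "discS k f g T = {VLeaf [] vs (map ((!) vs) f) (map ((!) vs) g) | vs.
     length vs = k \<and> set vs \<subseteq> verts T}"

text \<open>The pullback over the shared interface: maps out of a pushout.\<close>

definition seqS :: "'g presheaf \<Rightarrow> 'g presheaf \<Rightarrow> 'g presheaf" where
  "seqS S1 S2 T = {VSeq a b | a b. a \<in> S1 T \<and> b \<in> S2 T \<and> rgt a = lft b}"

definition tenS :: "'g presheaf \<Rightarrow> 'g presheaf \<Rightarrow> 'g presheaf" where
  "tenS S1 S2 T = {VTen a b | a b. a \<in> S1 T \<and> b \<in> S2 T}"

text \<open>An equaliser: maps out of the hypergraph in which the first \<open>x\<close> left and
  right interface vertices are identified.\<close>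

definition trS :: "nat \<Rightarrow> 'g presheaf \<Rightarrow> 'g presheaf" where
  "trS x S T = {VTr x a | a. a \<in> S T \<and> take x (lft a) = take x (rgt a)}"

section \<open>The operations yield presheaves\<close>

lemma presheaf_gen: "presheaf \<Sigma> (ar \<Sigma> \<phi>) (coar \<Sigma> \<phi>) (genS \<phi>)"
  unfolding presheaf_def
proof (intro allI impI ballI conjI)
  fix T :: "(nat, nat, 'a) hypergraph" and a assume T: "hyp \<Sigma> T" and "a \<in> genS \<phi> T"
  then obtain e where e: "a = VLeaf [e] [] (src T e) (tgt T e)" "e \<in> edges T" "lab T e = \<phi>"
    by (auto simp: genS_def)
  then show "length (lft a) = ar \<Sigma> \<phi>" "length (rgt a) = coar \<Sigma> \<phi>"
    "set1_valuation a \<subseteq> verts T" "set2_valuation a \<subseteq> edges T"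
    using T by (auto simp: hyp_def)
  fix U :: "(nat, nat, 'a) hypergraph" and h assume "hyp_mor T U h"
  then show "act h a \<in> genS \<phi> U"
    using e by (auto simp: genS_def hyp_mor_def image_subset_iff)
qed

lemma map_nth_map: "set f \<subseteq> {..<length vs} \<Longrightarrow> map h (map ((!) vs) f) = map ((!) (map h vs)) f"
  by (auto simp: subset_iff)

lemma presheaf_disc:
  assumes "set f \<subseteq> {..<k}" "set g \<subseteq> {..<k}" "m = length f" "n = length g"
  shows "presheaf \<Sigma> m n (discS k f g)"
  unfolding presheaf_def
proof (intro allI impI ballI conjI)
  fix T :: "(nat, nat, 'a) hypergraph" and a assume "a \<in> discS k f g T"
  then obtain vs where a: "a = VLeaf [] vs (map ((!) vs) f) (map ((!) vs) g)"
    and vs: "length vs = k" "set vs \<subseteq> verts T"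
    by (auto simp: discS_def)
  then show "length (lft a) = m" "length (rgt a) = n"
    using assms(3,4) by auto
  show "set1_valuation a \<subseteq> verts T" "set2_valuation a \<subseteq> edges T"
    using a vs assms(1,2) by (auto simp: subset_iff)
  fix U :: "(nat, nat, 'a) hypergraph" and h assume "hyp_mor T U h"
  then show "act h a \<in> discS k f g U"
    using a vs assms(1,2) map_nth_map[of _ vs "fst h"]
    by (auto simp: discS_def hyp_mor_def image_subset_iff subset_iff intro!: exI[of _ "map (fst h) vs"]
        simp del: map_map)
qed

lemma presheaf_seq:
  assumes S1: "presheaf \<Sigma> m n S1" and S2: "presheaf \<Sigma> n p S2"
  shows "presheaf \<Sigma> m p (seqS S1 S2)"
  unfolding presheaf_def
proof (intro allI impI ballI)
  fix T :: "(nat, nat, 'a) hypergraph" and c assume T: "hyp \<Sigma> T" and "c \<in> seqS S1 S2 T"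
  then obtain a b where c: "c = VSeq a b" "a \<in> S1 T" "b \<in> S2 T" "rgt a = lft b"
    by (auto simp: seqS_def)
  then show "length (lft c) = m \<and> length (rgt c) = p \<and> set1_valuation c \<subseteq> verts T \<and>
      set2_valuation c \<subseteq> edges T \<and> (\<forall>U h. hyp \<Sigma> U \<longrightarrow> hyp_mor T U h \<longrightarrow> act h c \<in> seqS S1 S2 U)"
    using presheafD[OF S1 T c(2)] presheafD[OF S2 T c(3)] by (simp add: seqS_def)
qed

lemma presheaf_ten:
  assumes S1: "presheaf \<Sigma> m n S1" and S2: "presheaf \<Sigma> p q S2"
  shows "presheaf \<Sigma> (m + p) (n + q) (tenS S1 S2)"
  unfolding presheaf_def
proof (intro allI impI ballI)
  fix T :: "(nat, nat, 'a) hypergraph" and c assume T: "hyp \<Sigma> T" and "c \<in> tenS S1 S2 T"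
  then obtain a b where c: "c = VTen a b" "a \<in> S1 T" "b \<in> S2 T"
    by (auto simp: tenS_def)
  then show "length (lft c) = m + p \<and> length (rgt c) = n + q \<and> set1_valuation c \<subseteq> verts T \<and>
      set2_valuation c \<subseteq> edges T \<and> (\<forall>U h. hyp \<Sigma> U \<longrightarrow> hyp_mor T U h \<longrightarrow> act h c \<in> tenS S1 S2 U)"
    using presheafD[OF S1 T c(2)] presheafD[OF S2 T c(3)] by (simp add: tenS_def)
qed

lemma presheaf_tr:
  assumes S: "presheaf \<Sigma> (x + m) (x + n) S"
  shows "presheaf \<Sigma> m n (trS x S)"
  unfolding presheaf_def
proof (intro allI impI ballI)
  fix T :: "(nat, nat, 'a) hypergraph" and c assume T: "hyp \<Sigma> T" and "c \<in> trS x S T"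
  then obtain a where c: "c = VTr x a" "a \<in> S T" "take x (lft a) = take x (rgt a)"
    by (auto simp: trS_def)
  then show "length (lft c) = m \<and> length (rgt c) = n \<and> set1_valuation c \<subseteq> verts T \<and>
      set2_valuation c \<subseteq> edges T \<and> (\<forall>U h. hyp \<Sigma> U \<longrightarrow> hyp_mor T U h \<longrightarrow> act h c \<in> trS x S U)"
    using presheafD[OF S T c(2)] by (simp add: trS_def take_map)
qed

section \<open>Presheaf operations represent the operations on cospans\<close>

lemma Rep_gen:
  fixes \<Sigma> :: "'g signature"
  assumes "\<phi> \<in> gens \<Sigma>"
  shows "Rep \<Sigma> (genS \<phi>) = gen_csp \<Sigma> \<phi>"
proof -
  define m n where "m = ar \<Sigma> \<phi>" and "n = coar \<Sigma> \<phi>"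
  define F :: "(nat, nat, 'g) hypergraph" where
    "F = \<lparr>verts = {0..<m + n}, edges = {0}, src = (\<lambda>_. [0..<m]), tgt = (\<lambda>_. [m..<m + n]), lab = (\<lambda>_. \<phi>)\<rparr>"
  define a :: "(nat, nat) valuation" where "a = VLeaf [0] [] [0..<m] [m..<m + n]"
  have "universal \<Sigma> (genS \<phi>) F a"
  proof (rule universalI)
    show "hyp \<Sigma> F" using assms by (auto simp: hyp_def F_def m_def n_def)
    show "a \<in> genS \<phi> F" by (auto simp: a_def genS_def F_def)
  next
    fix T b assume T: "hyp \<Sigma> T" and "b \<in> genS \<phi> T"
    then obtain e where e: "b = VLeaf [e] [] (src T e) (tgt T e)" "e \<in> edges T" "lab T e = \<phi>"
      by (auto simp: genS_def)
    have l: "length (src T e) = m" "length (tgt T e) = n" "set (src T e) \<subseteq> verts T"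
      "set (tgt T e) \<subseteq> verts T"
      using T e by (auto simp: hyp_def m_def n_def)
    \<comment> \<open>The vertices of the generator are positions in this concatenation, sources
      before targets.\<close>
    define f where "f = (!) (src T e @ tgt T e)"
    have f: "map f [0..<m] = src T e" "map f [m..<m + n] = tgt T e"
      using l by (auto intro!: nth_equalityI simp: f_def nth_append)
    have "f ` {0..<m + n} = set (map f [0..<m] @ map f [m..<m + n])" by (auto simp flip: image_Un)
    then have "f ` {0..<m + n} \<subseteq> verts T" using l f by simp
    then have "hyp_mor F T (f, \<lambda>_. e)" using f e by (auto simp: hyp_mor_def F_def)
    moreover have "act (f, \<lambda>_. e) a = b" using e f by (simp add: a_def)
    ultimately show "\<exists>h. hyp_mor F T h \<and> act h a = b" by blast
  next
    fix T :: "(nat, nat, 'g) hypergraph" and h k :: "(nat, nat, nat, nat) hmap"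
    assume "act h a = act k a"
    then show "hmap_eq F h k"
      by (auto simp: a_def F_def hmap_eq_def)
  qed
  then have "\<lparr>apex = F, left = [0..<m], right = [m..<m + n]\<rparr> \<in> Rep \<Sigma> (genS \<phi>)"
    by (auto simp: Rep_def a_def)
  then show ?thesis
    unfolding gen_csp_def F_def m_def n_def Let_def by (rule Rep_class[OF presheaf_gen])
qed

lemma Rep_disc:
  fixes \<Sigma> :: "'g signature"
  assumes "set f \<subseteq> {..<k}" "set g \<subseteq> {..<k}"
  shows "Rep \<Sigma> (discS k f g) = disc_csp k f g"
proof -
  define a :: "(nat, nat) valuation" where "a = VLeaf [] [0..<k] f g"
  have "universal \<Sigma> (discS k f g) (discrete k) a"
  proof (rule universalI)
    show "hyp \<Sigma> (discrete k)" by (auto simp: hyp_def discrete_def)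
    show "a \<in> discS k f g (discrete k)"
      using assms by (auto simp: a_def discS_def discrete_def subset_iff intro!: exI[of _ "[0..<k]"] map_idI[symmetric])
  next
    fix T :: "(nat, nat, 'g) hypergraph" and b assume "b \<in> discS k f g T"
    then obtain vs where b: "b = VLeaf [] vs (map ((!) vs) f) (map ((!) vs) g)"
      and vs: "length vs = k" "set vs \<subseteq> verts T"
      by (auto simp: discS_def)
    have "map ((!) vs) [0..<k] = vs" using vs(1) map_nth by blast
    then have "act ((!) vs, id) a = b" using b by (simp add: a_def)
    moreover have "hyp_mor (discrete k) T ((!) vs, id)"
      using vs by (auto simp: hyp_mor_def discrete_def)
    ultimately show "\<exists>h. hyp_mor (discrete k) T h \<and> act h a = b" by blast
  next
    fix T :: "(nat, nat, 'g) hypergraph" and h k' :: "(nat, nat, nat, nat) hmap"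
    assume "act h a = act k' a"
    then show "hmap_eq (discrete k) h k'"
      by (auto simp: a_def discrete_def hmap_eq_def)
  qed
  then have "\<lparr>apex = discrete k, left = f, right = g\<rparr> \<in> Rep \<Sigma> (discS k f g)"
    by (auto simp: Rep_def a_def)
  then show ?thesis
    using Rep_class[OF presheaf_disc[OF assms refl refl]] by (simp add: disc_csp_def)
qed

lemma hyp_sum_inj:
  "hyp_mor F (hyp_sum F G) (Inl, Inl)" "hyp_mor G (hyp_sum F G) (Inr, Inr)"
  by (auto simp: hyp_mor_def hyp_sum_def)

lemma hyp_sum_case:
  "hyp_mor F T g \<Longrightarrow> hyp_mor G T h \<Longrightarrow>
   hyp_mor (hyp_sum F G) T (case_sum (fst g) (fst h), case_sum (snd g) (snd h))"
  by (auto simp: hyp_mor_def hyp_sum_def comp_def)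

lemma is_cospan_sum:
  assumes "is_cospan \<Sigma> m n C" "is_cospan \<Sigma> p q D"
  shows "is_cospan \<Sigma> (m + p) (n + q) (cospan_sum C D)"
  using assms unfolding is_cospan_def hyp_def cospan_sum_def hyp_sum_def by (auto simp: subset_iff)

lemma Rep_ten:
  fixes S1 S2 :: "'g presheaf"
  assumes S1: "presheaf \<Sigma> m n S1" and S2: "presheaf \<Sigma> p q S2"
    and C: "C \<in> Rep \<Sigma> S1" and D: "D \<in> Rep \<Sigma> S2"
  shows "Rep \<Sigma> (tenS S1 S2) = csp_class (cospan_sum C D)"
proof -
  let ?K = "cospan_sum C D"
  have K: "is_cospan \<Sigma> (m + p) (n + q) ?K"
    using is_cospan_sum Rep_is_cospan[OF S1 C] Rep_is_cospan[OF S2 D] .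
  have apK: "apex ?K = hyp_sum (apex C) (apex D)" by (simp add: cospan_sum_def)
  \<comment> \<open>The disjoint union has vertices and edges in a sum type, whereas
    \<open>universal\<close> speaks about hypergraphs over \<open>nat\<close>; the universal
    valuation is therefore placed on a copy.\<close>
  obtain N :: "(nat, nat, 'g) cospan" where N: "cospan_iso ?K N" using nat_copy[OF K] .
  have hK: "hyp \<Sigma> (apex ?K)" using K by (simp add: is_cospan_def)
  obtain h k where hk: "hyp_mor (hyp_sum (apex C) (apex D)) (apex N) h"
    "hyp_mor (apex N) (hyp_sum (apex C) (apex D)) k"
    "hmap_eq (hyp_sum (apex C) (apex D)) (hmap_comp k h) hmap_id"
    "hmap_eq (apex N) (hmap_comp h k) hmap_id"
    "left N = map (fst h) (left ?K)" "right N = map (fst h) (right ?K)" "hyp \<Sigma> (apex N)"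
    using cospan_isoD[OF N hK, unfolded apK] by metis
  obtain a where a: "universal \<Sigma> S1 (apex C) a" "left C = lft a" "right C = rgt a"
    using C by (auto simp: Rep_def)
  obtain b where b: "universal \<Sigma> S2 (apex D) b" "left D = lft b" "right D = rgt b"
    using D by (auto simp: Rep_def)
  have ha: "hyp \<Sigma> (apex C)" "a \<in> S1 (apex C)" and hb: "hyp \<Sigma> (apex D)" "b \<in> S2 (apex D)"
    using a b by (auto simp: universal_def)
  define i where "i = hmap_comp h (Inl, Inl)"
  define j where "j = hmap_comp h (Inr, Inr)"
  have i: "hyp_mor (apex C) (apex N) i" and j: "hyp_mor (apex D) (apex N) j"
    unfolding i_def j_def using hyp_mor_comp[OF hyp_sum_inj(1) hk(1)] hyp_mor_comp[OF hyp_sum_inj(2) hk(1)] by blast+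
  have "universal \<Sigma> (tenS S1 S2) (apex N) (VTen (act i a) (act j b))"
  proof (rule universalI)
    show "VTen (act i a) (act j b) \<in> tenS S1 S2 (apex N)"
      using presheafD(7)[OF S1 ha hk(7) i] presheafD(7)[OF S2 hb hk(7) j] by (simp add: tenS_def)
  next
    fix T c assume T: "hyp \<Sigma> T" and "c \<in> tenS S1 S2 T"
    then obtain a' b' where c: "c = VTen a' b'" "a' \<in> S1 T" "b' \<in> S2 T" by (auto simp: tenS_def)
    obtain f where f: "hyp_mor (apex C) T f" "act f a = a'" using universal_ex[OF a(1) T c(2)] .
    obtain g where g: "hyp_mor (apex D) T g" "act g b = b'" using universal_ex[OF b(1) T c(3)] .
    define u where "u = hmap_comp (case_sum (fst f) (fst g), case_sum (snd f) (snd g)) k"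
    have "hmap_eq (apex C) (hmap_comp u i) f" "hmap_eq (apex D) (hmap_comp u j) g"
      using hk(3) by (simp_all add: hmap_eq_def hyp_sum_def u_def i_def j_def Plus_def ball_Un)
    then have "act u (act i a) = a'" "act u (act j b) = b'"
      using act_cong[OF presheafD(3,4)[OF S1 ha]] act_cong[OF presheafD(3,4)[OF S2 hb]] f g
      unfolding act_comp by blast+
    moreover have "hyp_mor (apex N) T u"
      unfolding u_def by (rule hyp_mor_comp[OF hk(2) hyp_sum_case[OF f(1) g(1)]])
    ultimately show "\<exists>h. hyp_mor (apex N) T h \<and> act h (VTen (act i a) (act j b)) = c"
      using c by (intro exI[of _ u]) simp
  next
    fix T :: "(nat, nat, 'g) hypergraph" and u v
    assume T: "hyp \<Sigma> T" and u: "hyp_mor (apex N) T u" and v: "hyp_mor (apex N) T v"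
      and eq: "act u (VTen (act i a) (act j b)) = act v (VTen (act i a) (act j b))"
    have "hmap_eq (apex C) (hmap_comp u i) (hmap_comp v i)"
      using universal_unique[OF a(1) T presheafD(7)[OF S1 ha T hyp_mor_comp[OF i u]]
          hyp_mor_comp[OF i u] hyp_mor_comp[OF i v]] eq by (simp add: act_comp)
    moreover have "hmap_eq (apex D) (hmap_comp u j) (hmap_comp v j)"
      using universal_unique[OF b(1) T presheafD(7)[OF S2 hb T hyp_mor_comp[OF j u]]
          hyp_mor_comp[OF j u] hyp_mor_comp[OF j v]] eq by (simp add: act_comp)
    ultimately have *: "\<forall>x \<in> verts (apex C) <+> verts (apex D). fst u (fst h x) = fst v (fst h x)"
      "\<forall>x \<in> edges (apex C) <+> edges (apex D). snd u (snd h x) = snd v (snd h x)"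
      by (auto simp: hmap_eq_def i_def j_def)
    have "fst k y \<in> verts (apex C) <+> verts (apex D)" "fst h (fst k y) = y" if "y \<in> verts (apex N)" for y
      using hk(2,4) that by (auto simp: hyp_mor_def hmap_eq_def hyp_sum_def image_subset_iff)
    moreover have "snd k y \<in> edges (apex C) <+> edges (apex D)" "snd h (snd k y) = y" if "y \<in> edges (apex N)" for y
      using hk(2,4) that by (auto simp: hyp_mor_def hmap_eq_def hyp_sum_def image_subset_iff)
    ultimately show "hmap_eq (apex N) u v"
      unfolding hmap_eq_def using * by metis
  qed (fact hk(7))
  then have "N \<in> Rep \<Sigma> (tenS S1 S2)"
    using hk a b by (auto simp: Rep_def cospan_sum_def i_def j_def)
  then show ?thesis
    using Rep_class[OF presheaf_ten[OF S1 S2]] csp_class_eq[OF N K] by simp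
qed

text \<open>Every choice of representatives contributes the same class, and nonemptiness ensures
  that there is a choice.\<close>

lemma csp_tensor_Rep:
  assumes S: "presheaf \<Sigma> m n S1" "presheaf \<Sigma> p q S2" and ne: "Rep \<Sigma> S1 \<noteq> {}" "Rep \<Sigma> S2 \<noteq> {}"
  shows "csp_tensor (Rep \<Sigma> S1) (Rep \<Sigma> S2) = Rep \<Sigma> (tenS S1 S2)"
  unfolding csp_tensor_def using Rep_ten[OF S] ne by blast

text \<open>By universality of the two factors, a cocone on the pushout span is the same as a pair
  of composable valuations. So the pushout property and universality for \<open>seqS\<close>
  translate into each other.\<close>

lemma csp_comp_Rep:
  fixes S1 S2 :: "'g presheaf"
  assumes S1: "presheaf \<Sigma> m n S1" and S2: "presheaf \<Sigma> n p S2"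
    and ne: "Rep \<Sigma> S1 \<noteq> {}" "Rep \<Sigma> S2 \<noteq> {}"
  shows "csp_comp \<Sigma> (Rep \<Sigma> S1) (Rep \<Sigma> S2) = Rep \<Sigma> (seqS S1 S2)"
proof (intro equalityI subsetI)
  fix E assume "E \<in> csp_comp \<Sigma> (Rep \<Sigma> S1) (Rep \<Sigma> S2)"
  then obtain C D i j where C: "C \<in> Rep \<Sigma> S1" and D: "D \<in> Rep \<Sigma> S2"
    and po: "pushout \<Sigma> (right C) (left D) (apex C) (apex D) (apex E) i j"
    and E: "left E = map (fst i) (left C)" "right E = map (fst j) (right D)"
    by (auto simp: csp_comp_def)
  obtain a where a: "universal \<Sigma> S1 (apex C) a" "left C = lft a" "right C = rgt a"
    using C by (auto simp: Rep_def)
  obtain b where b: "universal \<Sigma> S2 (apex D) b" "left D = lft b" "right D = rgt b"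
    using D by (auto simp: Rep_def)
  have ha: "hyp \<Sigma> (apex C)" "a \<in> S1 (apex C)" and hb: "hyp \<Sigma> (apex D)" "b \<in> S2 (apex D)"
    using a b by (auto simp: universal_def)
  have hE: "hyp \<Sigma> (apex E)" and i: "hyp_mor (apex C) (apex E) i" and j: "hyp_mor (apex D) (apex E) j"
    and ij: "map (fst i) (rgt a) = map (fst j) (lft b)"
    using po a b by (auto simp: pushout_def)
  have po': "\<exists>u. hyp_mor (apex E) T u \<and> hmap_eq (apex C) (hmap_comp u i) f \<and>
      hmap_eq (apex D) (hmap_comp u j) g \<and>
      (\<forall>u'. hyp_mor (apex E) T u' \<and> hmap_eq (apex C) (hmap_comp u' i) f \<and>
        hmap_eq (apex D) (hmap_comp u' j) g \<longrightarrow> hmap_eq (apex E) u' u)"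
    if "hyp \<Sigma> T" "hyp_mor (apex C) T f" "hyp_mor (apex D) T g" "map (fst f) (rgt a) = map (fst g) (lft b)"
    for T :: "(nat, nat, 'g) hypergraph" and f g
    using po that unfolding pushout_def a(3)[symmetric] b(2)[symmetric] by blast
  have "universal \<Sigma> (seqS S1 S2) (apex E) (VSeq (act i a) (act j b))"
  proof (rule universalI[OF hE])
    show "VSeq (act i a) (act j b) \<in> seqS S1 S2 (apex E)"
      using presheafD(7)[OF S1 ha hE i] presheafD(7)[OF S2 hb hE j] ij by (simp add: seqS_def)
  next
    fix T c assume T: "hyp \<Sigma> T" and "c \<in> seqS S1 S2 T"
    then obtain a' b' where c: "c = VSeq a' b'" "a' \<in> S1 T" "b' \<in> S2 T" "rgt a' = lft b'"
      by (auto simp: seqS_def)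
    obtain f where f: "hyp_mor (apex C) T f" "act f a = a'" using universal_ex[OF a(1) T c(2)] .
    obtain g where g: "hyp_mor (apex D) T g" "act g b = b'" using universal_ex[OF b(1) T c(3)] .
    obtain u where u: "hyp_mor (apex E) T u" "hmap_eq (apex C) (hmap_comp u i) f"
      "hmap_eq (apex D) (hmap_comp u j) g"
      using po'[OF T f(1) g(1)] c(4) f(2) g(2) by fastforce
    then have "act u (act i a) = a'" "act u (act j b) = b'"
      using act_cong[OF presheafD(3,4)[OF S1 ha]] act_cong[OF presheafD(3,4)[OF S2 hb]] f g
      unfolding act_comp by blast+
    then show "\<exists>h. hyp_mor (apex E) T h \<and> act h (VSeq (act i a) (act j b)) = c"
      using c u by (intro exI[of _ u]) simp
  next
    fix T :: "(nat, nat, 'g) hypergraph" and u v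
    assume T: "hyp \<Sigma> T" and u: "hyp_mor (apex E) T u" and v: "hyp_mor (apex E) T v"
      and eq: "act u (VSeq (act i a) (act j b)) = act v (VSeq (act i a) (act j b))"
    have 1: "hmap_eq (apex C) (hmap_comp v i) (hmap_comp u i)"
      using universal_unique[OF a(1) T presheafD(7)[OF S1 ha T hyp_mor_comp[OF i v]]
          hyp_mor_comp[OF i v] hyp_mor_comp[OF i u]] eq by (simp add: act_comp)
    have 2: "hmap_eq (apex D) (hmap_comp v j) (hmap_comp u j)"
      using universal_unique[OF b(1) T presheafD(7)[OF S2 hb T hyp_mor_comp[OF j v]]
          hyp_mor_comp[OF j v] hyp_mor_comp[OF j u]] eq by (simp add: act_comp)
    have 3: "map (fst (hmap_comp u i)) (rgt a) = map (fst (hmap_comp u j)) (lft b)"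
      using ij by (simp flip: map_map)
    \<comment> \<open>Both \<open>u\<close> and \<open>v\<close> mediate for the cocone induced by
      \<open>u\<close>, so both agree with its mediating morphism.\<close>
    obtain w where w: "\<And>u'. hyp_mor (apex E) T u' \<Longrightarrow> hmap_eq (apex C) (hmap_comp u' i) (hmap_comp u i) \<Longrightarrow>
        hmap_eq (apex D) (hmap_comp u' j) (hmap_comp u j) \<Longrightarrow> hmap_eq (apex E) u' w"
      using po'[OF T hyp_mor_comp[OF i u] hyp_mor_comp[OF j u] 3] by blast
    have "hmap_eq (apex E) u w" "hmap_eq (apex E) v w"
      using w[OF u] w[OF v 1 2] by (auto simp: hmap_eq_def)
    then show "hmap_eq (apex E) u v" by (simp add: hmap_eq_def)
  qed
  then show "E \<in> Rep \<Sigma> (seqS S1 S2)" using E a b by (auto simp: Rep_def)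
next
  fix E assume "E \<in> Rep \<Sigma> (seqS S1 S2)"
  then obtain c where c: "universal \<Sigma> (seqS S1 S2) (apex E) c" "left E = lft c" "right E = rgt c"
    by (auto simp: Rep_def)
  then obtain a' b' where ab': "c = VSeq a' b'" "a' \<in> S1 (apex E)" "b' \<in> S2 (apex E)" "rgt a' = lft b'"
    and hE: "hyp \<Sigma> (apex E)"
    by (auto simp: universal_def seqS_def)
  obtain C D where C: "C \<in> Rep \<Sigma> S1" and D: "D \<in> Rep \<Sigma> S2" using ne by blast
  obtain a where a: "universal \<Sigma> S1 (apex C) a" "left C = lft a" "right C = rgt a"
    using C by (auto simp: Rep_def)
  obtain b where b: "universal \<Sigma> S2 (apex D) b" "left D = lft b" "right D = rgt b"
    using D by (auto simp: Rep_def)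
  have ha: "hyp \<Sigma> (apex C)" "a \<in> S1 (apex C)" and hb: "hyp \<Sigma> (apex D)" "b \<in> S2 (apex D)"
    using a b by (auto simp: universal_def)
  obtain i where i: "hyp_mor (apex C) (apex E) i" "act i a = a'" using universal_ex[OF a(1) hE ab'(2)] .
  obtain j where j: "hyp_mor (apex D) (apex E) j" "act j b = b'" using universal_ex[OF b(1) hE ab'(3)] .
  have ij: "map (fst i) (rgt a) = map (fst j) (lft b)"
    using ab'(4) by (simp flip: i(2) j(2))
  have "pushout \<Sigma> (right C) (left D) (apex C) (apex D) (apex E) i j"
    unfolding pushout_def
  proof (intro conjI allI impI; (elim conjE)?)
    show "map (fst i) (right C) = map (fst j) (left D)" using ij a b by simp
  next
    fix T :: "(nat, nat, 'g) hypergraph" and f g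
    assume T: "hyp \<Sigma> T" and f: "hyp_mor (apex C) T f" and g: "hyp_mor (apex D) T g"
      and fg: "map (fst f) (right C) = map (fst g) (left D)"
    \<comment> \<open>The cocone read as a valuation of the composite; universality of
      \<open>c\<close> turns it into the mediating morphism.\<close>
    have "VSeq (act f a) (act g b) \<in> seqS S1 S2 T"
      using presheafD(7)[OF S1 ha T f] presheafD(7)[OF S2 hb T g] fg a b by (simp add: seqS_def)
    then obtain u where u: "hyp_mor (apex E) T u" "act u c = VSeq (act f a) (act g b)"
      using universal_ex[OF c(1) T] by metis
    have eqs: "hmap_eq (apex C) (hmap_comp u i) f" "hmap_eq (apex D) (hmap_comp u j) g"
      using universal_unique[OF a(1) T _ hyp_mor_comp[OF i(1) u(1)] f]
        universal_unique[OF b(1) T _ hyp_mor_comp[OF j(1) u(1)] g]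
        presheafD(7)[OF S1 ha T f] presheafD(7)[OF S2 hb T g] u(2) ab'(1) i(2) j(2)
      by (auto simp flip: act_comp)
    have "hmap_eq (apex E) u' u" if u': "hyp_mor (apex E) T u'"
      "hmap_eq (apex C) (hmap_comp u' i) f" "hmap_eq (apex D) (hmap_comp u' j) g" for u'
    proof -
      have "act u' a' = act f a" "act u' b' = act g b"
        using act_cong[OF presheafD(3,4)[OF S1 ha] u'(2)] act_cong[OF presheafD(3,4)[OF S2 hb] u'(3)]
          i(2) j(2) by (auto simp flip: act_comp)
      then have "act u' c = act u c" using ab'(1) u(2) by simp
      then show ?thesis
        using universal_unique[OF c(1) T _ u'(1) u(1)] u(2) \<open>VSeq (act f a) (act g b) \<in> seqS S1 S2 T\<close>
        by simp
    qed
    then show "\<exists>u. hyp_mor (apex E) T u \<and> hmap_eq (apex C) (hmap_comp u i) f \<and>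
        hmap_eq (apex D) (hmap_comp u j) g \<and>
        (\<forall>u'. hyp_mor (apex E) T u' \<and> hmap_eq (apex C) (hmap_comp u' i) f \<and>
          hmap_eq (apex D) (hmap_comp u' j) g \<longrightarrow> hmap_eq (apex E) u' u)"
      using u(1) eqs by (intro exI[of _ u]) simp
  qed (fact hE i(1) j(1))+
  moreover have "left E = map (fst i) (left C)" "right E = map (fst j) (right D)"
    using c(2,3) ab'(1) a b by (simp_all flip: i(2) j(2))
  ultimately show "E \<in> csp_comp \<Sigma> (Rep \<Sigma> S1) (Rep \<Sigma> S2)"
    unfolding csp_comp_def using C D by blast
qed


section \<open>Balanced cospans\<close>

text \<open>Multiplicities are counted instead of membership, so that the bound by one also contains
  the injectivity of both legs.\<close>

definition balanced :: "('v, 'e, 'g) hypergraph \<Rightarrow> 'v list \<Rightarrow> 'v list \<Rightarrow> bool" where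
  "balanced F L R \<longleftrightarrow> (\<forall>v \<in> verts F. count_list L v + in_deg F v = count_list R v + out_deg F v \<and>
     count_list L v + in_deg F v \<le> 1)"

section \<open>Degrees as sums of multiplicities\<close>

lemma count_list_card: "count_list xs v = card {j. j < length xs \<and> v = xs ! j}"
  by (simp add: count_list_eq_length_filter length_filter_conv_card)

lemma in_deg_sum: "finite (edges F) \<Longrightarrow> in_deg F v = (\<Sum>e \<in> edges F. count_list (tgt F e) v)"
proof -
  assume "finite (edges F)"
  moreover have "{(e, j). e \<in> edges F \<and> j < length (tgt F e) \<and> v = tgt F e ! j} =
      (SIGMA e : edges F. {j. j < length (tgt F e) \<and> v = tgt F e ! j})" by auto
  ultimately show ?thesis by (simp add: in_deg_def count_list_card)
qed

lemma out_deg_sum: "finite (edges F) \<Longrightarrow> out_deg F v = (\<Sum>e \<in> edges F. count_list (src F e) v)"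
proof -
  assume "finite (edges F)"
  moreover have "{(e, j). e \<in> edges F \<and> j < length (src F e) \<and> v = src F e ! j} =
      (SIGMA e : edges F. {j. j < length (src F e) \<and> v = src F e ! j})" by auto
  ultimately show ?thesis by (simp add: out_deg_def count_list_card)
qed

lemma distinct_iff_count_list: "distinct xs \<longleftrightarrow> (\<forall>x. count_list xs x \<le> 1)"
  by (induction xs) (auto simp: count_list_0_iff le_Suc_eq split: if_splits)

lemma count_list_distinct: "distinct xs \<Longrightarrow> count_list xs x = (if x \<in> set xs then 1 else 0)"
  by (induction xs) (auto simp: count_list_0_iff)

lemma count_list_map_inj:
  "inj_on h A \<Longrightarrow> set xs \<subseteq> A \<Longrightarrow> v \<in> A \<Longrightarrow> count_list (map h xs) (h v) = count_list xs v"
  by (induction xs) (auto simp: inj_on_def)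

text \<open>With both multiplicities at most one, the four cases of the degree condition are the
  four values of the pair of multiplicities, and in each case the equation and the bound leave
  exactly the prescribed degrees.\<close>

lemma partial_monogamous_iff_balanced:
  assumes "is_cospan \<Sigma> m n C"
  shows "partial_monogamous C \<longleftrightarrow> balanced (apex C) (left C) (right C)"
proof
  assume C: "partial_monogamous C"
  then have d: "distinct (left C)" "distinct (right C)" by (auto simp: partial_monogamous_def)
  show "balanced (apex C) (left C) (right C)"
    unfolding balanced_def
  proof
    fix v assume "v \<in> verts (apex C)"
    with C show "count_list (left C) v + in_deg (apex C) v = count_list (right C) v + out_deg (apex C) v \<and>
        count_list (left C) v + in_deg (apex C) v \<le> 1"
      unfolding partial_monogamous_def degree_def count_list_distinct[OF d(1)] count_list_distinct[OF d(2)]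
      by (cases "v \<in> set (left C)"; cases "v \<in> set (right C)") auto
  qed
next
  assume C: "balanced (apex C) (left C) (right C)"
  have s: "set (left C) \<subseteq> verts (apex C)" "set (right C) \<subseteq> verts (apex C)"
    using assms by (auto simp: is_cospan_def)
  \<comment> \<open>Off the carrier both multiplicities vanish; on it the left one is bounded
    directly and the right one through the equation.\<close>
  have "count_list (left C) x \<le> 1" "count_list (right C) x \<le> 1" for x
    using C s by (cases "x \<in> verts (apex C)"; force simp: balanced_def count_list_0_iff)+
  then have d: "distinct (left C)" "distinct (right C)" by (auto simp: distinct_iff_count_list)
  show "partial_monogamous C"
    unfolding partial_monogamous_def
  proof (intro conjI d ballI)
    fix v assume "v \<in> verts (apex C)"
    with C have "count_list (left C) v + in_deg (apex C) v = count_list (right C) v + out_deg (apex C) v"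
        "count_list (left C) v + in_deg (apex C) v \<le> 1"
      by (auto simp: balanced_def)
    then show "v \<in> set (left C) \<and> v \<in> set (right C) \<longrightarrow> degree (apex C) v = (0, 0)"
      "v \<in> set (left C) \<and> v \<notin> set (right C) \<longrightarrow> degree (apex C) v = (0, 1)"
      "v \<notin> set (left C) \<and> v \<in> set (right C) \<longrightarrow> degree (apex C) v = (1, 0)"
      "v \<notin> set (left C) \<and> v \<notin> set (right C) \<longrightarrow> degree (apex C) v \<in> {(0, 0), (1, 1)}"
      unfolding degree_def count_list_distinct[OF d(1)] count_list_distinct[OF d(2)]
      by auto
  qed
qed

lemma degree_iso:
  assumes F: "hyp \<Sigma> F" and h: "hyp_mor F G h"
    and b: "bij_betw (fst h) (verts F) (verts G)" "bij_betw (snd h) (edges F) (edges G)"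
    and v: "v \<in> verts F"
  shows "in_deg G (fst h v) = in_deg F v" "out_deg G (fst h v) = out_deg F v"
proof -
  have fin: "finite (edges F)" "finite (edges G)" using F hyp_iso[OF F h b] by (auto simp: hyp_def)
  have i: "inj_on (fst h) (verts F)" using b by (auto simp: bij_betw_def)
  have "count_list (tgt G (snd h e)) (fst h v) = count_list (tgt F e) v"
    "count_list (src G (snd h e)) (fst h v) = count_list (src F e) v" if "e \<in> edges F" for e
    using h F that count_list_map_inj[OF i _ v] by (auto simp: hyp_mor_def hyp_def)
  then show "in_deg G (fst h v) = in_deg F v" "out_deg G (fst h v) = out_deg F v"
    unfolding in_deg_sum[OF fin(1)] in_deg_sum[OF fin(2)] out_deg_sum[OF fin(1)] out_deg_sum[OF fin(2)]
    by (simp_all flip: sum.reindex_bij_betw[OF b(2)])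
qed

lemma balanced_iso:
  assumes i: "cospan_iso C D" and C: "is_cospan \<Sigma> m n C"
    and bal: "balanced (apex C) (left C) (right C)"
  shows "balanced (apex D) (left D) (right D)"
proof -
  from i obtain h where h: "hyp_mor (apex C) (apex D) h"
    "bij_betw (fst h) (verts (apex C)) (verts (apex D))"
    "bij_betw (snd h) (edges (apex C)) (edges (apex D))"
    "map (fst h) (left C) = left D" "map (fst h) (right C) = right D"
    by (auto simp: cospan_iso_def)
  have C': "hyp \<Sigma> (apex C)" "set (left C) \<subseteq> verts (apex C)" "set (right C) \<subseteq> verts (apex C)"
    using C by (auto simp: is_cospan_def)
  have inj: "inj_on (fst h) (verts (apex C))" using h by (auto simp: bij_betw_def)
  show ?thesis
    unfolding balanced_def
  proof
    fix w assume "w \<in> verts (apex D)"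
    then obtain v where v: "v \<in> verts (apex C)" "w = fst h v" using h(2) by (auto simp: bij_betw_def)
    have "count_list (left D) w = count_list (left C) v" "count_list (right D) w = count_list (right C) v"
      using count_list_map_inj[OF inj _ v(1)] C'(2,3) v(2) by (simp_all flip: h(4,5))
    then show "count_list (left D) w + in_deg (apex D) w = count_list (right D) w + out_deg (apex D) w \<and>
        count_list (left D) w + in_deg (apex D) w \<le> 1"
      using bal v degree_iso[OF C'(1) h(1-3) v(1)] by (auto simp: balanced_def)
  qed
qed

lemma count_list_map_Inl_Inr [simp]:
  "count_list (map Inl xs) (Inl v) = count_list xs v"
  "count_list (map Inr ys) (Inr w) = count_list ys w"
  "count_list (map Inl xs) (Inr w) = 0" "count_list (map Inr ys) (Inl v) = 0"
  by (induction xs; simp; fail | induction ys; simp; fail)+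

lemma balanced_sum:
  assumes C: "hyp \<Sigma> F" "balanced F L R" and D: "hyp \<Sigma> G" "balanced G L' R'"
  shows "balanced (hyp_sum F G) (map Inl L @ map Inr L') (map Inl R @ map Inr R')"
proof -
  have fin: "finite (edges F)" "finite (edges G)" "finite (edges (hyp_sum F G))"
    using C D by (auto simp: hyp_def hyp_sum_def)
  have "in_deg (hyp_sum F G) (Inl v) = in_deg F v" "in_deg (hyp_sum F G) (Inr w) = in_deg G w"
    "out_deg (hyp_sum F G) (Inl v) = out_deg F v" "out_deg (hyp_sum F G) (Inr w) = out_deg G w" for v w
    unfolding in_deg_sum[OF fin(1)] in_deg_sum[OF fin(2)] out_deg_sum[OF fin(1)] out_deg_sum[OF fin(2)]
      in_deg_sum[OF fin(3)] out_deg_sum[OF fin(3)]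
    using fin by (simp_all add: hyp_sum_def sum.Plus)
  then show ?thesis
    using C D by (auto simp: balanced_def hyp_sum_def)
qed


section \<open>Gluing vertices\<close>

lemma count_list_map_fuse:
  assumes "x \<noteq> y"
  shows "count_list (map (\<lambda>v. if v = x then y else v) vs) w =
    (if w = y then count_list vs x + count_list vs y else if w = x then 0 else count_list vs w)"
  using assms by (induction vs) auto

definition surj_mor where
  "surj_mor F Q q \<longleftrightarrow> hyp_mor F Q q \<and> fst q ` verts F = verts Q \<and> snd q ` edges F = edges Q"

text \<open>Every edge of \<open>Q\<close> comes from an edge of \<open>F\<close>, so a pair of
  functions that factors a morphism through a surjective one preserves sources, targets and labels
  by itself.\<close>

lemma hyp_mor_factor:
  assumes q: "surj_mor F Q q" and g: "hyp_mor F T g"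
    and u: "hmap_eq F (hmap_comp u q) g" and F: "hyp \<Sigma> F"
  shows "hyp_mor Q T u"
proof -
  have uq: "fst u (fst q v) = fst g v" if "v \<in> verts F" for v using u that by (auto simp: hmap_eq_def)
  have uq': "snd u (snd q e) = snd g e" if "e \<in> edges F" for e using u that by (auto simp: hmap_eq_def)
  have lst: "map (fst u) (map (fst q) vs) = map (fst g) vs" if "set vs \<subseteq> verts F" for vs
    using that uq by auto
  show ?thesis
    unfolding hyp_mor_def
  proof (intro conjI ballI)
    fix e' assume "e' \<in> edges Q"
    then obtain e where e: "e \<in> edges F" "e' = snd q e"
      using q unfolding surj_mor_def by (metis imageE)
    have "set (src F e) \<subseteq> verts F" "set (tgt F e) \<subseteq> verts F" using F e by (auto simp: hyp_def)
    then show "src T (snd u e') = map (fst u) (src Q e')" "tgt T (snd u e') = map (fst u) (tgt Q e')"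
      "lab T (snd u e') = lab Q e'"
      using q g e lst uq' by (auto simp: surj_mor_def hyp_mor_def simp del: map_map)
  next
    have Q: "verts Q = fst q ` verts F" "edges Q = snd q ` edges F"
      using q by (simp_all add: surj_mor_def)
    show "fst u ` verts Q \<subseteq> verts T" "snd u ` edges Q \<subseteq> edges T"
      unfolding Q using g uq uq' by (auto simp: hyp_mor_def image_subset_iff)
  qed
qed

text \<open>A coequaliser of two lists of vertices. Since the edges and vertices of \<open>Q\<close> are hit,
  factorisations are unique.\<close>

definition glued where
  "glued \<Sigma> F xs ys Q q \<longleftrightarrow> hyp \<Sigma> Q \<and> surj_mor F Q q \<and> map (fst q) xs = map (fst q) ys \<and>
     (\<forall>(T :: (nat, nat, 'g) hypergraph) g. hyp \<Sigma> T \<and> hyp_mor F T g \<and> map (fst g) xs = map (fst g) ys \<longrightarrow>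
       (\<exists>u. hyp_mor Q T u \<and> hmap_eq F (hmap_comp u q) g)) \<and>
     (\<forall>L R. balanced F (xs @ L) (ys @ R) \<longrightarrow> balanced Q (map (fst q) L) (map (fst q) R))"

lemma glued_balanced:
  fixes F :: "(nat, nat, 'g) hypergraph"
  assumes "glued \<Sigma> F xs ys Q q" "balanced F (xs @ L) (ys @ R)"
  shows "balanced Q (map (fst q) L) (map (fst q) R)"
  using assms unfolding glued_def by blast

lemma glued_factor:
  fixes T :: "(nat, nat, 'g) hypergraph"
  assumes "glued \<Sigma> F xs ys Q q" "hyp \<Sigma> T" "hyp_mor F T g" "map (fst g) xs = map (fst g) ys"
  obtains u where "hyp_mor Q T u" "hmap_eq F (hmap_comp u q) g"
  using assms unfolding glued_def by blast

text \<open>Covers both gluing nothing and gluing a vertex to itself; the two uses differ only in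
  why balance survives.\<close>

lemma glued_refl:
  fixes F :: "(nat, nat, 'g) hypergraph"
  assumes "hyp \<Sigma> F" and "\<And>L R. balanced F (xs @ L) (xs @ R) \<Longrightarrow> balanced F L R"
  shows "glued \<Sigma> F xs xs F hmap_id"
  unfolding glued_def surj_mor_def
proof (intro conjI allI impI; (elim conjE)?)
  fix T :: "(nat, nat, 'g) hypergraph" and g assume "hyp_mor F T g"
  moreover have "hmap_eq F (hmap_comp g hmap_id) g" by (simp add: hmap_eq_def)
  ultimately show "\<exists>u. hyp_mor F T u \<and> hmap_eq F (hmap_comp u hmap_id) g" by blast
qed (use assms hyp_mor_id in auto)

text \<open>Distinct vertices are glued by deleting \<open>x\<close> and redirecting it to
  \<open>y\<close>. If \<open>x = y\<close>, a wire closes into a loop: the hypergraph stays the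
  same, and the counts of this vertex drop from one to zero on both sides.\<close>

lemma glue_pair:
  fixes F :: "(nat, nat, 'g) hypergraph"
  assumes F: "hyp \<Sigma> F" and xy: "x \<in> verts F" "y \<in> verts F"
  shows "\<exists>(Q :: (nat, nat, 'g) hypergraph) q. glued \<Sigma> F [x] [y] Q q"
proof (cases "x = y")
  case True
  have "balanced F L R" if "balanced F ([x] @ L) ([x] @ R)" for L R
    unfolding balanced_def
  proof
    fix v assume "v \<in> verts F"
    with that have "count_list ([x] @ L) v + in_deg F v = count_list ([x] @ R) v + out_deg F v"
      "count_list ([x] @ L) v + in_deg F v \<le> 1"
      unfolding balanced_def by blast+
    then show "count_list L v + in_deg F v = count_list R v + out_deg F v \<and> count_list L v + in_deg F v \<le> 1"
      by (simp split: if_splits)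
  qed
  then have "glued \<Sigma> F [x] [y] F hmap_id"
    using glued_refl[OF F] True by blast
  then show ?thesis by blast
next
  case False
  define f where "f = (\<lambda>v. if v = x then y else v)"
  define Q where "Q = \<lparr>verts = verts F - {x}, edges = edges F, src = (\<lambda>e. map f (src F e)),
    tgt = (\<lambda>e. map f (tgt F e)), lab = lab F\<rparr>"
  have Q: "hyp \<Sigma> Q" using F xy False by (auto simp: hyp_def Q_def f_def subset_iff)
  have q: "surj_mor F Q (f, id)"
    using False xy by (auto simp: surj_mor_def hyp_mor_def Q_def f_def)
  have fin: "finite (edges F)" "finite (edges Q)" using F by (auto simp: hyp_def Q_def)
  have cnt: "count_list (map f vs) w =
      (if w = y then count_list vs x + count_list vs y else if w = x then 0 else count_list vs w)" for vs w
    unfolding f_def by (rule count_list_map_fuse[OF False])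
  have "in_deg Q w = (if w = y then in_deg F x + in_deg F y else if w = x then 0 else in_deg F w)"
    "out_deg Q w = (if w = y then out_deg F x + out_deg F y else if w = x then 0 else out_deg F w)" for w
    unfolding in_deg_sum[OF fin(1)] in_deg_sum[OF fin(2)] out_deg_sum[OF fin(1)] out_deg_sum[OF fin(2)]
    by (auto simp: Q_def cnt sum.distrib)
  note deg = this
  \<comment> \<open>At \<open>x\<close> the glued occurrence exhausts the bound on the left, leaving
    no other left count and exactly one right count. At \<open>y\<close> the roles are exchanged: no
    other right count, exactly one left count. The fused vertex therefore has one count on each
    side.\<close>
  have bal: "balanced Q (map f L) (map f R)" if "balanced F ([x] @ L) ([y] @ R)" for L R
    unfolding balanced_def
  proof
    fix w assume w: "w \<in> verts Q"
    have F: "count_list ([x] @ L) v + in_deg F v = count_list ([y] @ R) v + out_deg F v"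
      "count_list ([x] @ L) v + in_deg F v \<le> 1" if "v \<in> verts F" for v
      using \<open>balanced F ([x] @ L) ([y] @ R)\<close> that unfolding balanced_def by blast+
    have "w \<in> verts F" "w \<noteq> x" using w by (auto simp: Q_def)
    then show "count_list (map f L) w + in_deg Q w = count_list (map f R) w + out_deg Q w \<and>
        count_list (map f L) w + in_deg Q w \<le> 1"
      using F[OF xy(1)] F[OF xy(2)] F[of w] False by (cases "w = y") (auto simp: cnt deg)
  qed
  have "\<exists>u. hyp_mor Q T u \<and> hmap_eq F (hmap_comp u (f, id)) g"
    if "hyp_mor F T g" "map (fst g) [x] = map (fst g) [y]" for T :: "(nat, nat, 'g) hypergraph" and g
  proof -
    \<comment> \<open>Since \<open>g\<close> identifies \<open>x\<close> with \<open>y\<close>, it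
      already serves as its own factorisation.\<close>
    have "hmap_eq F (hmap_comp g (f, id)) g" using that by (auto simp: hmap_eq_def f_def)
    then show ?thesis using hyp_mor_factor[OF q that(1) _ F] by blast
  qed
  then have "glued \<Sigma> F [x] [y] Q (f, id)"
    unfolding glued_def
  proof (intro conjI allI impI; (elim conjE)?)
    show "map (fst (f, id)) [x] = map (fst (f, id)) [y]" by (simp add: f_def)
  qed (use Q q bal in simp_all)
  then show ?thesis by blast
qed

lemma surj_mor_comp:
  assumes "surj_mor F G h" "surj_mor G H k"
  shows "surj_mor F H (hmap_comp k h)"
  using assms hyp_mor_comp[of F G h H k] unfolding surj_mor_def hmap_comp_simps
  by (metis image_comp)

text \<open>After gluing the heads, the tails are pushed along the quotient. Entries that were
  distinct may coincide there, which is another source of the degenerate case of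
  \<open>glue_pair\<close>.\<close>

lemma glue:
  fixes F :: "(nat, nat, 'g) hypergraph"
  assumes "hyp \<Sigma> F" "length xs = length ys" "set xs \<subseteq> verts F" "set ys \<subseteq> verts F"
  shows "\<exists>(Q :: (nat, nat, 'g) hypergraph) q. glued \<Sigma> F xs ys Q q"
  using assms
proof (induction "length xs" arbitrary: F xs ys)
  case 0
  then have "glued \<Sigma> F xs ys F hmap_id"
    using glued_refl[of \<Sigma> F "[]"] by simp
  then show ?case by blast
next
  case (Suc n)
  obtain x xs' where xs: "xs = x # xs'" using Suc.hyps(2) by (cases xs) auto
  obtain y ys' where ys: "ys = y # ys'" using Suc.hyps(2) Suc.prems(2) by (cases ys) auto
  obtain P :: "(nat, nat, 'g) hypergraph" and p where P: "glued \<Sigma> F [x] [y] P p"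
    using glue_pair[of \<Sigma> F x y] Suc.prems xs ys by auto
  have p: "hyp \<Sigma> P" "surj_mor F P p" "fst p x = fst p y" using P by (auto simp: glued_def)
  have "set (map (fst p) xs') \<subseteq> verts P" "set (map (fst p) ys') \<subseteq> verts P"
    using Suc.prems xs ys p(2) by (auto simp: surj_mor_def)
  then obtain Q :: "(nat, nat, 'g) hypergraph" and q
    where Q: "glued \<Sigma> P (map (fst p) xs') (map (fst p) ys') Q q"
    using Suc.hyps(1)[OF _ p(1), of "map (fst p) xs'" "map (fst p) ys'"] Suc.hyps(2) Suc.prems(2) xs ys by auto
  have q: "hyp \<Sigma> Q" "surj_mor P Q q" "map (fst q) (map (fst p) xs') = map (fst q) (map (fst p) ys')"
    using Q by (auto simp: glued_def)
  have "glued \<Sigma> F (x # xs') (y # ys') Q (hmap_comp q p)"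
    unfolding glued_def
  proof (intro conjI allI impI; (elim conjE)?)
    show "hyp \<Sigma> Q" by fact
    show "surj_mor F Q (hmap_comp q p)" using surj_mor_comp[OF p(2) q(2)] .
    show "map (fst (hmap_comp q p)) (x # xs') = map (fst (hmap_comp q p)) (y # ys')"
      using p(3) q(3) by simp
  next
    fix L R assume "balanced F ((x # xs') @ L) ((y # ys') @ R)"
    then have "balanced P (map (fst p) (xs' @ L)) (map (fst p) (ys' @ R))"
      using glued_balanced[OF P, of "xs' @ L" "ys' @ R"] by simp
    then show "balanced Q (map (fst (hmap_comp q p)) L) (map (fst (hmap_comp q p)) R)"
      using glued_balanced[OF Q, of "map (fst p) L" "map (fst p) R"] by simp
  next
    fix T :: "(nat, nat, 'g) hypergraph" and g
    assume T: "hyp \<Sigma> T" and g: "hyp_mor F T g" "map (fst g) (x # xs') = map (fst g) (y # ys')"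
    then obtain u where u: "hyp_mor P T u" "hmap_eq F (hmap_comp u p) g"
      using glued_factor[OF P T g(1)] by auto
    have "map (fst u) (map (fst p) xs') = map (fst g) xs'" "map (fst u) (map (fst p) ys') = map (fst g) ys'"
      using u(2) Suc.prems(3,4) xs ys by (auto simp: hmap_eq_def)
    then obtain w where w: "hyp_mor Q T w" "hmap_eq P (hmap_comp w q) u"
      using glued_factor[OF Q T u(1)] g(2) by (metis list.inject list.map(2))
    have "fst p ` verts F \<subseteq> verts P" "snd p ` edges F \<subseteq> edges P" using p(2) by (auto simp: surj_mor_def)
    then have "hmap_eq F (hmap_comp w (hmap_comp q p)) g"
      using w(2) u(2) by (auto simp: hmap_eq_def image_subset_iff)
    then show "\<exists>u. hyp_mor Q T u \<and> hmap_eq F (hmap_comp u (hmap_comp q p)) g" using w by blast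
  qed
  then show ?case using xs ys by blast
qed

section \<open>Existence of traces, tensors and composites, with preservation of balance\<close>

lemma surj_mor_unique:
  "surj_mor F Q q \<Longrightarrow> hmap_eq F (hmap_comp u q) (hmap_comp v q) \<Longrightarrow> hmap_eq Q u v"
  unfolding surj_mor_def hmap_eq_def by force

text \<open>The apex is the coequaliser of the traced parts of the two interfaces. Existence and
  balance are stated together because both concern this one quotient.\<close>

lemma Rep_tr_ex:
  fixes S :: "'g presheaf"
  assumes S: "presheaf \<Sigma> (x + m) (x + n) S" and C: "C \<in> Rep \<Sigma> S"
  shows "\<exists>E \<in> Rep \<Sigma> (trS x S). balanced (apex C) (left C) (right C) \<longrightarrow>
    balanced (apex E) (left E) (right E)"
proof -
  obtain a where a: "universal \<Sigma> S (apex C) a" "left C = lft a" "right C = rgt a"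
    using C by (auto simp: Rep_def)
  have ha: "hyp \<Sigma> (apex C)" "a \<in> S (apex C)" using a by (auto simp: universal_def)
  note pa = presheafD[OF S ha]
  have "set (take x (lft a)) \<subseteq> verts (apex C)" "set (take x (rgt a)) \<subseteq> verts (apex C)"
    using pa(5,6) by (auto dest: in_set_takeD)
  then obtain Q :: "(nat, nat, 'g) hypergraph" and q
    where Q: "glued \<Sigma> (apex C) (take x (lft a)) (take x (rgt a)) Q q"
    using glue[OF ha(1), of "take x (lft a)" "take x (rgt a)"] pa(1,2) by auto
  have hQ: "hyp \<Sigma> Q" and sq: "surj_mor (apex C) Q q" and q: "hyp_mor (apex C) Q q"
    and eq: "map (fst q) (take x (lft a)) = map (fst q) (take x (rgt a))"
    using Q by (auto simp: glued_def surj_mor_def)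
  have "universal \<Sigma> (trS x S) Q (VTr x (act q a))"
  proof (rule universalI[OF hQ])
    show "VTr x (act q a) \<in> trS x S Q"
      using pa(7)[OF hQ q] eq by (simp add: trS_def take_map)
  next
    fix T c assume T: "hyp \<Sigma> T" and "c \<in> trS x S T"
    then obtain b where c: "c = VTr x b" "b \<in> S T" "take x (lft b) = take x (rgt b)"
      by (auto simp: trS_def)
    obtain g where g: "hyp_mor (apex C) T g" "act g a = b" using universal_ex[OF a(1) T c(2)] .
    have "map (fst g) (take x (lft a)) = map (fst g) (take x (rgt a))"
      using c(3) g(2) by (auto simp: take_map)
    then obtain u where u: "hyp_mor Q T u" "hmap_eq (apex C) (hmap_comp u q) g"
      using glued_factor[OF Q T g(1)] by blast
    have "act u (act q a) = b" using act_cong[OF pa(3,4) u(2)] g by (simp add: act_comp)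
    then show "\<exists>h. hyp_mor Q T h \<and> act h (VTr x (act q a)) = c"
      using u c by (intro exI[of _ u]) simp
  next
    fix T :: "(nat, nat, 'g) hypergraph" and u v
    assume T: "hyp \<Sigma> T" and u: "hyp_mor Q T u" and v: "hyp_mor Q T v"
      and "act u (VTr x (act q a)) = act v (VTr x (act q a))"
    then show "hmap_eq Q u v"
      using universal_unique[OF a(1) T pa(7)[OF T hyp_mor_comp[OF q u]] hyp_mor_comp[OF q u] hyp_mor_comp[OF q v]]
        surj_mor_unique[OF sq] by (simp add: act_comp)
  qed
  then have "\<lparr>apex = Q, left = map (fst q) (drop x (lft a)), right = map (fst q) (drop x (rgt a))\<rparr>
      \<in> Rep \<Sigma> (trS x S)" by (auto simp: Rep_def drop_map)
  moreover have "balanced (apex C) (left C) (right C) \<longrightarrow>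
      balanced Q (map (fst q) (drop x (lft a))) (map (fst q) (drop x (rgt a)))"
    using glued_balanced[OF Q] a by (metis append_take_drop_id)
  ultimately show ?thesis by (intro bexI) auto
qed

lemma Rep_ten_ex:
  fixes S1 S2 :: "'g presheaf"
  assumes S1: "presheaf \<Sigma> m n S1" and S2: "presheaf \<Sigma> p q S2"
    and C: "C \<in> Rep \<Sigma> S1" and D: "D \<in> Rep \<Sigma> S2"
  shows "\<exists>E \<in> Rep \<Sigma> (tenS S1 S2). balanced (apex C) (left C) (right C) \<and> balanced (apex D) (left D) (right D) \<longrightarrow>
    balanced (apex E) (left E) (right E)"
proof -
  have K: "is_cospan \<Sigma> (m + p) (n + q) (cospan_sum C D)"
    using is_cospan_sum Rep_is_cospan[OF S1 C] Rep_is_cospan[OF S2 D] .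
  obtain N :: "(nat, nat, 'g) cospan" where N: "cospan_iso (cospan_sum C D) N" using nat_copy[OF K] .
  have "N \<in> Rep \<Sigma> (tenS S1 S2)"
    using N Rep_ten[OF assms] by (simp add: csp_class_def)
  moreover have "balanced (apex N) (left N) (right N)"
    if "balanced (apex C) (left C) (right C)" "balanced (apex D) (left D) (right D)"
    using balanced_iso[OF N K] balanced_sum[of \<Sigma> "apex C" _ _ "apex D"] that
      Rep_is_cospan[OF S1 C] Rep_is_cospan[OF S2 D]
    by (auto simp: cospan_sum_def is_cospan_def)
  ultimately show ?thesis by blast
qed

text \<open>A pushout is a coequaliser of a disjoint union: the tensor already exists, and the
  shared interface is glued in it.\<close>

lemma Rep_seq_ex:
  fixes S1 S2 :: "'g presheaf"
  assumes S1: "presheaf \<Sigma> m n S1" and S2: "presheaf \<Sigma> n p S2"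
    and C: "C \<in> Rep \<Sigma> S1" and D: "D \<in> Rep \<Sigma> S2"
  shows "\<exists>E \<in> Rep \<Sigma> (seqS S1 S2). balanced (apex C) (left C) (right C) \<and> balanced (apex D) (left D) (right D) \<longrightarrow>
    balanced (apex E) (left E) (right E)"
proof -
  obtain N where N: "N \<in> Rep \<Sigma> (tenS S1 S2)" and Nbal: "balanced (apex C) (left C) (right C) \<and>
      balanced (apex D) (left D) (right D) \<longrightarrow> balanced (apex N) (left N) (right N)"
    using Rep_ten_ex[OF assms] by blast
  obtain c where c: "universal \<Sigma> (tenS S1 S2) (apex N) c" "left N = lft c" "right N = rgt c"
    using N by (auto simp: Rep_def)
  have hN: "hyp \<Sigma> (apex N)" "c \<in> tenS S1 S2 (apex N)" using c by (auto simp: universal_def)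
  then obtain a b where ab: "c = VTen a b" "a \<in> S1 (apex N)" "b \<in> S2 (apex N)"
    by (auto simp: tenS_def)
  note pa = presheafD[OF S1 hN(1) ab(2)] and pb = presheafD[OF S2 hN(1) ab(3)]
  \<comment> \<open>The order matters for balance: the first list counts on the left and the second
    on the right, and in the disjoint union \<open>lft b\<close> belongs to the left interface and
    \<open>rgt a\<close> to the right one.\<close>
  obtain Q :: "(nat, nat, 'g) hypergraph" and q where Q: "glued \<Sigma> (apex N) (lft b) (rgt a) Q q"
    using glue[OF hN(1), of "lft b" "rgt a"] pa(2,6) pb(1,5) by auto
  have hQ: "hyp \<Sigma> Q" and sq: "surj_mor (apex N) Q q" and q: "hyp_mor (apex N) Q q"
    and eq: "map (fst q) (lft b) = map (fst q) (rgt a)"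
    using Q by (auto simp: glued_def surj_mor_def)
  have "universal \<Sigma> (seqS S1 S2) Q (VSeq (act q a) (act q b))"
  proof (rule universalI[OF hQ])
    show "VSeq (act q a) (act q b) \<in> seqS S1 S2 Q"
      using pa(7)[OF hQ q] pb(7)[OF hQ q] eq by (simp add: seqS_def)
  next
    fix T d assume T: "hyp \<Sigma> T" and "d \<in> seqS S1 S2 T"
    then obtain a' b' where d: "d = VSeq a' b'" "a' \<in> S1 T" "b' \<in> S2 T" "rgt a' = lft b'"
      by (auto simp: seqS_def)
    then have "VTen a' b' \<in> tenS S1 S2 T" by (simp add: tenS_def)
    then obtain g where g: "hyp_mor (apex N) T g" "act g c = VTen a' b'"
      using universal_ex[OF c(1) T] by metis
    have g': "act g a = a'" "act g b = b'" using g(2) ab by auto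
    have "map (fst g) (lft b) = map (fst g) (rgt a)"
      using d(4) by (simp flip: g')
    then obtain u where u: "hyp_mor Q T u" "hmap_eq (apex N) (hmap_comp u q) g"
      using glued_factor[OF Q T g(1)] by blast
    have "act u (act q a) = a'" "act u (act q b) = b'"
      using act_cong[OF pa(3,4) u(2)] act_cong[OF pb(3,4) u(2)] g' by (simp_all add: act_comp)
    then show "\<exists>h. hyp_mor Q T h \<and> act h (VSeq (act q a) (act q b)) = d"
      using u d by (intro exI[of _ u]) simp
  next
    fix T :: "(nat, nat, 'g) hypergraph" and u v
    assume T: "hyp \<Sigma> T" and u: "hyp_mor Q T u" and v: "hyp_mor Q T v"
      and uv: "act u (VSeq (act q a) (act q b)) = act v (VSeq (act q a) (act q b))"
    have "act (hmap_comp u q) c \<in> tenS S1 S2 T"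
      using pa(7)[OF T hyp_mor_comp[OF q u]] pb(7)[OF T hyp_mor_comp[OF q u]] ab(1)
      by (simp add: tenS_def)
    then show "hmap_eq Q u v"
      using universal_unique[OF c(1) T _ hyp_mor_comp[OF q u] hyp_mor_comp[OF q v]] uv ab(1)
        surj_mor_unique[OF sq] by (simp add: act_comp)
  qed
  then have "\<lparr>apex = Q, left = map (fst q) (lft a), right = map (fst q) (rgt b)\<rparr> \<in> Rep \<Sigma> (seqS S1 S2)"
    by (auto simp: Rep_def)
  moreover have "balanced Q (map (fst q) (lft a)) (map (fst q) (rgt b))" if "balanced (apex N) (left N) (right N)"
  proof -
    \<comment> \<open>Balance depends only on multiplicities, so the glued part may be moved to the
      front.\<close>
    have "balanced (apex N) (lft b @ lft a) (rgt a @ rgt b)"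
      using that c ab by (auto simp: balanced_def add.commute add.left_commute)
    then show ?thesis using glued_balanced[OF Q] by blast
  qed
  ultimately show ?thesis using Nbal by (intro bexI) auto
qed


section \<open>Presheaves determined by their boundary\<close>

text \<open>The relation between the two boundaries that a presheaf induces; it forgets the
  valuation and turns composition into relational composition.\<close>

definition bd :: "'g presheaf \<Rightarrow> (nat, nat, 'g) hypergraph \<Rightarrow> nat list \<Rightarrow> nat list \<Rightarrow> bool" where
  "bd S T l r \<longleftrightarrow> (\<exists>a \<in> S T. lft a = l \<and> rgt a = r)"

definition ldet :: "'g signature \<Rightarrow> 'g presheaf \<Rightarrow> bool" where
  "ldet \<Sigma> S \<longleftrightarrow> (\<forall>T. hyp \<Sigma> T \<longrightarrow> inj_on lft (S T))"

definition rdet :: "'g signature \<Rightarrow> 'g presheaf \<Rightarrow> bool" where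
  "rdet \<Sigma> S \<longleftrightarrow> (\<forall>T. hyp \<Sigma> T \<longrightarrow> inj_on rgt (S T))"

text \<open>If one boundary determines the valuation, matching boundaries is already a bijection.
  Either side must be allowed: the unit has its vertex only on the right and the counit only on the
  left. Generators are determined by neither, because parallel edges may share all sources and
  targets.\<close>

lemma Rep_eqI_bd:
  assumes "presheaf \<Sigma> m n S" "presheaf \<Sigma> m' n' S'"
    and "ldet \<Sigma> S \<and> ldet \<Sigma> S' \<or> rdet \<Sigma> S \<and> rdet \<Sigma> S'"
    and "\<And>T l r. hyp \<Sigma> T \<Longrightarrow> bd S T l r \<longleftrightarrow> bd S' T l r"
  shows "Rep \<Sigma> S = Rep \<Sigma> S'"
proof (rule Rep_eqI[OF assms(1,2), where R = "\<lambda>a b. lft a = lft b \<and> rgt a = rgt b"])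
  fix T a assume "hyp \<Sigma> T" "a \<in> S T"
  then have "bd S' T (lft a) (rgt a)"
    using assms(4)[of T "lft a" "rgt a"] by (auto simp: bd_def)
  then show "\<exists>b \<in> S' T. lft a = lft b \<and> rgt a = rgt b"
    unfolding bd_def by metis
next
  fix T b assume "hyp \<Sigma> T" "b \<in> S' T"
  then have "bd S T (lft b) (rgt b)"
    using assms(4)[of T "lft b" "rgt b"] by (auto simp: bd_def)
  then show "\<exists>a \<in> S T. lft a = lft b \<and> rgt a = rgt b"
    unfolding bd_def by metis
next
  fix T a a' b b' assume "hyp \<Sigma> T" "a \<in> S T" "b \<in> S' T" "a' \<in> S T" "b' \<in> S' T"
    "lft a = lft b \<and> rgt a = rgt b" "lft a' = lft b' \<and> rgt a' = rgt b'"
  then show "a = a' \<longleftrightarrow> b = b'"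
    using assms(3) unfolding ldet_def rdet_def inj_on_def by metis
qed auto

section \<open>Identities and symmetries\<close>

abbreviation idS :: "nat \<Rightarrow> 'g presheaf" where
  "idS n \<equiv> discS n [0..<n] [0..<n]"

abbreviation symS :: "nat \<Rightarrow> nat \<Rightarrow> 'g presheaf" where
  "symS m n \<equiv> discS (m + n) [0..<m + n] ([m..<m + n] @ [0..<m])"

abbreviation idV :: "nat list \<Rightarrow> (nat, nat) valuation" where
  "idV vs \<equiv> VLeaf [] vs vs vs"

abbreviation symV :: "nat list \<Rightarrow> nat list \<Rightarrow> (nat, nat) valuation" where
  "symV us vs \<equiv> VLeaf [] (us @ vs) (us @ vs) (vs @ us)"

lemma map_nth_upt: "length vs = n \<Longrightarrow> map ((!) vs) [0..<n] = vs"
  using map_nth by blast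

lemma idS_eq: "idS n T = {idV vs | vs. length vs = n \<and> set vs \<subseteq> verts T}"
  by (auto simp: discS_def map_nth_upt)

lemma symS_eq:
  "symS m n T = {symV us vs | us vs. length us = m \<and> length vs = n \<and> set us \<subseteq> verts T \<and> set vs \<subseteq> verts T}"
proof -
  have nths: "map ((!) ws) [m..<m + n] = drop m ws" "map ((!) ws) [0..<m] = take m ws"
    if "length ws = m + n" for ws :: "nat list"
    using that by (auto intro!: nth_equalityI)
  show ?thesis
  proof (intro equalityI subsetI)
    fix a assume "a \<in> symS m n T"
    then obtain ws where ws: "length ws = m + n" "set ws \<subseteq> verts T" "a = VLeaf [] ws ws (drop m ws @ take m ws)"
      by (auto simp: discS_def map_nth_upt nths simp del: upt_add_eq_append)
    then have "a = symV (take m ws) (drop m ws)" by simp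
    moreover have "set (take m ws) \<subseteq> verts T" "set (drop m ws) \<subseteq> verts T"
      using ws by (auto dest: in_set_takeD in_set_dropD)
    ultimately show "a \<in> {symV us vs | us vs. length us = m \<and> length vs = n \<and> set us \<subseteq> verts T \<and> set vs \<subseteq> verts T}"
      using ws(1) by (intro CollectI exI[of _ "take m ws"] exI[of _ "drop m ws"]) auto
  next
    fix a assume "a \<in> {symV us vs | us vs. length us = m \<and> length vs = n \<and> set us \<subseteq> verts T \<and> set vs \<subseteq> verts T}"
    then obtain us vs where a: "a = symV us vs" "length us = m" "length vs = n" "set us \<subseteq> verts T" "set vs \<subseteq> verts T"
      by blast
    then have "a = VLeaf [] (us @ vs) (map ((!) (us @ vs)) [0..<m + n]) (map ((!) (us @ vs)) ([m..<m + n] @ [0..<m]))"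
      unfolding map_append using nths[of "us @ vs"] by (simp add: map_nth_upt del: upt_add_eq_append)
    then show "a \<in> symS m n T"
      unfolding discS_def using a by (intro CollectI exI[of _ "us @ vs"]) simp
  qed
qed

lemma symV_in:
  "length us = m \<Longrightarrow> length vs = n \<Longrightarrow> set us \<subseteq> verts T \<Longrightarrow> set vs \<subseteq> verts T \<Longrightarrow> symV us vs \<in> symS m n T"
  unfolding symS_eq by blast

lemma symS_E:
  assumes "a \<in> symS m n T"
  obtains us vs where "a = symV us vs" "length us = m" "length vs = n" "set us \<subseteq> verts T" "set vs \<subseteq> verts T"
  using assms unfolding symS_eq by blast

lemma seqS_E:
  assumes "c \<in> seqS S1 S2 T"
  obtains a b where "c = VSeq a b" "a \<in> S1 T" "b \<in> S2 T" "rgt a = lft b"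
  using assms unfolding seqS_def by blast

lemma tenS_E:
  assumes "c \<in> tenS S1 S2 T"
  obtains a b where "c = VTen a b" "a \<in> S1 T" "b \<in> S2 T"
  using assms unfolding tenS_def by blast

lemma valuation_in:
  "VSeq a b \<in> seqS S1 S2 T \<longleftrightarrow> a \<in> S1 T \<and> b \<in> S2 T \<and> rgt a = lft b"
  "VTen a b \<in> tenS S1 S2 T \<longleftrightarrow> a \<in> S1 T \<and> b \<in> S2 T"
  "VTr x a \<in> trS x S T \<longleftrightarrow> a \<in> S T \<and> take x (lft a) = take x (rgt a)"
  by (auto simp: seqS_def tenS_def trS_def)

lemma idV_in: "idV vs \<in> idS n T \<longleftrightarrow> length vs = n \<and> set vs \<subseteq> verts T"
  unfolding idS_eq by blast

lemma presheaf_id: "presheaf \<Sigma> n n (idS n)"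
  by (rule presheaf_disc) auto

lemma presheaf_sym: "presheaf \<Sigma> (m + n) (n + m) (symS m n)"
  by (rule presheaf_disc) auto

section \<open>Boundary relations of composites and of discrete cospans\<close>

lemma bd_seq: "bd (seqS S1 S2) T l r \<longleftrightarrow> (\<exists>c. bd S1 T l c \<and> bd S2 T c r)"
  by (fastforce simp: bd_def seqS_def)

lemma bd_ten: "bd (tenS S1 S2) T l r \<longleftrightarrow>
    (\<exists>l1 l2 r1 r2. l = l1 @ l2 \<and> r = r1 @ r2 \<and> bd S1 T l1 r1 \<and> bd S2 T l2 r2)"
  by (fastforce simp: bd_def tenS_def)

lemma bd_id: "bd (idS n) T l r \<longleftrightarrow> r = l \<and> length l = n \<and> set l \<subseteq> verts T"
  by (auto simp: bd_def idS_eq)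

lemma bd_sym: "bd (symS m n) T l r \<longleftrightarrow> (\<exists>us vs. l = us @ vs \<and> r = vs @ us \<and>
    length us = m \<and> length vs = n \<and> set us \<subseteq> verts T \<and> set vs \<subseteq> verts T)"
    (is "?L \<longleftrightarrow> ?R")
proof
  assume ?L
  then obtain us vs where "l = us @ vs" "r = vs @ us" "length us = m" "length vs = n"
    "set us \<subseteq> verts T" "set vs \<subseteq> verts T"
    unfolding bd_def symS_eq by force
  then show ?R by blast
next
  assume ?R
  then obtain us vs where *: "l = us @ vs" "r = vs @ us" "length us = m" "length vs = n"
    "set us \<subseteq> verts T" "set vs \<subseteq> verts T" by blast
  then have "symV us vs \<in> symS m n T" unfolding symS_eq by blast
  then show ?L unfolding bd_def using * by (intro bexI[of _ "symV us vs"]) simp_all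
qed

lemma bd_disc1: "bd (discS 1 (replicate p 0) (replicate q 0)) T l r \<longleftrightarrow>
    (\<exists>v \<in> verts T. l = replicate p v \<and> r = replicate q v)"
proof
  assume "bd (discS 1 (replicate p 0) (replicate q 0)) T l r"
  then show "\<exists>v \<in> verts T. l = replicate p v \<and> r = replicate q v"
    by (auto simp: bd_def discS_def length_Suc_conv)
next
  assume "\<exists>v \<in> verts T. l = replicate p v \<and> r = replicate q v"
  then obtain v where "v \<in> verts T" "l = replicate p v" "r = replicate q v" by blast
  then show "bd (discS 1 (replicate p 0) (replicate q 0)) T l r"
    unfolding bd_def discS_def by (intro bexI[of _ "VLeaf [] [v] l r"]) (auto intro!: exI[of _ "[v]"])
qed

lemma bd_frob:
  "bd (discS 1 [0, 0] [0]) T l r \<longleftrightarrow> (\<exists>v \<in> verts T. l = [v, v] \<and> r = [v])"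
  "bd (discS 1 [] [0]) T l r \<longleftrightarrow> (\<exists>v \<in> verts T. l = [] \<and> r = [v])"
  "bd (discS 1 [0] [0, 0]) T l r \<longleftrightarrow> (\<exists>v \<in> verts T. l = [v] \<and> r = [v, v])"
  "bd (discS 1 [0] []) T l r \<longleftrightarrow> (\<exists>v \<in> verts T. l = [v] \<and> r = [])"
  using bd_disc1[of 2 1 T l r] bd_disc1[of 0 1 T l r] bd_disc1[of 1 2 T l r] bd_disc1[of 1 0 T l r]
  by (simp_all add: numeral_2_eq_2)

section \<open>Determinacy by one boundary\<close>

lemma ldet_disc: "{..<k} \<subseteq> set f \<Longrightarrow> ldet \<Sigma> (discS k f g)"
proof -
  assume "{..<k} \<subseteq> set f"
  then have "vs = ws" if "map ((!) vs) f = map ((!) ws) f" "length vs = k" "length ws = k" for vs ws :: "nat list"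
    using that by (intro nth_equalityI) (auto simp: subset_iff)
  then show ?thesis by (fastforce simp: ldet_def inj_on_def discS_def)
qed

lemma rdet_disc: "{..<k} \<subseteq> set g \<Longrightarrow> rdet \<Sigma> (discS k f g)"
proof -
  assume "{..<k} \<subseteq> set g"
  then have "vs = ws" if "map ((!) vs) g = map ((!) ws) g" "length vs = k" "length ws = k" for vs ws :: "nat list"
    using that by (intro nth_equalityI) (auto simp: subset_iff)
  then show ?thesis by (fastforce simp: rdet_def inj_on_def discS_def)
qed

lemma ldet_seq: "ldet \<Sigma> S1 \<Longrightarrow> ldet \<Sigma> S2 \<Longrightarrow> ldet \<Sigma> (seqS S1 S2)"
  unfolding ldet_def inj_on_def seqS_def by clarsimp metis

lemma rdet_seq: "rdet \<Sigma> S1 \<Longrightarrow> rdet \<Sigma> S2 \<Longrightarrow> rdet \<Sigma> (seqS S1 S2)"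
  unfolding rdet_def inj_on_def seqS_def by clarsimp metis

text \<open>The presheaf hypothesis fixes the length of the first factor's boundary, which tells
  where the concatenated boundary is to be cut.\<close>

lemma ldet_ten:
  assumes S1: "presheaf \<Sigma> m n S1" and "ldet \<Sigma> S1" "ldet \<Sigma> S2"
  shows "ldet \<Sigma> (tenS S1 S2)"
  unfolding ldet_def
proof (intro allI impI inj_onI)
  fix T c c' assume T: "hyp \<Sigma> T" and "c \<in> tenS S1 S2 T" "c' \<in> tenS S1 S2 T" and eq: "lft c = lft c'"
  then obtain a b a' b' where ab: "c = VTen a b" "a \<in> S1 T" "b \<in> S2 T" "c' = VTen a' b'" "a' \<in> S1 T" "b' \<in> S2 T"
    by (auto simp: tenS_def)
  then have "lft a = lft a'" "lft b = lft b'" using presheafD(1)[OF S1 T] eq by auto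
  then show "c = c'" using ab assms(2,3) T by (auto simp: ldet_def dest: inj_onD)
qed

lemma rdet_ten:
  assumes S1: "presheaf \<Sigma> m n S1" and "rdet \<Sigma> S1" "rdet \<Sigma> S2"
  shows "rdet \<Sigma> (tenS S1 S2)"
  unfolding rdet_def
proof (intro allI impI inj_onI)
  fix T c c' assume T: "hyp \<Sigma> T" and "c \<in> tenS S1 S2 T" "c' \<in> tenS S1 S2 T" and eq: "rgt c = rgt c'"
  then obtain a b a' b' where ab: "c = VTen a b" "a \<in> S1 T" "b \<in> S2 T" "c' = VTen a' b'" "a' \<in> S1 T" "b' \<in> S2 T"
    by (auto simp: tenS_def)
  then have "rgt a = rgt a'" "rgt b = rgt b'" using presheafD(2)[OF S1 T] eq by auto
  then show "c = c'" using ab assms(2,3) T by (auto simp: rdet_def dest: inj_onD)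
qed

lemma det_id_sym: "ldet \<Sigma> (idS n)" "rdet \<Sigma> (idS n)" "ldet \<Sigma> (symS m n)" "rdet \<Sigma> (symS m n)"
  by (auto intro!: ldet_disc rdet_disc)


section \<open>The equations hold for presheaves\<close>

lemma Rep_seq_assoc:
  assumes S: "presheaf \<Sigma> m n S1" "presheaf \<Sigma> n p S2" "presheaf \<Sigma> p q S3"
  shows "Rep \<Sigma> (seqS (seqS S1 S2) S3) = Rep \<Sigma> (seqS S1 (seqS S2 S3))"
  by (rule Rep_eqI[OF presheaf_seq[OF presheaf_seq[OF S(1,2)] S(3)] presheaf_seq[OF S(1) presheaf_seq[OF S(2,3)]],
        where R = "\<lambda>a b. \<exists>x y z. a = VSeq (VSeq x y) z \<and> b = VSeq x (VSeq y z)"])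
    (auto simp: seqS_def)

lemma Rep_id_left:
  assumes S: "presheaf \<Sigma> m n S"
  shows "Rep \<Sigma> (seqS (idS m) S) = Rep \<Sigma> S"
  by (rule Rep_eqI[OF presheaf_seq[OF presheaf_id S] S, where R = "\<lambda>a b. a = VSeq (idV (lft b)) b"])
    (auto simp: seqS_def idS_eq dest: presheafD[OF S])

lemma Rep_id_right:
  assumes S: "presheaf \<Sigma> m n S"
  shows "Rep \<Sigma> (seqS S (idS n)) = Rep \<Sigma> S"
  by (rule Rep_eqI[OF presheaf_seq[OF S presheaf_id] S, where R = "\<lambda>a b. a = VSeq b (idV (rgt b))"])
    (auto simp: seqS_def idS_eq dest: presheafD[OF S])

lemma Rep_ten_assoc:
  assumes S: "presheaf \<Sigma> m n S1" "presheaf \<Sigma> m' n' S2" "presheaf \<Sigma> m'' n'' S3"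
  shows "Rep \<Sigma> (tenS (tenS S1 S2) S3) = Rep \<Sigma> (tenS S1 (tenS S2 S3))"
  by (rule Rep_eqI[OF presheaf_ten[OF presheaf_ten[OF S(1,2)] S(3)] presheaf_ten[OF S(1) presheaf_ten[OF S(2,3)]],
        where R = "\<lambda>a b. \<exists>x y z. a = VTen (VTen x y) z \<and> b = VTen x (VTen y z)"])
    (auto simp: tenS_def)

lemma Rep_ten_unit_left:
  assumes S: "presheaf \<Sigma> m n S"
  shows "Rep \<Sigma> (tenS (idS 0) S) = Rep \<Sigma> S"
  by (rule Rep_eqI[OF presheaf_ten[OF presheaf_id S] S, where R = "\<lambda>a b. a = VTen (idV []) b"])
    (auto simp: tenS_def discS_def)

lemma Rep_ten_unit_right:
  assumes S: "presheaf \<Sigma> m n S"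
  shows "Rep \<Sigma> (tenS S (idS 0)) = Rep \<Sigma> S"
  by (rule Rep_eqI[OF presheaf_ten[OF S presheaf_id] S, where R = "\<lambda>a b. a = VTen b (idV [])"])
    (auto simp: tenS_def discS_def)

text \<open>Composability of two tensors is a single equation between concatenations; the types
  split it into the two equations of the other side.\<close>

lemma Rep_interchange:
  assumes S: "presheaf \<Sigma> m n S1" "presheaf \<Sigma> n p S2" "presheaf \<Sigma> m' n' S3" "presheaf \<Sigma> n' p' S4"
  shows "Rep \<Sigma> (tenS (seqS S1 S2) (seqS S3 S4)) = Rep \<Sigma> (seqS (tenS S1 S3) (tenS S2 S4))"
proof (rule Rep_eqI[OF presheaf_ten[OF presheaf_seq[OF S(1,2)] presheaf_seq[OF S(3,4)]]
      presheaf_seq[OF presheaf_ten[OF S(1,3)] presheaf_ten[OF S(2,4)]],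
      where R = "\<lambda>a b. \<exists>x y z w. a = VTen (VSeq x y) (VSeq z w) \<and> b = VSeq (VTen x z) (VTen y w)"])
  fix T b assume T: "hyp \<Sigma> T" and "b \<in> seqS (tenS S1 S3) (tenS S2 S4) T"
  then obtain x y z w where b: "b = VSeq (VTen x z) (VTen y w)" "rgt x @ rgt z = lft y @ lft w"
    "x \<in> S1 T" "y \<in> S2 T" "z \<in> S3 T" "w \<in> S4 T"
    by (auto simp: seqS_def tenS_def)
  then have "rgt x = lft y" "rgt z = lft w"
    using presheafD(2)[OF S(1) T] presheafD(1)[OF S(2) T] by auto
  then show "\<exists>a \<in> tenS (seqS S1 S2) (seqS S3 S4) T.
      \<exists>x y z w. a = VTen (VSeq x y) (VSeq z w) \<and> b = VSeq (VTen x z) (VTen y w)"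
    using b by (auto simp: seqS_def tenS_def)
qed (auto simp: seqS_def tenS_def)

text \<open>Given the valuations of the two factors, the one of the symmetry is forced, by their
  right boundaries on one side of the equation and by their left boundaries on the other.\<close>

lemma Rep_sym_nat:
  assumes S: "presheaf \<Sigma> m n S1" "presheaf \<Sigma> p q S2"
  shows "Rep \<Sigma> (seqS (tenS S1 S2) (symS n q)) = Rep \<Sigma> (seqS (symS m p) (tenS S2 S1))"
proof (rule Rep_eqI[OF presheaf_seq[OF presheaf_ten[OF S] presheaf_sym] presheaf_seq[OF presheaf_sym presheaf_ten[OF S(2,1)]],
      where R = "\<lambda>a b. \<exists>x y. a = VSeq (VTen x y) (symV (rgt x) (rgt y)) \<and> b = VSeq (symV (lft x) (lft y)) (VTen y x)"])
  fix T a assume T: "hyp \<Sigma> T" and "a \<in> seqS (tenS S1 S2) (symS n q) T"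
  then obtain c d where a: "a = VSeq c d" "c \<in> tenS S1 S2 T" "d \<in> symS n q T" "rgt c = lft d"
    by (elim seqS_E)
  obtain x y where c: "c = VTen x y" "x \<in> S1 T" "y \<in> S2 T" using a(2) by (elim tenS_E)
  note p = presheafD(1,2,5,6)[OF S(1) T c(2)] presheafD(1,2,5,6)[OF S(2) T c(3)]
  obtain us vs where d: "d = symV us vs" "length us = n" "length vs = q" using a(3) by (elim symS_E)
  have "us = rgt x" "vs = rgt y" using a(4) c(1) d p by auto
  then show "\<exists>b \<in> seqS (symS m p) (tenS S2 S1) T.
      \<exists>x y. a = VSeq (VTen x y) (symV (rgt x) (rgt y)) \<and> b = VSeq (symV (lft x) (lft y)) (VTen y x)"
    using a c d p symV_in
    by (intro bexI[of _ "VSeq (symV (lft x) (lft y)) (VTen y x)"] exI[of _ x] exI[of _ y])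
      (simp_all add: valuation_in)
next
  fix T b assume T: "hyp \<Sigma> T" and "b \<in> seqS (symS m p) (tenS S2 S1) T"
  then obtain c d where a: "b = VSeq d c" "c \<in> tenS S2 S1 T" "d \<in> symS m p T" "rgt d = lft c"
    by (elim seqS_E)
  obtain x y where c: "c = VTen y x" "x \<in> S1 T" "y \<in> S2 T" using a(2) by (elim tenS_E)
  note p = presheafD(1,2,5,6)[OF S(1) T c(2)] presheafD(1,2,5,6)[OF S(2) T c(3)]
  obtain us vs where d: "d = symV us vs" "length us = m" "length vs = p" using a(3) by (elim symS_E)
  have "us = lft x" "vs = lft y" using a(4) c(1) d p by auto
  then show "\<exists>a \<in> seqS (tenS S1 S2) (symS n q) T.
      \<exists>x y. a = VSeq (VTen x y) (symV (rgt x) (rgt y)) \<and> b = VSeq (symV (lft x) (lft y)) (VTen y x)"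
    using a c d p symV_in
    by (intro bexI[of _ "VSeq (VTen x y) (symV (rgt x) (rgt y))"] exI[of _ x] exI[of _ y])
      (simp_all add: valuation_in)
qed auto

lemma Rep_ten_id: "Rep \<Sigma> (tenS (idS m) (idS n)) = Rep \<Sigma> (idS (m + n))"
proof (rule Rep_eqI_bd[OF presheaf_ten[OF presheaf_id presheaf_id] presheaf_id])
  fix T :: "(nat, nat, 'a) hypergraph" and l r :: "nat list"
  show "bd (tenS (idS m) (idS n)) T l r \<longleftrightarrow> bd (idS (m + n)) T l r"
  proof
    assume "bd (idS (m + n)) T l r"
    then have l: "r = l" "length l = m + n" "set l \<subseteq> verts T" by (auto simp: bd_id)
    then have "set (take m l) \<subseteq> verts T" "set (drop m l) \<subseteq> verts T"
      by (auto dest: in_set_takeD in_set_dropD)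
    then have "bd (idS m) T (take m l) (take m l)" "bd (idS n) T (drop m l) (drop m l)"
      unfolding bd_id using l by simp_all
    then show "bd (tenS (idS m) (idS n)) T l r"
      unfolding bd_ten using l(1) append_take_drop_id[of m l] by metis
  qed (auto simp: bd_ten bd_id)
qed (use ldet_ten[OF presheaf_id] det_id_sym in blast)

lemma Rep_sym_inv: "Rep \<Sigma> (seqS (symS m n) (symS n m)) = Rep \<Sigma> (idS (m + n))"
proof (rule Rep_eqI_bd[OF presheaf_seq[OF presheaf_sym presheaf_sym] presheaf_id])
  fix T :: "(nat, nat, 'a) hypergraph" and l r :: "nat list"
  show "bd (seqS (symS m n) (symS n m)) T l r \<longleftrightarrow> bd (idS (m + n)) T l r" (is "?L \<longleftrightarrow> ?R")
  proof
    assume ?R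
    then have l: "r = l" "length l = m + n" "set l \<subseteq> verts T" by (auto simp: bd_id)
    then have "set (take m l) \<subseteq> verts T" "set (drop m l) \<subseteq> verts T"
      by (auto dest: in_set_takeD in_set_dropD)
    moreover have "length (take m l) = m" "length (drop m l) = n" using l by simp_all
    ultimately have "bd (symS m n) T l (drop m l @ take m l)" "bd (symS n m) T (drop m l @ take m l) r"
      unfolding bd_sym using l(1) append_take_drop_id[of m l] by metis+
    then show ?L unfolding bd_seq by blast
  next
    assume ?L
    then obtain us vs us' vs' where *: "l = us @ vs" "vs @ us = us' @ vs'" "r = vs' @ us'"
      "length us = m" "length vs = n" "length us' = n" "set us \<subseteq> verts T" "set vs \<subseteq> verts T"
      unfolding bd_seq bd_sym by blast
    then have "us' = vs" "vs' = us" by auto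
    then show ?R unfolding bd_id using * by simp
  qed
qed (use ldet_seq det_id_sym in blast)

lemma Rep_sym_hex:
  "Rep \<Sigma> (symS m (n + p)) = Rep \<Sigma> (seqS (tenS (symS m n) (idS p)) (tenS (idS n) (symS m p)))"
proof (rule Rep_eqI_bd[OF presheaf_sym])
  show "presheaf \<Sigma> (m + n + p) (n + (p + m)) (seqS (tenS (symS m n) (idS p)) (tenS (idS n) (symS m p)))"
    using presheaf_seq[OF presheaf_ten[OF presheaf_sym[of \<Sigma> m n] presheaf_id[of \<Sigma> p]]]
      presheaf_ten[OF presheaf_id[of \<Sigma> n] presheaf_sym[of \<Sigma> m p]] by (simp only: add.assoc)
next
  fix T :: "(nat, nat, 'a) hypergraph" and l r :: "nat list"
  show "bd (symS m (n + p)) T l r \<longleftrightarrow> bd (seqS (tenS (symS m n) (idS p)) (tenS (idS n) (symS m p))) T l r"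
    (is "?L \<longleftrightarrow> ?R")
  proof
    assume ?L
    then obtain us vs where *: "l = us @ vs" "r = vs @ us" "length us = m" "length vs = n + p"
      "set us \<subseteq> verts T" "set vs \<subseteq> verts T" by (auto simp: bd_sym)
    define v w where "v = take n vs" and "w = drop n vs"
    have vw: "vs = v @ w" "length v = n" "length w = p" "set v \<subseteq> verts T" "set w \<subseteq> verts T"
      using * by (auto simp: v_def w_def dest: in_set_takeD in_set_dropD)
    have "bd (tenS (symS m n) (idS p)) T l (v @ us @ w)"
      unfolding bd_ten bd_sym bd_id using * vw
      by (intro exI[of _ "us @ v"] exI[of _ w] exI[of _ "v @ us"]) auto
    moreover have "bd (tenS (idS n) (symS m p)) T (v @ us @ w) r"
      unfolding bd_ten bd_sym bd_id using * vw
      by (intro exI[of _ v] exI[of _ "us @ w"] exI[of _ "w @ us"]) auto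
    ultimately show ?R unfolding bd_seq by blast
  next
    assume ?R
    then obtain u v w v' u' w' where *: "l = (u @ v) @ w" "(v @ u) @ w = v' @ u' @ w'" "r = v' @ w' @ u'"
      "length u = m" "length v = n" "length w = p" "length v' = n" "length u' = m" "length w' = p"
      "set u \<subseteq> verts T" "set v \<subseteq> verts T" "set w \<subseteq> verts T"
      unfolding bd_seq bd_ten bd_sym bd_id by blast
    then have "v' = v" "u' = u" "w' = w" by auto
    then show ?L
      unfolding bd_sym using * by (intro exI[of _ u] exI[of _ "v @ w"]) auto
  qed
next
  show "ldet \<Sigma> (symS m (n + p)) \<and> ldet \<Sigma> (seqS (tenS (symS m n) (idS p)) (tenS (idS n) (symS m p))) \<or>
    rdet \<Sigma> (symS m (n + p)) \<and> rdet \<Sigma> (seqS (tenS (symS m n) (idS p)) (tenS (idS n) (symS m p)))"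
    using ldet_seq[OF ldet_ten[OF presheaf_sym] ldet_ten[OF presheaf_id]] det_id_sym by blast
qed

lemma Rep_sym_unit: "Rep \<Sigma> (symS m 0) = Rep \<Sigma> (idS m)"
proof (rule Rep_eqI_bd[OF presheaf_sym presheaf_id])
  fix T :: "(nat, nat, 'a) hypergraph" and l r :: "nat list"
  show "bd (symS m 0) T l r \<longleftrightarrow> bd (idS m) T l r"
    unfolding bd_sym bd_id by auto
qed (use det_id_sym in blast)

section \<open>Trace equations\<close>

lemma Rep_tightening:
  assumes S: "presheaf \<Sigma> m' m S1" "presheaf \<Sigma> (x + m) (x + n) S2" "presheaf \<Sigma> n n' S3"
  shows "Rep \<Sigma> (trS x (seqS (seqS (tenS (idS x) S1) S2) (tenS (idS x) S3))) =
    Rep \<Sigma> (seqS (seqS S1 (trS x S2)) S3)"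
proof (rule Rep_eqI[OF presheaf_tr[OF presheaf_seq[OF presheaf_seq[OF presheaf_ten[OF presheaf_id S(1)] S(2)]
          presheaf_ten[OF presheaf_id S(3)]]] presheaf_seq[OF presheaf_seq[OF S(1) presheaf_tr[OF S(2)]] S(3)],
      where R = "\<lambda>a b. \<exists>p q r. a = VTr x (VSeq (VSeq (VTen (idV (take x (lft q))) p) q) (VTen (idV (take x (rgt q))) r)) \<and>
        b = VSeq (VSeq p (VTr x q)) r"])
  fix T a assume T: "hyp \<Sigma> T" and "a \<in> trS x (seqS (seqS (tenS (idS x) S1) S2) (tenS (idS x) S3)) T"
  then obtain p q r us vs where a: "a = VTr x (VSeq (VSeq (VTen (idV us) p) q) (VTen (idV vs) r))"
    "p \<in> S1 T" "q \<in> S2 T" "r \<in> S3 T" "us @ rgt p = lft q" "rgt q = vs @ lft r"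
    "length us = x" "length vs = x" "take x (us @ lft p) = take x (vs @ rgt r)"
    unfolding trS_def seqS_def tenS_def idS_eq by fastforce
  then show "\<exists>b \<in> seqS (seqS S1 (trS x S2)) S3 T. \<exists>p q r.
      a = VTr x (VSeq (VSeq (VTen (idV (take x (lft q))) p) q) (VTen (idV (take x (rgt q))) r)) \<and>
      b = VSeq (VSeq p (VTr x q)) r"
    by (intro bexI[of _ "VSeq (VSeq p (VTr x q)) r"]) (auto simp: seqS_def trS_def simp flip: a(5))
next
  fix T b assume T: "hyp \<Sigma> T" and "b \<in> seqS (seqS S1 (trS x S2)) S3 T"
  then obtain p q r where b: "b = VSeq (VSeq p (VTr x q)) r" "p \<in> S1 T" "q \<in> S2 T" "r \<in> S3 T"
    "rgt p = drop x (lft q)" "drop x (rgt q) = lft r" "take x (lft q) = take x (rgt q)"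
    unfolding trS_def seqS_def by fastforce
  have l: "length (lft q) = x + m" "length (rgt q) = x + n" "set (lft q) \<subseteq> verts T" "set (rgt q) \<subseteq> verts T"
    using presheafD[OF S(2) T b(3)] by auto
  \<comment> \<open>The traced blocks complete the boundaries of \<open>q\<close>, so these are the
    values that the identity wires have to carry.\<close>
  have "take x (lft q) @ rgt p = lft q" "take x (rgt q) @ lft r = rgt q"
    using b(5) append_take_drop_id by (simp_all flip: b(6))
  then show "\<exists>a \<in> trS x (seqS (seqS (tenS (idS x) S1) S2) (tenS (idS x) S3)) T. \<exists>p q r.
      a = VTr x (VSeq (VSeq (VTen (idV (take x (lft q))) p) q) (VTen (idV (take x (rgt q))) r)) \<and>
      b = VSeq (VSeq p (VTr x q)) r"
    using b l
    by (intro bexI[of _ "VTr x (VSeq (VSeq (VTen (idV (take x (lft q))) p) q) (VTen (idV (take x (rgt q))) r))"])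
      (auto simp: seqS_def trS_def tenS_def idS_eq dest: in_set_takeD)
next
  fix T a b assume T: "hyp \<Sigma> T" and "b \<in> seqS (seqS S1 (trS x S2)) S3 T" and
    "\<exists>p q r. a = VTr x (VSeq (VSeq (VTen (idV (take x (lft q))) p) q) (VTen (idV (take x (rgt q))) r)) \<and>
      b = VSeq (VSeq p (VTr x q)) r"
  then obtain p q r where *: "a = VTr x (VSeq (VSeq (VTen (idV (take x (lft q))) p) q) (VTen (idV (take x (rgt q))) r))"
    "b = VSeq (VSeq p (VTr x q)) r" "q \<in> S2 T"
    by (auto simp: seqS_def trS_def)
  then show "lft a = lft b \<and> rgt a = rgt b"
    using presheafD(1,2)[OF S(2) T *(3)] by simp
qed (auto simp: take_map)

text \<open>Both sides consist of valuations \<open>q\<close> and \<open>s\<close> with the same two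
  constraints: \<open>rgt q\<close> begins with \<open>lft s\<close>, and \<open>lft q\<close>
  begins with \<open>rgt s\<close>. Sliding merely exchanges which of them is composability and
  which is the trace condition.\<close>

lemma Rep_sliding:
  assumes S: "presheaf \<Sigma> (x + m) (y + n) S1" "presheaf \<Sigma> y x S2"
  shows "Rep \<Sigma> (trS x (seqS S1 (tenS S2 (idS n)))) = Rep \<Sigma> (trS y (seqS (tenS S2 (idS m)) S1))"
proof (rule Rep_eqI[OF presheaf_tr[OF presheaf_seq[OF S(1) presheaf_ten[OF S(2) presheaf_id]]]
      presheaf_tr[OF presheaf_seq[OF presheaf_ten[OF S(2) presheaf_id] S(1)]],
      where R = "\<lambda>a b. \<exists>q s. a = VTr x (VSeq q (VTen s (idV (drop y (rgt q))))) \<and>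
        b = VTr y (VSeq (VTen s (idV (drop x (lft q)))) q)"])
  fix T a assume T: "hyp \<Sigma> T" and "a \<in> trS x (seqS S1 (tenS S2 (idS n))) T"
  then obtain q s us where a: "a = VTr x (VSeq q (VTen s (idV us)))"
    "q \<in> S1 T" "s \<in> S2 T" "rgt q = lft s @ us" "length us = n" "take x (lft q) = take x (rgt s @ us)"
    unfolding trS_def seqS_def tenS_def idS_eq by fastforce
  have l: "length (lft q) = x + m" "length (lft s) = y" "length (rgt s) = x" "set (lft q) \<subseteq> verts T"
    using presheafD[OF S(1) T a(2)] presheafD[OF S(2) T a(3)] by auto
  have "rgt s @ drop x (lft q) = lft q" using a(6) l append_take_drop_id[of x "lft q"] by simp
  then show "\<exists>b \<in> trS y (seqS (tenS S2 (idS m)) S1) T. \<exists>q s.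
      a = VTr x (VSeq q (VTen s (idV (drop y (rgt q))))) \<and> b = VTr y (VSeq (VTen s (idV (drop x (lft q)))) q)"
    using a l
    by (intro bexI[of _ "VTr y (VSeq (VTen s (idV (drop x (lft q)))) q)"])
      (auto simp: seqS_def trS_def tenS_def idS_eq dest: in_set_dropD)
next
  fix T b assume T: "hyp \<Sigma> T" and "b \<in> trS y (seqS (tenS S2 (idS m)) S1) T"
  then obtain q s vs where b: "b = VTr y (VSeq (VTen s (idV vs)) q)"
    "q \<in> S1 T" "s \<in> S2 T" "rgt s @ vs = lft q" "length vs = m" "take y (lft s @ vs) = take y (rgt q)"
    unfolding trS_def seqS_def tenS_def idS_eq by fastforce
  have l: "length (rgt q) = y + n" "length (lft s) = y" "length (rgt s) = x" "set (rgt q) \<subseteq> verts T"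
    using presheafD[OF S(1) T b(2)] presheafD[OF S(2) T b(3)] by auto
  have "lft s @ drop y (rgt q) = rgt q" using b(6) l append_take_drop_id[of y "rgt q"] by simp
  then show "\<exists>a \<in> trS x (seqS S1 (tenS S2 (idS n))) T. \<exists>q s.
      a = VTr x (VSeq q (VTen s (idV (drop y (rgt q))))) \<and> b = VTr y (VSeq (VTen s (idV (drop x (lft q)))) q)"
    using b l
    by (intro bexI[of _ "VTr x (VSeq q (VTen s (idV (drop y (rgt q)))))"])
      (auto simp: seqS_def trS_def tenS_def idS_eq simp flip: b(4) dest: in_set_dropD)
next
  fix T a b assume T: "hyp \<Sigma> T" and "b \<in> trS y (seqS (tenS S2 (idS m)) S1) T" and
    "\<exists>q s. a = VTr x (VSeq q (VTen s (idV (drop y (rgt q))))) \<and> b = VTr y (VSeq (VTen s (idV (drop x (lft q)))) q)"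
  then obtain q s where *: "a = VTr x (VSeq q (VTen s (idV (drop y (rgt q)))))"
    "b = VTr y (VSeq (VTen s (idV (drop x (lft q)))) q)" "s \<in> S2 T"
    by (auto simp: seqS_def trS_def tenS_def)
  then show "lft a = lft b \<and> rgt a = rgt b"
    using presheafD(1,2)[OF S(2) T *(3)] by simp
qed (auto simp: drop_map)

lemma Rep_vanishing_unit:
  assumes S: "presheaf \<Sigma> m n S"
  shows "Rep \<Sigma> (trS 0 S) = Rep \<Sigma> S"
  by (rule Rep_eqI[where R = "\<lambda>a b. a = VTr 0 b" and m = m and n = n, OF presheaf_tr S])
    (use S in \<open>auto simp: trS_def\<close>)

lemma Rep_vanishing_sum:
  assumes S: "presheaf \<Sigma> (x + y + m) (x + y + n) S"
  shows "Rep \<Sigma> (trS (x + y) S) = Rep \<Sigma> (trS y (trS x S))"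
proof (rule Rep_eqI[OF presheaf_tr[OF S] presheaf_tr[OF presheaf_tr[OF S[unfolded add.assoc]]],
      where R = "\<lambda>a b. \<exists>q. a = VTr (x + y) q \<and> b = VTr y (VTr x q)"])
  \<comment> \<open>The feedback equation on \<open>x + y\<close> wires splits into the inner and
    the outer one; the length bounds make the cut unambiguous.\<close>
  have "take (x + y) u = take (x + y) v \<longleftrightarrow> take x u = take x v \<and> take y (drop x u) = take y (drop x v)"
    if "length u \<ge> x" "length v \<ge> x" for u v :: "nat list"
    using that by (simp add: take_add)
  moreover have "length (lft q) \<ge> x" "length (rgt q) \<ge> x" if "hyp \<Sigma> T" "q \<in> S T" for q T
    using presheafD(1,2)[OF S that] by auto
  ultimately have *: "take (x + y) (lft q) = take (x + y) (rgt q) \<longleftrightarrow>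
      take x (lft q) = take x (rgt q) \<and> take y (drop x (lft q)) = take y (drop x (rgt q))"
    if "hyp \<Sigma> T" "q \<in> S T" for q T
    using that by meson
  show "\<exists>b \<in> trS y (trS x S) T. \<exists>q. a = VTr (x + y) q \<and> b = VTr y (VTr x q)"
    if "hyp \<Sigma> T" "a \<in> trS (x + y) S T" for T a
    using that * by (fastforce simp: trS_def)
  show "\<exists>a \<in> trS (x + y) S T. \<exists>q. a = VTr (x + y) q \<and> b = VTr y (VTr x q)"
    if "hyp \<Sigma> T" "b \<in> trS y (trS x S) T" for T b
    using that * by (fastforce simp: trS_def)
qed (auto simp: add.commute)

lemma Rep_superposing:
  assumes S: "presheaf \<Sigma> (x + m) (x + n) S1" "presheaf \<Sigma> p q S2"
  shows "Rep \<Sigma> (trS x (tenS S1 S2)) = Rep \<Sigma> (tenS (trS x S1) S2)"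
proof (rule Rep_eqI[OF presheaf_tr[OF presheaf_ten[OF S, unfolded add.assoc]] presheaf_ten[OF presheaf_tr[OF S(1)] S(2)],
      where R = "\<lambda>a b. \<exists>u v. a = VTr x (VTen u v) \<and> b = VTen (VTr x u) v"])
  have *: "length (lft u) \<ge> x" "length (rgt u) \<ge> x" if "hyp \<Sigma> T" "u \<in> S1 T" for u T
    using presheafD(1,2)[OF S(1) that] by auto
  show "\<exists>b \<in> tenS (trS x S1) S2 T. \<exists>u v. a = VTr x (VTen u v) \<and> b = VTen (VTr x u) v"
    if "hyp \<Sigma> T" "a \<in> trS x (tenS S1 S2) T" for T a
    using that * by (fastforce simp: trS_def tenS_def)
  show "\<exists>a \<in> trS x (tenS S1 S2) T. \<exists>u v. a = VTr x (VTen u v) \<and> b = VTen (VTr x u) v"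
    if "hyp \<Sigma> T" "b \<in> tenS (trS x S1) S2 T" for T b
    using that * by (fastforce simp: trS_def tenS_def)
  show "lft a = lft b \<and> rgt a = rgt b" if "hyp \<Sigma> T" "b \<in> tenS (trS x S1) S2 T"
    "\<exists>u v. a = VTr x (VTen u v) \<and> b = VTen (VTr x u) v" for T a b
    using that * by (fastforce simp: trS_def tenS_def)
qed auto

text \<open>The symmetry has boundaries \<open>us @ vs\<close> and \<open>vs @ us\<close>, so the
  feedback equation is \<open>us = vs\<close>.\<close>

lemma Rep_yanking: "Rep \<Sigma> (trS x (symS x x)) = Rep \<Sigma> (idS x)"
proof (rule Rep_eqI[OF presheaf_tr[OF presheaf_sym] presheaf_id,
      where R = "\<lambda>a b. \<exists>us. a = VTr x (symV us us) \<and> b = idV us \<and> length us = x"])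
  fix T :: "(nat, nat, 'a) hypergraph" and a assume "a \<in> trS x (symS x x) T"
  then obtain c where c: "a = VTr x c" "c \<in> symS x x T" "take x (lft c) = take x (rgt c)"
    unfolding trS_def by blast
  obtain us vs where us: "c = symV us vs" "length us = x" "length vs = x" "set us \<subseteq> verts T"
    using c(2) by (elim symS_E)
  then have "us = vs" using c(3) by simp
  then show "\<exists>b \<in> idS x T. \<exists>us. a = VTr x (symV us us) \<and> b = idV us \<and> length us = x"
    using us c(1) by (intro bexI[of _ "idV us"] exI[of _ us]) (simp_all add: idV_in)
next
  fix T :: "(nat, nat, 'a) hypergraph" and b assume "b \<in> idS x T"
  then obtain us where "b = idV us" "length us = x" "set us \<subseteq> verts T" unfolding idS_eq by blast
  then show "\<exists>a \<in> trS x (symS x x) T. \<exists>us. a = VTr x (symV us us) \<and> b = idV us \<and> length us = x"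
    by (intro bexI[of _ "VTr x (symV us us)"] exI[of _ us] valuation_in(3)[THEN iffD2] conjI symV_in) simp_all
next
  fix T :: "(nat, nat, 'a) hypergraph" and a a' b b'
  assume "\<exists>us. a = VTr x (symV us us) \<and> b = idV us \<and> length us = x"
    "\<exists>us. a' = VTr x (symV us us) \<and> b' = idV us \<and> length us = x"
  then obtain us us' where "a = VTr x (symV us us)" "b = idV us" "a' = VTr x (symV us' us')" "b' = idV us'"
    "length us = x" "length us' = x" by blast
  then show "a = a' \<longleftrightarrow> b = b'" by simp
next
  fix T a b and h :: "(nat, nat, nat, nat) hmap"
  assume "\<exists>us. a = VTr x (symV us us) \<and> b = idV us \<and> length us = x"
  then obtain us where "a = VTr x (symV us us)" "b = idV us" "length us = x" by blast
  then show "\<exists>us. act h a = VTr x (symV us us) \<and> act h b = idV us \<and> length us = x"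
    by (intro exI[of _ "map (fst h) us"]) simp
next
  fix T a b
  assume "\<exists>us. a = VTr x (symV us us) \<and> b = idV us \<and> length us = x"
  then obtain us where "a = VTr x (symV us us)" "b = idV us" "length us = x" by blast
  then show "lft a = lft b \<and> rgt a = rgt b" by simp
qed


section \<open>Frobenius structure\<close>

abbreviation mergeS :: "'g presheaf" where "mergeS \<equiv> discS 1 [0, 0] [0]"
abbreviation unitS :: "'g presheaf" where "unitS \<equiv> discS 1 [] [0]"
abbreviation copyS :: "'g presheaf" where "copyS \<equiv> discS 1 [0] [0, 0]"
abbreviation counitS :: "'g presheaf" where "counitS \<equiv> discS 1 [0] []"

section \<open>The Frobenius generators and their boundary relations\<close>

lemma presheaf_frob:
  "presheaf \<Sigma> 2 1 mergeS" "presheaf \<Sigma> 0 1 unitS" "presheaf \<Sigma> 1 2 copyS" "presheaf \<Sigma> 1 0 counitS"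
  by (rule presheaf_disc; simp)+

lemma det_frob:
  "ldet \<Sigma> mergeS" "ldet \<Sigma> copyS" "ldet \<Sigma> counitS" "rdet \<Sigma> mergeS" "rdet \<Sigma> copyS" "rdet \<Sigma> unitS"
  by (auto intro!: ldet_disc rdet_disc)

lemma bd_id1: "bd (idS 1) T l r \<longleftrightarrow> (\<exists>v \<in> verts T. l = [v] \<and> r = [v])"
  unfolding bd_id by (auto simp: length_Suc_conv)

lemma bd_sym11: "bd (symS 1 1) T l r \<longleftrightarrow> (\<exists>u \<in> verts T. \<exists>v \<in> verts T. l = [u, v] \<and> r = [v, u])"
proof
  assume "bd (symS 1 1) T l r"
  then obtain us vs where *: "l = us @ vs" "r = vs @ us" "length us = 1" "length vs = 1"
    "set us \<subseteq> verts T" "set vs \<subseteq> verts T" unfolding bd_sym by blast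
  then obtain u v where "us = [u]" "vs = [v]" by (auto simp: length_Suc_conv)
  then show "\<exists>u \<in> verts T. \<exists>v \<in> verts T. l = [u, v] \<and> r = [v, u]" using * by simp
next
  assume "\<exists>u \<in> verts T. \<exists>v \<in> verts T. l = [u, v] \<and> r = [v, u]"
  then obtain u v where "u \<in> verts T" "v \<in> verts T" "l = [u, v]" "r = [v, u]" by blast
  then show "bd (symS 1 1) T l r" unfolding bd_sym by (intro exI[of _ "[u]"] exI[of _ "[v]"]) simp
qed

lemma bd_ten_left:
  assumes "\<And>l r. bd S1 T l r \<longleftrightarrow> (\<exists>u \<in> verts T. l = f u \<and> r = g u)"
  shows "bd (tenS S1 S2) T l r \<longleftrightarrow>
    (\<exists>u \<in> verts T. \<exists>l2 r2. l = f u @ l2 \<and> r = g u @ r2 \<and> bd S2 T l2 r2)"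
  unfolding bd_ten assms by blast

text \<open>The form that \<open>bd_id\<close> takes once simplification has evaluated the empty
  interval.\<close>

lemma bd_id0: "bd (discS 0 [] []) T l r \<longleftrightarrow> l = [] \<and> r = []"
  using bd_id[of 0 T l r] by auto

lemma det_id0: "ldet \<Sigma> (discS 0 [] [])" "rdet \<Sigma> (discS 0 [] [])"
  by (auto intro: ldet_disc rdet_disc)

lemma bd_ten_pair:
  assumes "\<And>l r. bd S1 T l r \<longleftrightarrow> (\<exists>u \<in> verts T. l = f u \<and> r = g u)"
    and "\<And>l r. bd S2 T l r \<longleftrightarrow> (\<exists>v \<in> verts T. l = h v \<and> r = k v)"
  shows "bd (tenS S1 S2) T l r \<longleftrightarrow> (\<exists>u \<in> verts T. \<exists>v \<in> verts T. l = f u @ h v \<and> r = g u @ k v)"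
  unfolding bd_ten assms by blast

lemma bd_wires2:
  "bd (tenS mergeS (idS 1)) T l r \<longleftrightarrow> (\<exists>u \<in> verts T. \<exists>v \<in> verts T. l = [u, u, v] \<and> r = [u, v])"
  "bd (tenS (idS 1) mergeS) T l r \<longleftrightarrow> (\<exists>u \<in> verts T. \<exists>v \<in> verts T. l = [u, v, v] \<and> r = [u, v])"
  "bd (tenS unitS (idS 1)) T l r \<longleftrightarrow> (\<exists>u \<in> verts T. \<exists>v \<in> verts T. l = [v] \<and> r = [u, v])"
  "bd (tenS copyS (idS 1)) T l r \<longleftrightarrow> (\<exists>u \<in> verts T. \<exists>v \<in> verts T. l = [u, v] \<and> r = [u, u, v])"
  "bd (tenS (idS 1) copyS) T l r \<longleftrightarrow> (\<exists>u \<in> verts T. \<exists>v \<in> verts T. l = [u, v] \<and> r = [u, v, v])"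
  "bd (tenS counitS (idS 1)) T l r \<longleftrightarrow> (\<exists>u \<in> verts T. \<exists>v \<in> verts T. l = [u, v] \<and> r = [v])"
  by (simp_all only: bd_ten_pair[OF bd_frob(1) bd_id1] bd_ten_pair[OF bd_id1 bd_frob(1)]
      bd_ten_pair[OF bd_frob(2) bd_id1] bd_ten_pair[OF bd_frob(3) bd_id1]
      bd_ten_pair[OF bd_id1 bd_frob(3)] bd_ten_pair[OF bd_frob(4) bd_id1] append.simps)

text \<open>Every side is a connected diagram, so it relates exactly the constant lists of the right
  lengths with a common value. The relation depends on arity and coarity alone.\<close>

lemma bd_frob_eqs:
  "bd (seqS (tenS mergeS (idS 1)) mergeS) T l r \<longleftrightarrow> bd (seqS (tenS (idS 1) mergeS) mergeS) T l r"
  "bd (seqS (tenS unitS (idS 1)) mergeS) T l r \<longleftrightarrow> bd (idS 1) T l r"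
  "bd (seqS (symS 1 1) mergeS) T l r \<longleftrightarrow> bd mergeS T l r"
  "bd (seqS copyS (tenS copyS (idS 1))) T l r \<longleftrightarrow> bd (seqS copyS (tenS (idS 1) copyS)) T l r"
  "bd (seqS copyS (tenS counitS (idS 1))) T l r \<longleftrightarrow> bd (idS 1) T l r"
  "bd (seqS copyS (symS 1 1)) T l r \<longleftrightarrow> bd copyS T l r"
  "bd (seqS (tenS copyS (idS 1)) (tenS (idS 1) mergeS)) T l r \<longleftrightarrow> bd (seqS mergeS copyS) T l r"
  "bd (seqS (tenS (idS 1) copyS) (tenS mergeS (idS 1))) T l r \<longleftrightarrow> bd (seqS mergeS copyS) T l r"
  "bd (seqS copyS mergeS) T l r \<longleftrightarrow> bd (idS 1) T l r"
  unfolding bd_seq bd_wires2 unfolding bd_frob bd_id1 bd_sym11 by auto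

lemmas det_intros = ldet_seq rdet_seq det_id_sym det_frob
  presheaf_frob[THEN ldet_ten] presheaf_frob[THEN rdet_ten] ldet_ten[OF presheaf_id] rdet_ten[OF presheaf_id]
  ldet_ten[OF presheaf_sym] rdet_ten[OF presheaf_sym]


section \<open>Interpretation of terms\<close>

primrec fdom :: "'g signature \<Rightarrow> 'g fterm \<Rightarrow> nat" where
  "fdom \<Sigma> (FGen \<phi>) = ar \<Sigma> \<phi>"
| "fdom \<Sigma> Merge = 2"
| "fdom \<Sigma> Unit = 0"
| "fdom \<Sigma> Copy = 1"
| "fdom \<Sigma> Counit = 1"
| "fdom \<Sigma> (FId n) = n"
| "fdom \<Sigma> (FSym m n) = m + n"
| "fdom \<Sigma> (s ;\<^sub>f t) = fdom \<Sigma> s"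
| "fdom \<Sigma> (s \<otimes>\<^sub>f t) = fdom \<Sigma> s + fdom \<Sigma> t"

primrec fcod :: "'g signature \<Rightarrow> 'g fterm \<Rightarrow> nat" where
  "fcod \<Sigma> (FGen \<phi>) = coar \<Sigma> \<phi>"
| "fcod \<Sigma> Merge = 1"
| "fcod \<Sigma> Unit = 1"
| "fcod \<Sigma> Copy = 2"
| "fcod \<Sigma> Counit = 0"
| "fcod \<Sigma> (FId n) = n"
| "fcod \<Sigma> (FSym m n) = n + m"
| "fcod \<Sigma> (s ;\<^sub>f t) = fcod \<Sigma> t"
| "fcod \<Sigma> (s \<otimes>\<^sub>f t) = fcod \<Sigma> s + fcod \<Sigma> t"

primrec fwf :: "'g signature \<Rightarrow> 'g fterm \<Rightarrow> bool" where
  "fwf \<Sigma> (FGen \<phi>) \<longleftrightarrow> \<phi> \<in> gens \<Sigma>"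
| "fwf \<Sigma> Merge \<longleftrightarrow> True"
| "fwf \<Sigma> Unit \<longleftrightarrow> True"
| "fwf \<Sigma> Copy \<longleftrightarrow> True"
| "fwf \<Sigma> Counit \<longleftrightarrow> True"
| "fwf \<Sigma> (FId n) \<longleftrightarrow> True"
| "fwf \<Sigma> (FSym m n) \<longleftrightarrow> True"
| "fwf \<Sigma> (s ;\<^sub>f t) \<longleftrightarrow> fwf \<Sigma> s \<and> fwf \<Sigma> t \<and> fcod \<Sigma> s = fdom \<Sigma> t"
| "fwf \<Sigma> (s \<otimes>\<^sub>f t) \<longleftrightarrow> fwf \<Sigma> s \<and> fwf \<Sigma> t"

text \<open>The typing rules carry sums in their indices, which obstructs inversion; computing
  arities from the term leaves conditions that simplification can settle.\<close>

lemma fwf_typed: "fwf \<Sigma> u \<Longrightarrow> f_typed \<Sigma> (fdom \<Sigma> u) (fcod \<Sigma> u) u"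
  by (induction u) (auto intro: f_typed.intros simp del: One_nat_def)

lemma f_typed_iff: "f_typed \<Sigma> m n u \<longleftrightarrow> fwf \<Sigma> u \<and> fdom \<Sigma> u = m \<and> fcod \<Sigma> u = n"
proof
  show "fwf \<Sigma> u \<and> fdom \<Sigma> u = m \<and> fcod \<Sigma> u = n" if "f_typed \<Sigma> m n u"
    using that by (induction rule: f_typed.induct) auto
qed (auto dest: fwf_typed)

primrec tdom :: "'g signature \<Rightarrow> 'g tterm \<Rightarrow> nat" where
  "tdom \<Sigma> (TGen \<phi>) = ar \<Sigma> \<phi>"
| "tdom \<Sigma> (TId n) = n"
| "tdom \<Sigma> (TSym m n) = m + n"
| "tdom \<Sigma> (s ;\<^sub>t t) = tdom \<Sigma> s"
| "tdom \<Sigma> (s \<otimes>\<^sub>t t) = tdom \<Sigma> s + tdom \<Sigma> t"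
| "tdom \<Sigma> (TTr x m n t) = m"

primrec tcod :: "'g signature \<Rightarrow> 'g tterm \<Rightarrow> nat" where
  "tcod \<Sigma> (TGen \<phi>) = coar \<Sigma> \<phi>"
| "tcod \<Sigma> (TId n) = n"
| "tcod \<Sigma> (TSym m n) = n + m"
| "tcod \<Sigma> (s ;\<^sub>t t) = tcod \<Sigma> t"
| "tcod \<Sigma> (s \<otimes>\<^sub>t t) = tcod \<Sigma> s + tcod \<Sigma> t"
| "tcod \<Sigma> (TTr x m n t) = n"

primrec twf :: "'g signature \<Rightarrow> 'g tterm \<Rightarrow> bool" where
  "twf \<Sigma> (TGen \<phi>) \<longleftrightarrow> \<phi> \<in> gens \<Sigma>"
| "twf \<Sigma> (TId n) \<longleftrightarrow> True"
| "twf \<Sigma> (TSym m n) \<longleftrightarrow> True"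
| "twf \<Sigma> (s ;\<^sub>t t) \<longleftrightarrow> twf \<Sigma> s \<and> twf \<Sigma> t \<and> tcod \<Sigma> s = tdom \<Sigma> t"
| "twf \<Sigma> (s \<otimes>\<^sub>t t) \<longleftrightarrow> twf \<Sigma> s \<and> twf \<Sigma> t"
| "twf \<Sigma> (TTr x m n t) \<longleftrightarrow> twf \<Sigma> t \<and> tdom \<Sigma> t = x + m \<and> tcod \<Sigma> t = x + n"

lemma twf_typed: "twf \<Sigma> u \<Longrightarrow> t_typed \<Sigma> (tdom \<Sigma> u) (tcod \<Sigma> u) u"
  by (induction u) (auto intro: t_typed.intros)

lemma t_typed_iff: "t_typed \<Sigma> m n u \<longleftrightarrow> twf \<Sigma> u \<and> tdom \<Sigma> u = m \<and> tcod \<Sigma> u = n"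
proof
  show "twf \<Sigma> u \<and> tdom \<Sigma> u = m \<and> tcod \<Sigma> u = n" if "t_typed \<Sigma> m n u"
    using that by (induction rule: t_typed.induct) auto
qed (auto dest: twf_typed)

section \<open>Semantics of terms in presheaves\<close>

primrec sem_f :: "'g fterm \<Rightarrow> 'g presheaf" where
  "sem_f (FGen \<phi>) = genS \<phi>"
| "sem_f Merge = mergeS"
| "sem_f Unit = unitS"
| "sem_f Copy = copyS"
| "sem_f Counit = counitS"
| "sem_f (FId n) = idS n"
| "sem_f (FSym m n) = symS m n"
| "sem_f (s ;\<^sub>f t) = seqS (sem_f s) (sem_f t)"
| "sem_f (s \<otimes>\<^sub>f t) = tenS (sem_f s) (sem_f t)"

primrec sem_t :: "'g tterm \<Rightarrow> 'g presheaf" where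
  "sem_t (TGen \<phi>) = genS \<phi>"
| "sem_t (TId n) = idS n"
| "sem_t (TSym m n) = symS m n"
| "sem_t (s ;\<^sub>t t) = seqS (sem_t s) (sem_t t)"
| "sem_t (s \<otimes>\<^sub>t t) = tenS (sem_t s) (sem_t t)"
| "sem_t (TTr x m n t) = trS x (sem_t t)"

text \<open>Nonemptiness belongs to the invariant because \<open>csp_comp_Rep\<close> and
  \<open>csp_tensor_Rep\<close> assume it of both factors.\<close>

definition denotes :: "'g signature \<Rightarrow> nat \<Rightarrow> nat \<Rightarrow> 'g csp \<Rightarrow> 'g presheaf \<Rightarrow> bool" where
  "denotes \<Sigma> m n A S \<longleftrightarrow> presheaf \<Sigma> m n S \<and> A = Rep \<Sigma> S \<and> A \<noteq> {}"

lemma denotes_seq: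
  assumes "denotes \<Sigma> m n A S1" "denotes \<Sigma> n p B S2"
  shows "denotes \<Sigma> m p (csp_comp \<Sigma> A B) (seqS S1 S2)"
proof -
  have S: "presheaf \<Sigma> m n S1" "presheaf \<Sigma> n p S2" and ne: "Rep \<Sigma> S1 \<noteq> {}" "Rep \<Sigma> S2 \<noteq> {}"
    and AB: "A = Rep \<Sigma> S1" "B = Rep \<Sigma> S2"
    using assms by (auto simp: denotes_def)
  from ne obtain C D where "C \<in> Rep \<Sigma> S1" "D \<in> Rep \<Sigma> S2" by blast
  then show ?thesis
    unfolding denotes_def AB csp_comp_Rep[OF S ne] using Rep_seq_ex[OF S] presheaf_seq[OF S] by blast
qed

lemma denotes_ten:
  assumes "denotes \<Sigma> m n A S1" "denotes \<Sigma> p q B S2"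
  shows "denotes \<Sigma> (m + p) (n + q) (csp_tensor A B) (tenS S1 S2)"
proof -
  have S: "presheaf \<Sigma> m n S1" "presheaf \<Sigma> p q S2" and ne: "Rep \<Sigma> S1 \<noteq> {}" "Rep \<Sigma> S2 \<noteq> {}"
    and AB: "A = Rep \<Sigma> S1" "B = Rep \<Sigma> S2"
    using assms by (auto simp: denotes_def)
  from ne obtain C D where "C \<in> Rep \<Sigma> S1" "D \<in> Rep \<Sigma> S2" by blast
  then show ?thesis
    unfolding denotes_def AB csp_tensor_Rep[OF S ne] using Rep_ten_ex[OF S] presheaf_ten[OF S] by blast
qed

lemma cospan_iso_refl: "cospan_iso C C"
  unfolding cospan_iso_def by (intro exI[of _ hmap_id]) (simp add: hyp_mor_id)

lemma csp_class_self: "C \<in> csp_class C"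
  by (simp add: csp_class_def cospan_iso_refl)

lemma denotes_gen:
  assumes "\<phi> \<in> gens \<Sigma>"
  shows "denotes \<Sigma> (ar \<Sigma> \<phi>) (coar \<Sigma> \<phi>) (gen_csp \<Sigma> \<phi>) (genS \<phi>)"
  unfolding denotes_def Rep_gen[OF assms] using presheaf_gen csp_class_self
  by (auto simp: gen_csp_def Let_def)

lemma denotes_disc:
  assumes "set f \<subseteq> {..<k}" "set g \<subseteq> {..<k}" "m = length f" "n = length g"
  shows "denotes \<Sigma> m n (disc_csp k f g) (discS k f g)"
  unfolding denotes_def Rep_disc[OF assms(1,2)] using presheaf_disc[OF assms] csp_class_self
  by (auto simp: disc_csp_def)

lemma denotes_id: "denotes \<Sigma> n n (disc_csp n [0..<n] [0..<n]) (idS n)"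
  by (rule denotes_disc) auto

lemma denotes_sym:
  "denotes \<Sigma> (m + n) (n + m) (disc_csp (m + n) [0..<m + n] ([m..<m + n] @ [0..<m])) (symS m n)"
  by (rule denotes_disc) auto

lemma denotes_f: "f_typed \<Sigma> m n u \<Longrightarrow> denotes \<Sigma> m n (interp_term \<Sigma> u) (sem_f u)"
proof (induction rule: f_typed.induct)
  case (7 m n)
  then show ?case using denotes_sym by simp
qed (use denotes_gen denotes_id denotes_seq denotes_ten in \<open>auto intro: denotes_disc\<close>)

lemma presheaf_f: "f_typed \<Sigma> m n u \<Longrightarrow> presheaf \<Sigma> m n (sem_f u)"
  using denotes_f by (auto simp: denotes_def)

lemma interp_f: "fwf \<Sigma> u \<Longrightarrow> interp_term \<Sigma> u = Rep \<Sigma> (sem_f u)"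
  using denotes_f[OF fwf_typed] by (auto simp: denotes_def)

text \<open>Serves the Frobenius equations: their sides contain no unknown term, so one boundary
  determines the valuation.\<close>

lemma f_eq_bdI:
  assumes "fwf \<Sigma> s" "fwf \<Sigma> t"
    and "ldet \<Sigma> (sem_f s) \<and> ldet \<Sigma> (sem_f t) \<or> rdet \<Sigma> (sem_f s) \<and> rdet \<Sigma> (sem_f t)"
    and "\<And>T l r. bd (sem_f s) T l r \<longleftrightarrow> bd (sem_f t) T l r"
  shows "interp_term \<Sigma> s = interp_term \<Sigma> t"
  unfolding interp_f[OF assms(1)] interp_f[OF assms(2)]
  by (rule Rep_eqI_bd[OF presheaf_f[OF fwf_typed[OF assms(1)]] presheaf_f[OF fwf_typed[OF assms(2)]]])
    (use assms in auto)

lemma f_eq_sound: "f_eq \<Sigma> m n s t \<Longrightarrow> interp_term \<Sigma> s = interp_term \<Sigma> t"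
proof (induction rule: f_eq.induct)
  case (f_seq_assoc m n s p t q u)
  then have "fwf \<Sigma> ((s ;\<^sub>f t) ;\<^sub>f u)" "fwf \<Sigma> (s ;\<^sub>f (t ;\<^sub>f u))" by (auto simp: f_typed_iff)
  then show ?case using Rep_seq_assoc[OF f_seq_assoc[THEN presheaf_f]] by (simp only: interp_f sem_f.simps)
next
  case (f_id_left m n t)
  then have "fwf \<Sigma> (FId m ;\<^sub>f t)" "fwf \<Sigma> t" by (auto simp: f_typed_iff)
  then show ?case using Rep_id_left[OF f_id_left[THEN presheaf_f]] by (simp only: interp_f sem_f.simps)
next
  case (f_id_right m n t)
  then have "fwf \<Sigma> (t ;\<^sub>f FId n)" "fwf \<Sigma> t" by (auto simp: f_typed_iff)
  then show ?case using Rep_id_right[OF f_id_right[THEN presheaf_f]] by (simp only: interp_f sem_f.simps)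
next
  case (f_ten_assoc m n s m' n' t m'' n'' u)
  then have "fwf \<Sigma> ((s \<otimes>\<^sub>f t) \<otimes>\<^sub>f u)" "fwf \<Sigma> (s \<otimes>\<^sub>f (t \<otimes>\<^sub>f u))" by (auto simp: f_typed_iff)
  then show ?case using Rep_ten_assoc[OF f_ten_assoc[THEN presheaf_f]] by (simp only: interp_f sem_f.simps)
next
  case (f_ten_unit_left m n t)
  then have "fwf \<Sigma> (FId 0 \<otimes>\<^sub>f t)" "fwf \<Sigma> t" by (auto simp: f_typed_iff)
  then show ?case using Rep_ten_unit_left[OF f_ten_unit_left[THEN presheaf_f]] by (simp only: interp_f sem_f.simps)
next
  case (f_ten_unit_right m n t)
  then have "fwf \<Sigma> (t \<otimes>\<^sub>f FId 0)" "fwf \<Sigma> t" by (auto simp: f_typed_iff)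
  then show ?case using Rep_ten_unit_right[OF f_ten_unit_right[THEN presheaf_f]] by (simp only: interp_f sem_f.simps)
next
  case (f_ten_id m n)
  have "fwf \<Sigma> (FId m \<otimes>\<^sub>f FId n)" "fwf \<Sigma> (FId (m + n))" by auto
  then show ?case using Rep_ten_id by (simp only: interp_f sem_f.simps)
next
  case (f_interchange m n s p t m' n' s' p' t')
  then have "fwf \<Sigma> ((s ;\<^sub>f t) \<otimes>\<^sub>f (s' ;\<^sub>f t'))" "fwf \<Sigma> ((s \<otimes>\<^sub>f s') ;\<^sub>f (t \<otimes>\<^sub>f t'))" by (auto simp: f_typed_iff)
  then show ?case using Rep_interchange[OF f_interchange[THEN presheaf_f]] by (simp only: interp_f sem_f.simps)
next
  case (f_sym_nat m n s p q t)
  then have "fwf \<Sigma> ((s \<otimes>\<^sub>f t) ;\<^sub>f FSym n q)" "fwf \<Sigma> (FSym m p ;\<^sub>f (t \<otimes>\<^sub>f s))" by (auto simp: f_typed_iff)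
  then show ?case using Rep_sym_nat[OF f_sym_nat[THEN presheaf_f]] by (simp only: interp_f sem_f.simps)
next
  case (f_sym_inv m n)
  have "fwf \<Sigma> (FSym m n ;\<^sub>f FSym n m)" "fwf \<Sigma> (FId (m + n))" by auto
  then show ?case using Rep_sym_inv by (simp only: interp_f sem_f.simps)
next
  case (f_sym_hex m n p)
  have "fwf \<Sigma> (FSym m (n + p))" "fwf \<Sigma> ((FSym m n \<otimes>\<^sub>f FId p) ;\<^sub>f (FId n \<otimes>\<^sub>f FSym m p))" by auto
  then show ?case using Rep_sym_hex by (simp only: interp_f sem_f.simps)
next
  case (f_sym_unit m)
  have "fwf \<Sigma> (FSym m 0)" "fwf \<Sigma> (FId m)" by auto
  then show ?case using Rep_sym_unit by (simp only: interp_f sem_f.simps)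
next
  case f_merge_assoc
  show ?case by (rule f_eq_bdI) (simp_all only: sem_f.simps bd_frob_eqs, simp_all add: det_intros del: One_nat_def)
next
  case f_merge_unit
  show ?case by (rule f_eq_bdI) (simp_all only: sem_f.simps bd_frob_eqs, simp_all add: det_intros del: One_nat_def)
next
  case f_merge_comm
  have "ldet \<Sigma> (seqS (symS 1 1) (mergeS))" "ldet \<Sigma> mergeS" by (intro det_intros)+
  then show ?case
    by (intro f_eq_bdI disjI1 conjI; (simp only: sem_f.simps bd_frob_eqs; fail)?) simp_all
next
  case f_copy_assoc
  show ?case by (rule f_eq_bdI) (simp_all only: sem_f.simps bd_frob_eqs, simp_all add: det_intros del: One_nat_def)
next
  case f_copy_counit
  show ?case by (rule f_eq_bdI) (simp_all only: sem_f.simps bd_frob_eqs, simp_all add: det_intros del: One_nat_def)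
next
  case f_copy_comm
  have "ldet \<Sigma> (seqS (copyS) (symS 1 1))" "ldet \<Sigma> copyS" by (intro det_intros)+
  then show ?case
    by (intro f_eq_bdI disjI1 conjI; (simp only: sem_f.simps bd_frob_eqs; fail)?) simp_all
next
  case f_frob_left
  show ?case by (rule f_eq_bdI) (simp_all only: sem_f.simps bd_frob_eqs, simp_all add: det_intros del: One_nat_def)
next
  case f_frob_right
  show ?case by (rule f_eq_bdI) (simp_all only: sem_f.simps bd_frob_eqs, simp_all add: det_intros del: One_nat_def)
next
  case f_special
  show ?case by (rule f_eq_bdI) (simp_all only: sem_f.simps bd_frob_eqs, simp_all add: det_intros del: One_nat_def)
qed simp_all


section \<open>The canonical trace\<close>

lemma fdom_fcod_frob [simp]:
  "fdom \<Sigma> (merge n) = n + n" "fcod \<Sigma> (merge n) = n" "fdom \<Sigma> (copy n) = n" "fcod \<Sigma> (copy n) = n + n"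
  "fdom \<Sigma> (unit n) = 0" "fcod \<Sigma> (unit n) = n" "fdom \<Sigma> (counit n) = n" "fcod \<Sigma> (counit n) = 0"
  by (induction n; simp)+

lemma fwf_frob [simp]: "fwf \<Sigma> (merge n)" "fwf \<Sigma> (copy n)" "fwf \<Sigma> (unit n)" "fwf \<Sigma> (counit n)"
  by (induction n; simp)+

lemma bd_unit: "bd (sem_f (unit n)) T l r \<longleftrightarrow> l = [] \<and> length r = n \<and> set r \<subseteq> verts T"
proof (induction n arbitrary: l r)
  case 0
  show ?case by (auto simp: bd_id0)
next
  case (Suc n)
  show ?case
    unfolding unit.simps sem_f.simps bd_ten_left[OF bd_frob(2)] Suc by (cases r) auto
qed

lemma bd_counit: "bd (sem_f (counit n)) T l r \<longleftrightarrow> r = [] \<and> length l = n \<and> set l \<subseteq> verts T"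
proof (induction n arbitrary: l r)
  case 0
  show ?case by (auto simp: bd_id0)
next
  case (Suc n)
  show ?case
    unfolding counit.simps sem_f.simps bd_ten_left[OF bd_frob(4)] Suc by (cases l) auto
qed

text \<open>The interleaving layer of \<open>merge\<close> and \<open>copy\<close>, which use it
  with the lengths of the two middle blocks exchanged.\<close>

lemma bd_shuffle: "bd (tenS (tenS (idS 1) (symS m n)) (idS p)) T l r \<longleftrightarrow>
  (\<exists>u us vs ws. l = u # us @ vs @ ws \<and> r = u # vs @ us @ ws \<and> length us = m \<and> length vs = n \<and>
    length ws = p \<and> {u} \<union> set us \<union> set vs \<union> set ws \<subseteq> verts T)" (is "?L \<longleftrightarrow> ?R")
proof
  assume ?L
  then obtain u us vs ws where "l = ([u] @ (us @ vs)) @ ws" "r = ([u] @ (vs @ us)) @ ws" "length us = m"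
    "length vs = n" "length ws = p" "u \<in> verts T" "set us \<subseteq> verts T" "set vs \<subseteq> verts T" "set ws \<subseteq> verts T"
    unfolding bd_ten bd_id1 bd_sym unfolding bd_id by blast
  then show ?R by (intro exI[of _ u] exI[of _ us] exI[of _ vs] exI[of _ ws]) simp
next
  assume ?R
  then obtain u us vs ws where *: "l = u # us @ vs @ ws" "r = u # vs @ us @ ws" "length us = m" "length vs = n"
    "length ws = p" "u \<in> verts T" "set us \<subseteq> verts T" "set vs \<subseteq> verts T" "set ws \<subseteq> verts T" by blast
  have "bd (idS 1) T [u] [u]" "bd (symS m n) T (us @ vs) (vs @ us)" "bd (idS p) T ws ws"
    unfolding bd_id1 bd_sym unfolding bd_id using * by blast+
  then have "bd (tenS (tenS (idS 1) (symS m n)) (idS p)) T (([u] @ (us @ vs)) @ ws) (([u] @ (vs @ us)) @ ws)"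
    unfolding bd_ten by blast
  then show ?L using * by simp
qed

lemma bd_merge: "bd (sem_f (merge n)) T l r \<longleftrightarrow> l = r @ r \<and> length r = n \<and> set r \<subseteq> verts T"
proof (induction n arbitrary: l r)
  case 0
  show ?case by (auto simp: bd_id0)
next
  case (Suc n)
  \<comment> \<open>The layer after the interleaving. It expects \<open>u # u # us @ us\<close>,
    which the shuffle produces from \<open>u # us @ [u] @ us\<close> by moving the second
    \<open>u\<close> forward.\<close>
  have M: "bd (tenS mergeS (sem_f (merge n))) T c r \<longleftrightarrow>
      (\<exists>u us. c = u # u # us @ us \<and> r = u # us \<and> length us = n \<and> u \<in> verts T \<and> set us \<subseteq> verts T)" for c
    unfolding bd_ten_left[OF bd_frob(1)] Suc by auto
  show ?case (is "?L \<longleftrightarrow> ?R")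
  proof
    assume ?L
    then obtain u us vs ws u' us' where *: "l = u # us @ vs @ ws" "u # vs @ us @ ws = u' # u' # us' @ us'"
      "r = u' # us'" "length us = n" "length vs = 1" "length ws = n" "length us' = n" "u' \<in> verts T" "set us' \<subseteq> verts T"
      unfolding merge.simps sem_f.simps bd_seq M bd_shuffle by blast
    then obtain v where "vs = [v]" by (auto simp: length_Suc_conv)
    with * show ?R by auto
  next
    assume ?R
    then obtain u us where *: "r = u # us" "l = u # us @ [u] @ us" "length us = n" "u \<in> verts T" "set us \<subseteq> verts T"
      by (cases r) auto
    have "bd (tenS (tenS (idS 1) (symS n 1)) (idS n)) T l (u # u # us @ us)"
      unfolding bd_shuffle using * by (intro exI[of _ u] exI[of _ us] exI[of _ "[u]"] exI[of _ us]) simp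
    then show ?L
      unfolding merge.simps sem_f.simps bd_seq M using * by blast
  qed
qed

lemma bd_copy: "bd (sem_f (copy n)) T l r \<longleftrightarrow> r = l @ l \<and> length l = n \<and> set l \<subseteq> verts T"
proof (induction n arbitrary: l r)
  case 0
  show ?case by (auto simp: bd_id0)
next
  case (Suc n)
  have M: "bd (tenS copyS (sem_f (copy n))) T l c \<longleftrightarrow>
      (\<exists>u us. c = u # u # us @ us \<and> l = u # us \<and> length us = n \<and> u \<in> verts T \<and> set us \<subseteq> verts T)" for c
    unfolding bd_ten_left[OF bd_frob(3)] Suc by auto
  show ?case (is "?L \<longleftrightarrow> ?R")
  proof
    assume ?L
    then obtain c where c: "bd (tenS copyS (sem_f (copy n))) T l c" "bd (tenS (tenS (idS 1) (symS 1 n)) (idS n)) T c r"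
      unfolding copy.simps sem_f.simps bd_seq by blast
    obtain u us vs ws where 1: "c = u # us @ vs @ ws" "r = u # vs @ us @ ws" "length us = 1" "length vs = n" "length ws = n"
      using c(2) unfolding bd_shuffle by blast
    obtain u' us' where 2: "c = u' # u' # us' @ us'" "l = u' # us'" "length us' = n" "u' \<in> verts T" "set us' \<subseteq> verts T"
      using c(1) unfolding M by blast
    note * = 1 2
    from 1(3) obtain v where "us = [v]" by (auto simp: length_Suc_conv)
    with * show ?R by auto
  next
    assume ?R
    then obtain u us where *: "l = u # us" "r = u # us @ [u] @ us" "length us = n" "u \<in> verts T" "set us \<subseteq> verts T"
      by (cases l) auto
    have "bd (tenS (tenS (idS 1) (symS 1 n)) (idS n)) T (u # u # us @ us) r"
      unfolding bd_shuffle using * by (intro exI[of _ u] exI[of _ "[u]"] exI[of _ us] exI[of _ us]) simp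
    moreover have "bd (tenS copyS (sem_f (copy n))) T l (u # u # us @ us)"
      unfolding M using * by blast
    ultimately show ?L
      unfolding copy.simps sem_f.simps bd_seq by blast
  qed
qed

text \<open>The sides are those that make a cup determined by its outputs and a cap by its inputs,
  their only nonempty boundaries.\<close>

lemma det_frob_n:
  "rdet \<Sigma> (sem_f (unit n))" "ldet \<Sigma> (sem_f (counit n))" "ldet \<Sigma> (sem_f (merge n))" "rdet \<Sigma> (sem_f (copy n))"
proof -
  have p: "presheaf \<Sigma> (1 + (m + p)) (1 + (p + m)) (tenS (idS 1) (symS m p))" for m p
    by (rule presheaf_ten[OF presheaf_id presheaf_sym])
  show "rdet \<Sigma> (sem_f (unit n))"
    by (induction n) (simp_all add: det_id0 rdet_ten[OF presheaf_frob(2)] det_frob del: One_nat_def)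
  show "ldet \<Sigma> (sem_f (counit n))"
    by (induction n) (simp_all add: det_id0 ldet_ten[OF presheaf_frob(4)] det_frob del: One_nat_def)
  show "ldet \<Sigma> (sem_f (merge n))"
  proof (induction n)
    case (Suc n)
    have "ldet \<Sigma> (tenS (tenS (idS 1) (symS n 1)) (idS n))"
      by (rule ldet_ten[OF p ldet_ten[OF presheaf_id det_id_sym(1,3)] det_id_sym(1)])
    then show ?case
      unfolding merge.simps sem_f.simps by (rule ldet_seq) (rule ldet_ten[OF presheaf_frob(1) det_frob(1) Suc])
  qed (simp add: det_id0)
  show "rdet \<Sigma> (sem_f (copy n))"
  proof (induction n)
    case (Suc n)
    have "rdet \<Sigma> (tenS (tenS (idS 1) (symS 1 n)) (idS n))"
      by (rule rdet_ten[OF p rdet_ten[OF presheaf_id det_id_sym(2,4)] det_id_sym(2)])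
    then show ?case
      unfolding copy.simps sem_f.simps by (rule rdet_seq[rotated]) (rule rdet_ten[OF presheaf_frob(3) det_frob(5) Suc])
  qed (simp add: det_id0)
qed

lemma bd_cup: "bd (sem_f (cup x)) T l r \<longleftrightarrow> l = [] \<and> (\<exists>us. r = us @ us \<and> length us = x \<and> set us \<subseteq> verts T)"
  unfolding cup_def sem_f.simps bd_seq bd_unit bd_copy by blast

lemma bd_cap: "bd (sem_f (cap x)) T l r \<longleftrightarrow> r = [] \<and> (\<exists>us. l = us @ us \<and> length us = x \<and> set us \<subseteq> verts T)"
  unfolding cap_def sem_f.simps bd_seq bd_counit bd_merge by blast

lemma rdet_cup: "rdet \<Sigma> (sem_f (cup x))" and ldet_cap: "ldet \<Sigma> (sem_f (cap x))"
  by (simp_all add: cup_def cap_def rdet_seq ldet_seq det_frob_n)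

lemma cup_cap_typed: "f_typed \<Sigma> 0 (x + x) (cup x)" "f_typed \<Sigma> (x + x) 0 (cap x)"
  by (simp_all add: f_typed_iff cup_def cap_def)

abbreviation ctrS :: "nat \<Rightarrow> nat \<Rightarrow> nat \<Rightarrow> 'g presheaf \<Rightarrow> 'g presheaf" where
  "ctrS x m n S \<equiv> seqS (seqS (tenS (sem_f (cup x)) (idS m)) (tenS (idS x) S)) (tenS (sem_f (cap x)) (idS n))"

lemma denotes_canonical_trace:
  assumes "denotes \<Sigma> (x + m) (x + n) (interp_term \<Sigma> t) S"
  shows "denotes \<Sigma> m n (interp_term \<Sigma> (canonical_trace x m n t)) (ctrS x m n S)"
proof -
  have 1: "denotes \<Sigma> m (x + (x + m)) (csp_tensor (interp_term \<Sigma> (cup x)) (interp_term \<Sigma> (FId m)))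
      (tenS (sem_f (cup x)) (idS m))"
    using denotes_ten[OF denotes_f[OF cup_cap_typed(1)] denotes_id] by (simp add: add.assoc)
  have 2: "denotes \<Sigma> (x + (x + m)) (x + (x + n)) (csp_tensor (interp_term \<Sigma> (FId x)) (interp_term \<Sigma> t))
      (tenS (idS x) S)"
    using denotes_ten[OF denotes_id assms] by simp
  have 3: "denotes \<Sigma> (x + (x + n)) n (csp_tensor (interp_term \<Sigma> (cap x)) (interp_term \<Sigma> (FId n)))
      (tenS (sem_f (cap x)) (idS n))"
    using denotes_ten[OF denotes_f[OF cup_cap_typed(2)] denotes_id] by (simp add: add.assoc)
  show ?thesis
    unfolding canonical_trace_def using denotes_seq[OF denotes_seq[OF 1 2] 3] by simp
qed

text \<open>The cup emits \<open>us @ us\<close>: one copy enters \<open>q\<close>, the other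
  bypasses it, and the cap compares the bypass with the traced outputs of \<open>q\<close>. That is
  the feedback equation. The valuations \<open>c\<close> and \<open>d\<close> of cup and cap stay
  existential in the relation; \<open>rdet_cup\<close> and \<open>ldet_cap\<close> make them
  unique.\<close>

lemma Rep_canonical_trace:
  fixes S :: "'g presheaf"
  assumes S: "presheaf \<Sigma> (x + m) (x + n) S" and C: "presheaf \<Sigma> m n (ctrS x m n S)"
  shows "Rep \<Sigma> (ctrS x m n S) = Rep \<Sigma> (trS x S)"
proof (rule Rep_eqI[OF C presheaf_tr[OF S], where R = "\<lambda>a b. \<exists>c d q.
    a = VSeq (VSeq (VTen c (idV (drop x (lft q)))) (VTen (idV (take x (lft q))) q)) (VTen d (idV (drop x (rgt q)))) \<and>
    b = VTr x q \<and> lft c = [] \<and> rgt d = []"])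
  have sq: "length (lft q) = x + m" "length (rgt q) = x + n" "set (take x (lft q)) \<subseteq> verts T"
    "set (drop x (lft q)) \<subseteq> verts T" "set (drop x (rgt q)) \<subseteq> verts T" if "hyp \<Sigma> T" "q \<in> S T" for q and T :: "(nat, nat, 'g) hypergraph"
    using presheafD[OF S that] by (auto dest: in_set_takeD in_set_dropD)
  have mem: "rgt c = take x (lft q) @ take x (lft q) \<and> lft d = take x (lft q) @ take x (lft q) \<and> q \<in> S T \<and>
      c \<in> sem_f (cup x) T \<and> d \<in> sem_f (cap x) T"
    if T: "hyp \<Sigma> T" and a: "VSeq (VSeq (VTen c (idV (drop x (lft q)))) (VTen (idV (take x (lft q))) q))
      (VTen d (idV (drop x (rgt q)))) \<in> ctrS x m n S T" and tr: "take x (lft q) = take x (rgt q)" for c d q and T :: "(nat, nat, 'g) hypergraph"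
  proof -
    have *: "c \<in> sem_f (cup x) T" "d \<in> sem_f (cap x) T" "q \<in> S T"
      "rgt c @ drop x (lft q) = take x (lft q) @ lft q"
      "take x (lft q) @ rgt q = lft d @ drop x (rgt q)"
      using a by (auto simp: valuation_in)
    have "rgt c = take x (lft q) @ take x (lft q)"
      using *(4) append_take_drop_id[of x "lft q"] by (metis append_assoc append_same_eq)
    moreover have "lft d = take x (lft q) @ take x (lft q)"
      using *(5) append_take_drop_id[of x "rgt q"] tr by (metis append_assoc append_same_eq)
    ultimately show ?thesis using * by simp
  qed
  {
    fix T a assume T: "hyp \<Sigma> T" and a: "a \<in> ctrS x m n S T"
    obtain c ms us q d ns where a': "a = VSeq (VSeq (VTen c (idV ms)) (VTen (idV us) q)) (VTen d (idV ns))"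
      and mem': "c \<in> sem_f (cup x) T" "d \<in> sem_f (cap x) T" "q \<in> S T" "length us = x"
        "rgt c @ ms = us @ lft q" "us @ rgt q = lft d @ ns" "length ms = m" "length ns = n"
    proof -
      obtain a1 a2 where 1: "a = VSeq a1 a2" "a1 \<in> seqS (tenS (sem_f (cup x)) (idS m)) (tenS (idS x) S) T"
        "a2 \<in> tenS (sem_f (cap x)) (idS n) T" "rgt a1 = lft a2"
        using a by (rule seqS_E)
      obtain a3 a4 where 2: "a1 = VSeq a3 a4" "a3 \<in> tenS (sem_f (cup x)) (idS m) T" "a4 \<in> tenS (idS x) S T" "rgt a3 = lft a4"
        using 1(2) by (rule seqS_E)
      obtain d a5 where 3: "a2 = VTen d a5" "d \<in> sem_f (cap x) T" "a5 \<in> idS n T" using 1(3) by (rule tenS_E)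
      obtain c a6 where 4: "a3 = VTen c a6" "c \<in> sem_f (cup x) T" "a6 \<in> idS m T" using 2(2) by (rule tenS_E)
      obtain a7 q where 5: "a4 = VTen a7 q" "a7 \<in> idS x T" "q \<in> S T" using 2(3) by (rule tenS_E)
      obtain ns where 6: "a5 = idV ns" "length ns = n" using 3(3) unfolding idS_eq by blast
      obtain ms where 7: "a6 = idV ms" "length ms = m" using 4(3) unfolding idS_eq by blast
      obtain us where 8: "a7 = idV us" "length us = x" using 5(2) unfolding idS_eq by blast
      show thesis by (rule that[of c ms us q d ns]) (use 1 2 3 4 5 6 7 8 in simp_all)
    qed
    have "bd (sem_f (cup x)) T (lft c) (rgt c)" "bd (sem_f (cap x)) T (lft d) (rgt d)"
      using mem' by (auto simp: bd_def)
    then obtain us' vs where c: "lft c = []" "rgt c = us' @ us'" "length us' = x" and d: "rgt d = []" "lft d = vs @ vs" "length vs = x"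
      unfolding bd_cup bd_cap by blast
    \<comment> \<open>Cancelling the bypass wires in the first composability equation; the second
      one gives the same for the cap.\<close>
    have "us' = us" "lft q = us @ ms" using mem'(5) c mem'(4) by auto
    moreover have "vs = us" "rgt q = us @ ns" using mem'(6) d mem'(4) by auto
    ultimately show "\<exists>b \<in> trS x S T. \<exists>c d q.
      a = VSeq (VSeq (VTen c (idV (drop x (lft q)))) (VTen (idV (take x (lft q))) q)) (VTen d (idV (drop x (rgt q)))) \<and>
      b = VTr x q \<and> lft c = [] \<and> rgt d = []"
      using a' mem' c(1) d(1) by (intro bexI[of _ "VTr x q"] exI[of _ c] exI[of _ d] exI[of _ q]) (simp_all add: valuation_in)
  next
    fix T b assume T: "hyp \<Sigma> T" and "b \<in> trS x S T"
    then obtain q where q: "b = VTr x q" "q \<in> S T" "take x (lft q) = take x (rgt q)" unfolding trS_def by blast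
    let ?us = "take x (lft q)"
    note s = sq[OF T q(2)]
    have l: "length ?us = x" using s by simp
    have "bd (sem_f (cup x)) T [] (?us @ ?us)" "bd (sem_f (cap x)) T (?us @ ?us) []"
      unfolding bd_cup bd_cap using l s(3) by blast+
    then obtain c d where cd: "c \<in> sem_f (cup x) T" "lft c = []" "rgt c = ?us @ ?us" "d \<in> sem_f (cap x) T" "lft d = ?us @ ?us" "rgt d = []"
      unfolding bd_def by blast
    have 1: "?us @ drop x (rgt q) = rgt q" using append_take_drop_id[of x "rgt q"] q(3) by simp
    have m: "idV (drop x (lft q)) \<in> idS m T" "idV ?us \<in> idS x T" "idV (drop x (rgt q)) \<in> idS n T"
      unfolding idV_in using s by simp_all
    have "VSeq (VSeq (VTen c (idV (drop x (lft q)))) (VTen (idV ?us) q)) (VTen d (idV (drop x (rgt q)))) \<in> ctrS x m n S T"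
      unfolding valuation_in using cd m q(2) 1 by simp
    then show "\<exists>a \<in> ctrS x m n S T. \<exists>c d q.
      a = VSeq (VSeq (VTen c (idV (drop x (lft q)))) (VTen (idV (take x (lft q))) q)) (VTen d (idV (drop x (rgt q)))) \<and>
      b = VTr x q \<and> lft c = [] \<and> rgt d = []"
      using q(1) cd by blast
  next
    fix T a b assume "\<exists>c d q.
      a = VSeq (VSeq (VTen c (idV (drop x (lft q)))) (VTen (idV (take x (lft q))) q)) (VTen d (idV (drop x (rgt q)))) \<and>
      b = VTr x q \<and> lft c = [] \<and> rgt d = []"
    then show "lft a = lft b \<and> rgt a = rgt b" by auto
  next
    fix T a b and h :: "(nat, nat, nat, nat) hmap" assume "\<exists>c d q.
      a = VSeq (VSeq (VTen c (idV (drop x (lft q)))) (VTen (idV (take x (lft q))) q)) (VTen d (idV (drop x (rgt q)))) \<and>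
      b = VTr x q \<and> lft c = [] \<and> rgt d = []"
    then obtain c d q where "a = VSeq (VSeq (VTen c (idV (drop x (lft q)))) (VTen (idV (take x (lft q))) q)) (VTen d (idV (drop x (rgt q))))"
      "b = VTr x q" "lft c = []" "rgt d = []" by blast
    then show "\<exists>c d q.
      act h a = VSeq (VSeq (VTen c (idV (drop x (lft q)))) (VTen (idV (take x (lft q))) q)) (VTen d (idV (drop x (rgt q)))) \<and>
      act h b = VTr x q \<and> lft c = [] \<and> rgt d = []"
      by (intro exI[of _ "act h c"] exI[of _ "act h d"] exI[of _ "act h q"]) (simp add: take_map drop_map)
  next
    fix T a a' b b' assume T: "hyp \<Sigma> T" and mem1: "a \<in> ctrS x m n S T" "b \<in> trS x S T" "a' \<in> ctrS x m n S T" "b' \<in> trS x S T"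
      and "\<exists>c d q.
      a = VSeq (VSeq (VTen c (idV (drop x (lft q)))) (VTen (idV (take x (lft q))) q)) (VTen d (idV (drop x (rgt q)))) \<and>
      b = VTr x q \<and> lft c = [] \<and> rgt d = []" "\<exists>c d q.
      a' = VSeq (VSeq (VTen c (idV (drop x (lft q)))) (VTen (idV (take x (lft q))) q)) (VTen d (idV (drop x (rgt q)))) \<and>
      b' = VTr x q \<and> lft c = [] \<and> rgt d = []"
    then obtain c d q c' d' q' where
      1: "a = VSeq (VSeq (VTen c (idV (drop x (lft q)))) (VTen (idV (take x (lft q))) q)) (VTen d (idV (drop x (rgt q))))" "b = VTr x q"
      and 2: "a' = VSeq (VSeq (VTen c' (idV (drop x (lft q')))) (VTen (idV (take x (lft q'))) q')) (VTen d' (idV (drop x (rgt q'))))" "b' = VTr x q'"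
      by blast
    have "take x (lft q) = take x (rgt q)" "take x (lft q') = take x (rgt q')"
      using mem1(2,4) 1(2) 2(2) by (simp_all add: valuation_in)
    then have m: "rgt c = take x (lft q) @ take x (lft q)" "lft d = take x (lft q) @ take x (lft q)"
      "c \<in> sem_f (cup x) T" "d \<in> sem_f (cap x) T"
      "rgt c' = take x (lft q') @ take x (lft q')" "lft d' = take x (lft q') @ take x (lft q')"
      "c' \<in> sem_f (cup x) T" "d' \<in> sem_f (cap x) T"
      using mem[OF T mem1(1)[unfolded 1(1)]] mem[OF T mem1(3)[unfolded 2(1)]] by auto
    \<comment> \<open>Equal \<open>q\<close> means equal boundaries for the cups and for the
      caps.\<close>
    have "c = c'" "d = d'" if "q = q'"
      using m that rdet_cup[of \<Sigma> x] ldet_cap[of \<Sigma> x] T unfolding rdet_def ldet_def inj_on_def by auto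
    then show "a = a' \<longleftrightarrow> b = b'" unfolding 1 2 by auto
  }
qed


section \<open>Traced terms\<close>

lemma incl_typed: "t_typed \<Sigma> m n t \<Longrightarrow> f_typed \<Sigma> m n (incl_term t)"
  by (induction rule: t_typed.induct) (auto simp: f_typed_iff canonical_trace_def cup_def cap_def)

text \<open>In the trace case the interpretation runs through cup and cap, and
  \<open>Rep_canonical_trace\<close> replaces the result by \<open>trS\<close>.\<close>

lemma denotes_t: "t_typed \<Sigma> m n t \<Longrightarrow> denotes \<Sigma> m n (interp_term \<Sigma> (incl_term t)) (sem_t t)"
proof (induction rule: t_typed.induct)
  case (3 m n)
  then show ?case using denotes_sym by simp
next
  case (6 x m n t)
  have c: "denotes \<Sigma> m n (interp_term \<Sigma> (incl_term (TTr x m n t))) (ctrS x m n (sem_t t))"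
    using denotes_canonical_trace[OF 6(2)] by simp
  have p: "presheaf \<Sigma> (x + m) (x + n) (sem_t t)" "presheaf \<Sigma> m n (ctrS x m n (sem_t t))"
    using 6(2) c by (auto simp: denotes_def)
  show ?case
    using c presheaf_tr[OF p(1)] unfolding denotes_def Rep_canonical_trace[OF p] sem_t.simps by blast
qed (use denotes_gen denotes_id denotes_seq denotes_ten in auto)

lemma presheaf_t: "t_typed \<Sigma> m n u \<Longrightarrow> presheaf \<Sigma> m n (sem_t u)"
  using denotes_t by (auto simp: denotes_def)

lemma interp_t: "twf \<Sigma> u \<Longrightarrow> interp_term \<Sigma> (incl_term u) = Rep \<Sigma> (sem_t u)"
  using denotes_t[OF twf_typed] by (auto simp: denotes_def)

text \<open>Traced equations are compared semantically through \<open>interp_t\<close>, instead of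
  deriving the images from one another in \<open>f_eq\<close>.\<close>

lemma t_eq_sound: "t_eq \<Sigma> m n s t \<Longrightarrow> interp_term \<Sigma> (incl_term s) = interp_term \<Sigma> (incl_term t)"
proof (induction rule: t_eq.induct)
  case (t_cong_tr x m n t t')
  then show ?case by (simp add: canonical_trace_def)
next
  case (t_seq_assoc m n s p t q u)
  then have "twf \<Sigma> ((s ;\<^sub>t t) ;\<^sub>t u)" "twf \<Sigma> (s ;\<^sub>t (t ;\<^sub>t u))" by (auto simp: t_typed_iff)
  then show ?case using Rep_seq_assoc[OF t_seq_assoc[THEN presheaf_t]] by (simp only: interp_t sem_t.simps)
next
  case (t_id_left m n t)
  then have "twf \<Sigma> (TId m ;\<^sub>t t)" "twf \<Sigma> t" by (auto simp: t_typed_iff)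
  then show ?case using Rep_id_left[OF t_id_left[THEN presheaf_t]] by (simp only: interp_t sem_t.simps)
next
  case (t_id_right m n t)
  then have "twf \<Sigma> (t ;\<^sub>t TId n)" "twf \<Sigma> t" by (auto simp: t_typed_iff)
  then show ?case using Rep_id_right[OF t_id_right[THEN presheaf_t]] by (simp only: interp_t sem_t.simps)
next
  case (t_ten_assoc m n s m' n' t m'' n'' u)
  then have "twf \<Sigma> ((s \<otimes>\<^sub>t t) \<otimes>\<^sub>t u)" "twf \<Sigma> (s \<otimes>\<^sub>t (t \<otimes>\<^sub>t u))" by (auto simp: t_typed_iff)
  then show ?case using Rep_ten_assoc[OF t_ten_assoc[THEN presheaf_t]] by (simp only: interp_t sem_t.simps)
next
  case (t_ten_unit_left m n t)
  then have "twf \<Sigma> (TId 0 \<otimes>\<^sub>t t)" "twf \<Sigma> t" by (auto simp: t_typed_iff)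
  then show ?case using Rep_ten_unit_left[OF t_ten_unit_left[THEN presheaf_t]] by (simp only: interp_t sem_t.simps)
next
  case (t_ten_unit_right m n t)
  then have "twf \<Sigma> (t \<otimes>\<^sub>t TId 0)" "twf \<Sigma> t" by (auto simp: t_typed_iff)
  then show ?case using Rep_ten_unit_right[OF t_ten_unit_right[THEN presheaf_t]] by (simp only: interp_t sem_t.simps)
next
  case (t_ten_id m n)
  have "twf \<Sigma> (TId m \<otimes>\<^sub>t TId n)" "twf \<Sigma> (TId (m + n))" by auto
  then show ?case using Rep_ten_id by (simp only: interp_t sem_t.simps)
next
  case (t_interchange m n s p t m' n' s' p' t')
  then have "twf \<Sigma> ((s ;\<^sub>t t) \<otimes>\<^sub>t (s' ;\<^sub>t t'))" "twf \<Sigma> ((s \<otimes>\<^sub>t s') ;\<^sub>t (t \<otimes>\<^sub>t t'))" by (auto simp: t_typed_iff)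
  then show ?case using Rep_interchange[OF t_interchange[THEN presheaf_t]] by (simp only: interp_t sem_t.simps)
next
  case (t_sym_nat m n s p q t)
  then have "twf \<Sigma> ((s \<otimes>\<^sub>t t) ;\<^sub>t TSym n q)" "twf \<Sigma> (TSym m p ;\<^sub>t (t \<otimes>\<^sub>t s))" by (auto simp: t_typed_iff)
  then show ?case using Rep_sym_nat[OF t_sym_nat[THEN presheaf_t]] by (simp only: interp_t sem_t.simps)
next
  case (t_sym_inv m n)
  have "twf \<Sigma> (TSym m n ;\<^sub>t TSym n m)" "twf \<Sigma> (TId (m + n))" by auto
  then show ?case using Rep_sym_inv by (simp only: interp_t sem_t.simps)
next
  case (t_sym_hex m n p)
  have "twf \<Sigma> (TSym m (n + p))" "twf \<Sigma> ((TSym m n \<otimes>\<^sub>t TId p) ;\<^sub>t (TId n \<otimes>\<^sub>t TSym m p))" by auto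
  then show ?case using Rep_sym_hex by (simp only: interp_t sem_t.simps)
next
  case (t_sym_unit m)
  have "twf \<Sigma> (TSym m 0)" "twf \<Sigma> (TId m)" by auto
  then show ?case using Rep_sym_unit by (simp only: interp_t sem_t.simps)
next
  case (t_tightening m' m s x n t n' u)
  then have "twf \<Sigma> (TTr x m' n' ((TId x \<otimes>\<^sub>t s) ;\<^sub>t t ;\<^sub>t (TId x \<otimes>\<^sub>t u)))" "twf \<Sigma> (s ;\<^sub>t TTr x m n t ;\<^sub>t u)"
    by (auto simp: t_typed_iff)
  then show ?case using Rep_tightening[OF t_tightening[THEN presheaf_t]] by (simp only: interp_t sem_t.simps)
next
  case (t_sliding x m y n t s)
  then have "twf \<Sigma> (TTr x m n (t ;\<^sub>t (s \<otimes>\<^sub>t TId n)))" "twf \<Sigma> (TTr y m n ((s \<otimes>\<^sub>t TId m) ;\<^sub>t t))"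
    by (auto simp: t_typed_iff)
  then show ?case using Rep_sliding[OF t_sliding[THEN presheaf_t]] by (simp only: interp_t sem_t.simps)
next
  case (t_vanishing_unit m n t)
  then have "twf \<Sigma> (TTr 0 m n t)" "twf \<Sigma> t" by (auto simp: t_typed_iff)
  then show ?case using Rep_vanishing_unit[OF t_vanishing_unit[THEN presheaf_t]] by (simp only: interp_t sem_t.simps)
next
  case (t_vanishing_sum x y m n t)
  then have "twf \<Sigma> (TTr (x + y) m n t)" "twf \<Sigma> (TTr y m n (TTr x (y + m) (y + n) t))" by (auto simp: t_typed_iff)
  then show ?case using Rep_vanishing_sum[OF t_vanishing_sum[THEN presheaf_t]] by (simp only: interp_t sem_t.simps)
next
  case (t_superposing x m n t p q s)
  then have "twf \<Sigma> (TTr x (m + p) (n + q) (t \<otimes>\<^sub>t s))" "twf \<Sigma> (TTr x m n t \<otimes>\<^sub>t s)" by (auto simp: t_typed_iff)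
  then show ?case using Rep_superposing[OF t_superposing[THEN presheaf_t]] by (simp only: interp_t sem_t.simps)
next
  case (t_yanking x)
  have "twf \<Sigma> (TTr x x x (TSym x x))" "twf \<Sigma> (TId x)" by auto
  then show ?case using Rep_yanking by (simp only: interp_t sem_t.simps)
qed simp_all

section \<open>Interpretations of traced terms are balanced\<close>

lemma balanced_gen:
  assumes "\<phi> \<in> gens \<Sigma>"
  shows "\<exists>C \<in> Rep \<Sigma> (genS \<phi>). balanced (apex C) (left C) (right C)"
proof -
  define m n where "m = ar \<Sigma> \<phi>" and "n = coar \<Sigma> \<phi>"
  define F :: "(nat, nat, 'a) hypergraph" where
    "F = \<lparr>verts = {0..<m + n}, edges = {0}, src = (\<lambda>_. [0..<m]), tgt = (\<lambda>_. [m..<m + n]), lab = (\<lambda>_. \<phi>)\<rparr>"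
  have "\<lparr>apex = F, left = [0..<m], right = [m..<m + n]\<rparr> \<in> Rep \<Sigma> (genS \<phi>)"
    unfolding Rep_gen[OF assms] gen_csp_def Let_def F_def m_def n_def by (rule csp_class_self)
  moreover have fin: "finite (edges F)" by (simp add: F_def)
  have "balanced F [0..<m] [m..<m + n]"
    unfolding balanced_def in_deg_sum[OF fin] out_deg_sum[OF fin]
    by (auto simp: F_def count_list_distinct)
  ultimately show ?thesis by (intro bexI) auto
qed

text \<open>The third hypothesis covers identities and symmetries and excludes the Frobenius
  generators, which repeat or omit their vertex on one side.\<close>

lemma balanced_disc:
  assumes "set f \<subseteq> {..<k}" "set g \<subseteq> {..<k}" and "\<And>v. v < k \<Longrightarrow> count_list f v = 1 \<and> count_list g v = 1"
  shows "\<exists>C \<in> Rep \<Sigma> (discS k f g). balanced (apex C) (left C) (right C)"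
proof -
  have "\<lparr>apex = discrete k, left = f, right = g\<rparr> \<in> Rep \<Sigma> (discS k f g)"
    unfolding Rep_disc[OF assms(1,2)] disc_csp_def by (rule csp_class_self)
  moreover have "balanced (discrete k) f g"
    using assms(3) by (auto simp: balanced_def in_deg_def out_deg_def discrete_def)
  ultimately show ?thesis by (intro bexI) auto
qed

text \<open>One balanced representative is enough, since balance is invariant under isomorphism and
  all representatives are isomorphic.\<close>

lemma balanced_t: "t_typed \<Sigma> m n t \<Longrightarrow> \<exists>C \<in> Rep \<Sigma> (sem_t t). balanced (apex C) (left C) (right C)"
proof (induction rule: t_typed.induct)
  case (1 \<phi>)
  then show ?case using balanced_gen by simp
next
  case (2 n)
  show ?case unfolding sem_t.simps by (rule balanced_disc) (auto simp: count_list_distinct)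
next
  case (3 m n)
  show ?case unfolding sem_t.simps by (rule balanced_disc) (auto simp: count_list_distinct)
next
  case (4 m n s p t)
  then show ?case using Rep_seq_ex[OF presheaf_t[OF 4(1)] presheaf_t[OF 4(2)]] unfolding sem_t.simps by blast
next
  case (5 m n s p q t)
  then show ?case using Rep_ten_ex[OF presheaf_t[OF 5(1)] presheaf_t[OF 5(2)]] unfolding sem_t.simps by blast
next
  case (6 x m n t)
  then show ?case using Rep_tr_ex[OF presheaf_t[OF 6(1)]] unfolding sem_t.simps by blast
qed


section \<open>Every balanced cospan is the interpretation of a term\<close>

lemma bd_move: "bd (tenS (symS m 1) (idS n)) T l r \<longleftrightarrow>
  (\<exists>u us vs. l = us @ u # vs \<and> r = u # us @ vs \<and> length us = m \<and> length vs = n \<and>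
    {u} \<union> set us \<union> set vs \<subseteq> verts T)" (is "?L \<longleftrightarrow> ?R")
proof
  assume ?L
  then obtain us ws vs where *: "l = (us @ ws) @ vs" "r = (ws @ us) @ vs" "length us = m"
    "length ws = 1" "length vs = n" "set us \<subseteq> verts T" "set ws \<subseteq> verts T" "set vs \<subseteq> verts T"
    unfolding bd_ten bd_sym bd_id by blast
  then obtain u where "ws = [u]" by (auto simp: length_Suc_conv)
  with * show ?R by (intro exI[of _ u] exI[of _ us] exI[of _ vs]) simp
next
  assume ?R
  then obtain u us vs where *: "l = us @ u # vs" "r = u # us @ vs" "length us = m" "length vs = n"
    "u \<in> verts T" "set us \<subseteq> verts T" "set vs \<subseteq> verts T" by blast
  have "length [u] = 1" "set [u] \<subseteq> verts T" using * by auto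
  then have "bd (symS m 1) T (us @ [u]) ([u] @ us)" "bd (idS n) T vs vs"
    unfolding bd_sym bd_id using * by blast+
  then have "bd (tenS (symS m 1) (idS n)) T ((us @ [u]) @ vs) (([u] @ us) @ vs)"
    unfolding bd_ten by blast
  then show ?L using * by simp
qed

text \<open>Induction on the target list: a symmetry brings its head to the front, and the rest is
  permuted behind it. Distinctness lets the entries serve as names of wires, so that a valuation is
  an assignment \<open>f\<close> to names.\<close>

lemma permutation_term:
  assumes "distinct ps" "distinct qs" "set ps = set qs"
  shows "\<exists>t. t_typed \<Sigma> (length ps) (length qs) t \<and> ldet \<Sigma> (sem_t t) \<and>
    (\<forall>T l r. bd (sem_t t) T l r \<longleftrightarrow> (\<exists>f. f ` set ps \<subseteq> verts T \<and> l = map f ps \<and> r = map f qs))"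
  using assms
proof (induction qs arbitrary: ps)
  case Nil
  then show ?case by (intro exI[of _ "TId 0"]) (auto simp: t_typed_iff det_id0 bd_id0)
next
  case (Cons q qs)
  then obtain p1 p2 where ps: "ps = p1 @ q # p2" by (metis list.set_intros(1) split_list)
  have "distinct (p1 @ p2)" "set (p1 @ p2) = set qs" using Cons.prems ps by auto
  then obtain t where t: "t_typed \<Sigma> (length (p1 @ p2)) (length qs) t" "ldet \<Sigma> (sem_t t)"
    and bdt: "\<And>T l r. bd (sem_t t) T l r \<longleftrightarrow>
      (\<exists>f. f ` set (p1 @ p2) \<subseteq> verts T \<and> l = map f (p1 @ p2) \<and> r = map f qs)"
    using Cons.IH[of "p1 @ p2"] Cons.prems by auto
  let ?u = "(TSym (length p1) 1 \<otimes>\<^sub>t TId (length p2)) ;\<^sub>t (TId 1 \<otimes>\<^sub>t t)"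
  have "t_typed \<Sigma> (length ps) (length (q # qs)) ?u"
    using t(1) ps by (auto simp: t_typed_iff)
  moreover have "ldet \<Sigma> (sem_t ?u)"
    unfolding sem_t.simps
    by (intro ldet_seq ldet_ten[OF presheaf_sym] ldet_ten[OF presheaf_id] det_id_sym t(2))
  moreover have "bd (sem_t ?u) T l r \<longleftrightarrow> (\<exists>f. f ` set ps \<subseteq> verts T \<and> l = map f ps \<and> r = map f (q # qs))"
    (is "?L \<longleftrightarrow> ?R") for T l r
  proof
    assume ?L
    then obtain c where c: "bd (tenS (symS (length p1) 1) (idS (length p2))) T l c" "bd (tenS (idS 1) (sem_t t)) T c r"
      unfolding sem_t.simps bd_seq by blast
    obtain u us vs where 1: "l = us @ u # vs" "c = u # us @ vs" "length us = length p1" "length vs = length p2"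
      "u \<in> verts T" using c(1) unfolding bd_move by blast
    obtain l' r' where 2: "c = u # l'" "r = u # r'" "bd (sem_t t) T l' r'"
      using c(2) 1(2) unfolding bd_ten_left[OF bd_id1] by auto
    obtain f where f: "f ` set (p1 @ p2) \<subseteq> verts T" "l' = map f (p1 @ p2)" "r' = map f qs"
      using 2(3) bdt by blast
    have q: "q \<notin> set p1" "q \<notin> set p2" "q \<notin> set qs" using Cons.prems ps by auto
    \<comment> \<open>The head wire gets its value by updating \<open>f\<close> at \<open>q\<close>;
      this leaves the other wires alone because \<open>q\<close> occurs only once.\<close>
    have "us = map f p1" "vs = map f p2" using 1 2(1) f(2) by auto
    then have "l = map (f(q := u)) ps" "r = map (f(q := u)) (q # qs)"
      using 1(1) 2(2) f(3) ps q by auto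
    moreover have "(f(q := u)) ` set ps \<subseteq> verts T" using f(1) 1(5) ps by auto
    ultimately show ?R by blast
  next
    assume ?R
    then obtain f where f: "f ` set ps \<subseteq> verts T" "l = map f ps" "r = map f (q # qs)" by blast
    have "bd (tenS (symS (length p1) 1) (idS (length p2))) T l (f q # map f p1 @ map f p2)"
      unfolding bd_move using f ps by (intro exI[of _ "f q"] exI[of _ "map f p1"] exI[of _ "map f p2"]) auto
    moreover have "bd (sem_t t) T (map f (p1 @ p2)) (map f qs)" unfolding bdt using f(1) ps by (intro exI[of _ f]) auto
    then have "bd (tenS (idS 1) (sem_t t)) T (f q # map f p1 @ map f p2) r"
      unfolding bd_ten_left[OF bd_id1] using f ps by auto
    ultimately show ?L unfolding sem_t.simps bd_seq by blast
  qed
  ultimately show ?case by (intro exI[of _ ?u]) blast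
qed

section \<open>The tensor of all generators\<close>

primrec gens_term :: "'g list \<Rightarrow> 'g tterm" where
  "gens_term [] = TId 0"
| "gens_term (\<phi> # \<phi>s) = TGen \<phi> \<otimes>\<^sub>t gens_term \<phi>s"

primrec gens_val :: "(nat, nat, 'g) hypergraph \<Rightarrow> nat list \<Rightarrow> (nat, nat) valuation" where
  "gens_val T [] = idV []"
| "gens_val T (e # es) = VTen (VLeaf [e] [] (src T e) (tgt T e)) (gens_val T es)"

lemma gens_term_typed:
  "set \<phi>s \<subseteq> gens \<Sigma> \<Longrightarrow>
   t_typed \<Sigma> (sum_list (map (ar \<Sigma>) \<phi>s)) (sum_list (map (coar \<Sigma>) \<phi>s)) (gens_term \<phi>s)"
  by (induction \<phi>s) (auto simp: t_typed_iff)

lemma lft_gens_val [simp]: "lft (gens_val T es) = concat (map (src T) es)"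
  by (induction es) auto

lemma rgt_gens_val [simp]: "rgt (gens_val T es) = concat (map (tgt T) es)"
  by (induction es) auto

lemma sem_gens_term:
  "sem_t (gens_term \<phi>s) T = {gens_val T es | es. set es \<subseteq> edges T \<and> map (lab T) es = \<phi>s}"
proof (induction \<phi>s)
  case Nil
  then show ?case by (auto simp: discS_def)
next
  case (Cons \<phi> \<phi>s)
  show ?case
  proof (intro equalityI subsetI)
    fix a assume "a \<in> sem_t (gens_term (\<phi> # \<phi>s)) T"
    then obtain b c where a: "a = VTen b c" "b \<in> genS \<phi> T" "c \<in> sem_t (gens_term \<phi>s) T"
      by (auto simp: tenS_def)
    obtain e where e: "b = VLeaf [e] [] (src T e) (tgt T e)" "e \<in> edges T" "lab T e = \<phi>"
      using a(2) by (auto simp: genS_def)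
    obtain es where es: "c = gens_val T es" "set es \<subseteq> edges T" "map (lab T) es = \<phi>s"
      using a(3) Cons by blast
    show "a \<in> {gens_val T es | es. set es \<subseteq> edges T \<and> map (lab T) es = \<phi> # \<phi>s}"
      using a e es by (intro CollectI exI[of _ "e # es"]) simp
  next
    fix a assume "a \<in> {gens_val T es | es. set es \<subseteq> edges T \<and> map (lab T) es = \<phi> # \<phi>s}"
    then obtain e es where "a = gens_val T (e # es)" "set (e # es) \<subseteq> edges T" "map (lab T) (e # es) = \<phi> # \<phi>s"
      by (auto simp: map_eq_Cons_conv)
    then show "a \<in> sem_t (gens_term (\<phi> # \<phi>s)) T"
      using Cons by (auto simp: valuation_in genS_def)
  qed
qed

lemma act_gens_val:
  assumes "hyp_mor F T h" "set es \<subseteq> edges F"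
  shows "act h (gens_val F es) = gens_val T (map (snd h) es)"
  using assms(2) assms(1) by (induction es) (auto simp: hyp_mor_def)

lemma act_gens_val_eqD:
  "act h (gens_val F es) = act k (gens_val F es) \<Longrightarrow> map (snd h) es = map (snd k) es"
  by (induction es) auto

text \<open>Equal block lengths let both concatenations be cut at the same places.\<close>

lemma concat_map_eqD:
  assumes "concat (map s' es) = map f (concat (map s es))" "\<And>e. e \<in> set es \<Longrightarrow> length (s' e) = length (s e)"
    "e \<in> set es"
  shows "s' e = map f (s e)"
  using assms
proof (induction es)
  case (Cons d es)
  have "s' d = map f (s d)" "concat (map s' es) = map f (concat (map s es))"
    using Cons.prems(1,2) by (auto simp: append_eq_append_conv)
  then show ?case using Cons by auto
qed simp

lemma count_list_concat: "distinct es \<Longrightarrow> count_list (concat (map s es)) v = (\<Sum>e \<in> set es. count_list (s e) v)"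
  by (induction es) auto

lemma distinct_set_count:
  assumes "\<And>v. count_list xs v = (if v \<in> A then 1 else 0)"
  shows "distinct xs" "set xs = A"
proof -
  show "distinct xs" unfolding distinct_iff_count_list using assms by simp
  show "set xs = A" using assms count_list_0_iff by (metis equalityI one_neq_zero subsetI)
qed

text \<open>Balance makes both \<open>B @ I @ L\<close> and \<open>A @ I @ R\<close> enumerations of
  the vertices: each vertex begins exactly once, as a target, a loop or an input, and ends exactly
  once, as a source, a loop or an output. A valuation of the resulting term is an assignment of
  vertices and edges subject to the incidence equations, hence a morphism from
  \<open>F\<close>.\<close>

lemma balanced_representable:
  fixes F :: "(nat, nat, 'g) hypergraph"
  assumes F: "hyp \<Sigma> F" and bal: "balanced F L R" and LR: "set L \<subseteq> verts F" "set R \<subseteq> verts F"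
  shows "\<exists>t a. t_typed \<Sigma> (length L) (length R) t \<and> universal \<Sigma> (sem_t t) F a \<and> lft a = L \<and> rgt a = R"
proof -
  have fin: "finite (verts F)" "finite (edges F)" using F by (auto simp: hyp_def)
  obtain es where es: "set es = edges F" "distinct es" using finite_distinct_list[OF fin(2)] by blast
  \<comment> \<open>The closed loops: by balance, a zero count on the left means also no occurrence
    on the right. A vertex on both interfaces is excluded, as it counts once in
    \<open>L\<close>.\<close>
  obtain I where I: "set I = {v \<in> verts F. count_list L v + in_deg F v = 0}" "distinct I"
    using finite_distinct_list[of "{v \<in> verts F. count_list L v + in_deg F v = 0}"] fin(1) by auto
  define A where "A = concat (map (src F) es)"
  define B where "B = concat (map (tgt F) es)"
  have AB: "count_list A v = out_deg F v" "count_list B v = in_deg F v" for v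
    unfolding A_def B_def count_list_concat[OF es(2)] in_deg_sum[OF fin(2)] out_deg_sum[OF fin(2)] es(1)
    by simp_all
  have ABv: "set A \<subseteq> verts F" "set B \<subseteq> verts F"
    using F es(1) by (auto simp: A_def B_def hyp_def)
  have b: "count_list L v + in_deg F v = count_list R v + out_deg F v" "count_list L v + in_deg F v \<le> 1"
    if "v \<in> verts F" for v using bal that unfolding balanced_def by blast+
  have cnt: "count_list ((B @ I) @ L) v = (if v \<in> verts F then 1 else 0)"
    "count_list (A @ I @ R) v = (if v \<in> verts F then 1 else 0)" for v
  proof -
    show "count_list ((B @ I) @ L) v = (if v \<in> verts F then 1 else 0)"
    proof (cases "v \<in> verts F")
      case True
      then show ?thesis using b(2)[OF True] I by (simp add: AB count_list_distinct)
    next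
      case False
      then have "v \<notin> set B" "v \<notin> set I" "v \<notin> set L" using LR ABv I by auto
      with False show ?thesis by simp
    qed
    show "count_list (A @ I @ R) v = (if v \<in> verts F then 1 else 0)"
    proof (cases "v \<in> verts F")
      case True
      then show ?thesis using b[OF True] I by (simp add: AB count_list_distinct)
    next
      case False
      then have "v \<notin> set A" "v \<notin> set I" "v \<notin> set R" using LR ABv I by auto
      with False show ?thesis by simp
    qed
  qed
  note P = distinct_set_count[OF cnt(1)] and Q = distinct_set_count[OF cnt(2)]
  obtain p where p: "t_typed \<Sigma> (length ((B @ I) @ L)) (length (A @ I @ R)) p" "ldet \<Sigma> (sem_t p)"
    and bdp: "\<And>T l r. bd (sem_t p) T l r \<longleftrightarrow>
      (\<exists>f. f ` verts F \<subseteq> verts T \<and> l = map f ((B @ I) @ L) \<and> r = map f (A @ I @ R))"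
    using permutation_term[OF P(1) Q(1), of \<Sigma>] P(2) Q(2) by auto
  note pp = presheafD[OF presheaf_t[OF p(1)]]
  let ?x = "length (B @ I)" and ?i = "length I" and ?n = "length R" and ?\<phi>s = "map (lab F) es"
  have len: "length (src F e) = ar \<Sigma> (lab F e)" "length (tgt F e) = coar \<Sigma> (lab F e)" "lab F e \<in> gens \<Sigma>"
    if "e \<in> edges F" for e using F that by (auto simp: hyp_def)
  have g: "t_typed \<Sigma> (length A) (length B) (gens_term ?\<phi>s)"
  proof -
    have "map (ar \<Sigma>) ?\<phi>s = map (length \<circ> src F) es" "map (coar \<Sigma>) ?\<phi>s = map (length \<circ> tgt F) es"
      using len es(1) by simp_all
    then have "sum_list (map (ar \<Sigma>) ?\<phi>s) = length A" "sum_list (map (coar \<Sigma>) ?\<phi>s) = length B"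
      by (simp_all only: A_def B_def length_concat map_map)
    moreover have "set ?\<phi>s \<subseteq> gens \<Sigma>" using len es(1) by auto
    ultimately show ?thesis using gens_term_typed by metis
  qed
  \<comment> \<open>The permutation sends \<open>B @ I @ L\<close> to \<open>A @ I @ R\<close>; the
    generators then turn \<open>A\<close> into \<open>B\<close>, so the wires fed back are again
    \<open>B @ I\<close>, and \<open>R\<close> leaves the trace.\<close>
  let ?t = "TTr ?x (length L) ?n (p ;\<^sub>t (gens_term ?\<phi>s \<otimes>\<^sub>t TId ?i \<otimes>\<^sub>t TId ?n))"
  have t: "t_typed \<Sigma> (length L) ?n ?t"
    using p(1) g by (auto simp: t_typed_iff)
  \<comment> \<open>The universal valuation names every wire by its own vertex, the identity
    assignment.\<close>
  have "bd (sem_t p) F ((B @ I) @ L) (A @ I @ R)"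
    unfolding bdp by (intro exI[of _ id]) simp
  then obtain a0 where a0: "a0 \<in> sem_t p F" "lft a0 = (B @ I) @ L" "rgt a0 = A @ I @ R"
    unfolding bd_def by blast
  define a where "a = VTr ?x (VSeq a0 (VTen (VTen (gens_val F es) (idV I)) (idV R)))"
  have bnd: "lft a = L" "rgt a = R" using a0 by (simp_all add: a_def B_def)
  have "universal \<Sigma> (sem_t ?t) F a"
  proof (rule universalI[OF F])
    have "gens_val F es \<in> sem_t (gens_term ?\<phi>s) F" unfolding sem_gens_term using es(1) by blast
    moreover have "idV I \<in> idS ?i F" "idV R \<in> idS ?n F" unfolding idV_in using I LR by auto
    ultimately show "a \<in> sem_t ?t F"
      unfolding a_def sem_t.simps valuation_in using a0 by (simp add: A_def B_def)
  next
    fix T b assume T: "hyp \<Sigma> T" and "b \<in> sem_t ?t T"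
    then obtain c where c: "b = VTr ?x c" "c \<in> seqS (sem_t p) (tenS (tenS (sem_t (gens_term ?\<phi>s)) (idS ?i)) (idS ?n)) T"
      "take ?x (lft c) = take ?x (rgt c)"
      unfolding sem_t.simps trS_def by blast
    obtain b0 b1 where b1: "c = VSeq b0 b1" "b0 \<in> sem_t p T" "b1 \<in> tenS (tenS (sem_t (gens_term ?\<phi>s)) (idS ?i)) (idS ?n) T" "rgt b0 = lft b1"
      using c(2) by (rule seqS_E)
    obtain b2 b3 where b2: "b1 = VTen b2 b3" "b2 \<in> tenS (sem_t (gens_term ?\<phi>s)) (idS ?i) T" "b3 \<in> idS ?n T"
      using b1(3) by (rule tenS_E)
    obtain b4 b5 where b4: "b2 = VTen b4 b5" "b4 \<in> sem_t (gens_term ?\<phi>s) T" "b5 \<in> idS ?i T"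
      using b2(2) by (rule tenS_E)
    obtain Rs where Rs: "b3 = idV Rs" "length Rs = ?n" using b2(3) unfolding idS_eq by blast
    obtain Is where Is: "b5 = idV Is" "length Is = ?i" using b4(3) unfolding idS_eq by blast
    obtain es' where es': "b4 = gens_val T es'" "set es' \<subseteq> edges T" "map (lab T) es' = ?\<phi>s"
      using b4(2) unfolding sem_gens_term by blast
    have "bd (sem_t p) T (lft b0) (rgt b0)" using b1(2) by (auto simp: bd_def)
    then obtain f where f: "f ` verts F \<subseteq> verts T" "lft b0 = map f ((B @ I) @ L)" "rgt b0 = map f (A @ I @ R)"
      unfolding bdp by blast
    have "length es' = length es" using arg_cong[OF es'(3), of length] by simp
    \<comment> \<open>Sends the i-th edge of \<open>es\<close> to the i-th edge of
      \<open>es'\<close>; a function of the edge because \<open>es\<close> is distinct.\<close>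
    define h where "h e = es' ! (SOME i. i < length es \<and> es ! i = e)" for e
    have "h (es ! i) = es' ! i" if "i < length es" for i
    proof -
      have "(SOME j. j < length es \<and> es ! j = es ! i) = i"
        using that es(2) by (intro some_equality) (auto simp: nth_eq_iff_index_eq)
      then show ?thesis by (simp add: h_def)
    qed
    then have h: "es' = map h es" using \<open>length es' = length es\<close> by (intro nth_equalityI) auto
    have hE: "h e \<in> edges T" "lab T (h e) = lab F e" if "e \<in> edges F" for e
      using that es(1) es'(2,3) h by auto
    have len': "length (src T (h e)) = length (src F e)" "length (tgt T (h e)) = length (tgt F e)"
      if "e \<in> set es" for e
      using that es(1) hE[of e] len[of e] T by (auto simp: hyp_def)
    \<comment> \<open>Composability, cut into blocks below: an edge and its image share a label and
      hence arities, so the blocks have the same lengths on both sides. The first block expresses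
      compatibility with sources.\<close>
    have eq: "map f A @ map f I @ map f R = concat (map (src T) es') @ Is @ Rs"
      using b1(4) f(3) b2(1) b4(1) Rs(1) Is(1) es'(1) by simp
    have "map (length \<circ> src T) es' = map (length \<circ> src F) es" "map (length \<circ> tgt T) es' = map (length \<circ> tgt F) es"
      using len' by (simp_all add: h)
    then have lA: "length (concat (map (src T) es')) = length A" and lB: "length (concat (map (tgt T) es')) = length B"
      by (simp_all add: A_def B_def length_concat)
    have eqA: "concat (map (src T) es') = map f A" and "Is = map f I" and "Rs = map f R"
      using eq lA Is(2) by auto
    \<comment> \<open>The trace condition; its first block expresses compatibility with
      targets.\<close>
    have "take ?x (map f ((B @ I) @ L)) = take ?x (concat (map (tgt T) es') @ Is @ Rs)"
      using c(3) b1(1) f(2) b2(1) b4(1) Rs(1) Is(1) es'(1) by simp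
    then have eqB: "concat (map (tgt T) es') = map f B"
      using lB Is(2) by simp
    have mor: "hyp_mor F T (f, h)"
      unfolding hyp_mor_def
    proof (intro conjI ballI)
      fix e assume e: "e \<in> edges F"
      have 1: "concat (map (src T \<circ> h) es) = map f (concat (map (src F) es))"
        "concat (map (tgt T \<circ> h) es) = map f (concat (map (tgt F) es))"
        using eqA eqB by (simp_all add: h A_def B_def)
      show "src T (snd (f, h) e) = map (fst (f, h)) (src F e)"
        using concat_map_eqD[OF 1(1), of e] len' e es(1) by simp
      show "tgt T (snd (f, h) e) = map (fst (f, h)) (tgt F e)"
        using concat_map_eqD[OF 1(2), of e] len' e es(1) by simp
      show "lab T (snd (f, h) e) = lab F e" using hE(2)[OF e] by simp
    qed (use f(1) hE(1) in auto)
    \<comment> \<open>The valuation of the permutation is known only by its boundary, which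
      \<open>ldet\<close> turns into equality.\<close>
    have "inj_on lft (sem_t p T)" using p(2) T by (simp add: ldet_def)
    moreover have "lft (act (f, h) a0) = lft b0" using f(2) a0(2) by simp
    ultimately have "act (f, h) a0 = b0"
      using inj_onD pp(7)[OF F a0(1) T mor] b1(2) by metis
    then have "act (f, h) a = b"
      using c(1) b1(1) b2(1) b4(1) Rs(1) Is(1) es'(1) h es(1) act_gens_val[OF mor]
        \<open>Is = map f I\<close> \<open>Rs = map f R\<close> by (simp add: a_def)
    then show "\<exists>h. hyp_mor F T h \<and> act h a = b" using mor by blast
  next
    fix T :: "(nat, nat, 'g) hypergraph" and h k :: "(nat, nat, nat, nat) hmap"
    assume eq: "act h a = act k a"
    then have "lft (act h a0) = lft (act k a0)" "map (snd h) es = map (snd k) es"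
      using act_gens_val_eqD[of h F es k] by (simp_all add: a_def)
    \<comment> \<open>The left boundary of \<open>a0\<close> lists every vertex and
      \<open>es\<close> every edge, so the valuation already fixes the morphism.\<close>
    then have "\<forall>v \<in> set ((B @ I) @ L). fst h v = fst k v" "\<forall>e \<in> set es. snd h e = snd k e"
      using a0(2) by auto
    then show "hmap_eq F h k" unfolding P(2) es(1) by (simp add: hmap_eq_def)
  qed
  then show ?thesis using t bnd by blast
qed


section \<open>The characterisation\<close>

text \<open>Soundness of both theories makes all members of the nested unions equal, and reflexivity
  makes the unions nonempty.\<close>

lemma interp_incl:
  assumes t: "t_typed \<Sigma> m n t"
  shows "interp \<Sigma> (incl \<Sigma> m n ({(s, t). t_eq \<Sigma> m n s t} `` {t})) = Rep \<Sigma> (sem_t t)"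
proof -
  have I: "interp_term \<Sigma> (incl_term t) = Rep \<Sigma> (sem_t t)"
    using t by (simp add: interp_t t_typed_iff)
  have "interp_term \<Sigma> u = Rep \<Sigma> (sem_t t)" if "t_eq \<Sigma> m n t s" "f_eq \<Sigma> m n (incl_term s) u" for s u
    using I t_eq_sound[OF that(1)] f_eq_sound[OF that(2)] by simp
  moreover have "t_eq \<Sigma> m n t t" "f_eq \<Sigma> m n (incl_term t) (incl_term t)"
    using t_refl[OF t] f_refl[OF incl_typed[OF t]] .
  ultimately show ?thesis unfolding interp_def incl_def by blast
qed

lemma image_stmc_hom:
  "(\<lambda>X. interp \<Sigma> (incl \<Sigma> m n X)) ` stmc_hom \<Sigma> m n = (\<lambda>t. Rep \<Sigma> (sem_t t)) ` {t. t_typed \<Sigma> m n t}"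
proof -
  have "stmc_hom \<Sigma> m n = (\<lambda>t. {(s, t). t_eq \<Sigma> m n s t} `` {t}) ` {t. t_typed \<Sigma> m n t}"
    unfolding stmc_hom_def quotient_def by blast
  then show ?thesis
    unfolding image_image by (simp only: image_image) (intro image_cong refl, simp only: interp_incl mem_Collect_eq)
qed

theorem theorem3p35:
  fixes \<Sigma> :: "'g signature" and m n :: nat and C :: "('v, 'e, 'g) cospan"
  assumes "is_cospan \<Sigma> m n C"
  shows "csp_class C \<in> (\<lambda>X. interp \<Sigma> (incl \<Sigma> m n X)) ` stmc_hom \<Sigma> m n \<longleftrightarrow> partial_monogamous C"
proof -
  \<comment> \<open>The types of \<open>C\<close> are arbitrary; the results on \<open>Rep\<close>
    apply to a copy over \<open>nat\<close>.\<close>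
  obtain N :: "(nat, nat, 'g) cospan" where N: "cospan_iso C N" using nat_copy[OF assms] .
  have cN: "is_cospan \<Sigma> m n N" using is_cospan_iso[OF N assms] .
  have "csp_class C \<in> (\<lambda>t. Rep \<Sigma> (sem_t t)) ` {t. t_typed \<Sigma> m n t} \<longleftrightarrow> balanced (apex N) (left N) (right N)"
  proof
    assume "csp_class C \<in> (\<lambda>t. Rep \<Sigma> (sem_t t)) ` {t. t_typed \<Sigma> m n t}"
    then obtain t where t: "t_typed \<Sigma> m n t" "csp_class C = Rep \<Sigma> (sem_t t)" by blast
    obtain D where D: "D \<in> Rep \<Sigma> (sem_t t)" "balanced (apex D) (left D) (right D)"
      using balanced_t[OF t(1)] by blast
    \<comment> \<open>Both \<open>D\<close> and \<open>N\<close> represent the same presheaf, so the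
      balance of \<open>D\<close> passes to \<open>N\<close>.\<close>
    have "N \<in> Rep \<Sigma> (sem_t t)" using N t(2) by (auto simp: csp_class_def)
    then show "balanced (apex N) (left N) (right N)"
      using balanced_iso[OF Rep_iso[OF presheaf_t[OF t(1)] D(1)] Rep_is_cospan[OF presheaf_t[OF t(1)] D(1)] D(2)] by blast
  next
    assume "balanced (apex N) (left N) (right N)"
    then obtain t a where t: "t_typed \<Sigma> m n t" "universal \<Sigma> (sem_t t) (apex N) a" "lft a = left N" "rgt a = right N"
      using balanced_representable[of \<Sigma> "apex N" "left N" "right N"] cN by (auto simp: is_cospan_def)
    then have "N \<in> Rep \<Sigma> (sem_t t)" by (auto simp: Rep_def)
    then have "csp_class C = Rep \<Sigma> (sem_t t)"
      using Rep_class[OF presheaf_t[OF t(1)]] csp_class_eq[OF N assms] by simp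
    then show "csp_class C \<in> (\<lambda>t. Rep \<Sigma> (sem_t t)) ` {t. t_typed \<Sigma> m n t}" using t(1) by blast
  qed
  moreover have "balanced (apex N) (left N) (right N) \<longleftrightarrow> partial_monogamous C"
    unfolding partial_monogamous_iff_balanced[OF assms]
    using balanced_iso[OF N assms] balanced_iso[OF cospan_iso_sym[OF N assms] cN] by blast
  ultimately show ?thesis unfolding image_stmc_hom by blast
qed

end
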